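(* Let $n\ge 1$ be an integer, $0<\gamma<n$, $q=n/(n-\gamma)$ and $w\in A_{1,q}$. Assume that $1\le\alpha<\beta<s\le\infty$ with $1/\beta=1/\alpha-\gamma/n$, that $\mu\in\Delta_2$ and that $b\in BMO(\mathbb R^n)$. Then there is a constant $C>0$, independent of $f$, $\lambda$ and $r$, such that for every $\lambda>0$, every $r>0$ and every locally integrable function $f$ on $\mathbb R^n$, $$\Big\|w^q(B(y,r))^{1/\beta-1/q-1/s}\cdot\Big[w^q\big(\big\{x\in B(y,r):|[b,I_\gamma]f(x)|>\lambda\big\}\big)\Big]^{1/q}\Big\|_{L^s(\mu)}\le C\,\Big\|\Phi\Big(\frac{|f|}{\lambda}\Big)\Big\|_{(L\log L,L^s)^{\alpha}(w,w^q;\mu)},$$ where the $L^s(\mu)$-norm on the left is taken in the variable $y\in\mathbb R^n$ and $\Phi(t)=t(1+\log^+t)$, $\log^+t=\max\{\log t,0\}$. (The inequality is trivial when the right-hand side is infinite.)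
   Context: A weight is a non-negative locally integrable function on $\mathbb R^n$; for a weight $w$ and measurable $E$, $w(E)=\int_E w(x)\,dx$, and $w^q(E)=\int_E w(x)^q\,dx$. $B(y,r)$ is the open Euclidean ball with center $y$ and radius $r$. Linear commutator of the fractional integral operator: $[b,I_\gamma]f(x)=\frac{1}{\zeta(\gamma)}\int_{\mathbb R^n}\frac{[b(x)-b(y)]f(y)}{|x-y|^{n-\gamma}}\,dy$, with $\zeta(\gamma)=\frac{\pi^{n/2}2^\gamma\Gamma(\gamma/2)}{\Gamma((n-\gamma)/2)}$. $BMO(\mathbb R^n)$: locally integrable $b$ with $\|b\|_*=\sup_B\frac1{|B|}\int_B|b-b_B|\,dx<\infty$, the supremum over all balls, $b_B$ the mean of $b$ over $B$. For $1<q<\infty$, $w\in A_{1,q}$ means: there is $C>0$ such that for every ball $B$, $\left(\frac1{|B|}\int_B w^q\,dx\right)^{1/q}\left(\operatorname{ess\,sup}_{x\in B}\frac1{w(x)}\right)\le C$. $\mu\in\Delta_2$ means that $\mu$ is a weight and there is $C>0$ with $\mu(2B)\le C\mu(B)$ for every ball $B$ ($2B$ is the concentric ball with twice the radius). $L^s(\mu)$ is the $L^s$ space with respect to $\mu(y)\,dy$, with the usual modification when $s=\infty$. Weighted Luxemburg norm: for a weight $\nu$ and a ball $B$, $\|f\|_{L\log L(\nu),B}=\inf\{\sigma>0:\frac1{\nu(B)}\int_B\Phi(|f(x)|/\sigma)\,\nu(x)\,dx\le1\}$ with $\Phi(t)=t(1+\log^+t)$. Weighted amalgam space of $L\log L$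 type: for $1\le\alpha\le s\le\infty$ and weights $\nu,w,\mu$, $$\|f\|_{(L\log L,L^s)^{\alpha}(\nu,w;\mu)}:=\sup_{r>0}\Big\|w(B(y,r))^{1/\alpha-1-1/s}\,\nu(B(y,r))\,\|f\|_{L\log L(\nu),B(y,r)}\Big\|_{L^s(\mu)},$$ the $L^s(\mu)$-norm being taken in $y$. *)

theory Defs
  imports "HOL-Analysis.Analysis" "HOL-Probability.Essential_Supremum"
begin

definition locally_integrable :: "(real^'n \<Rightarrow> 'b::euclidean_space) \<Rightarrow> bool" where
  "locally_integrable f \<longleftrightarrow> (\<forall>K. compact K \<longrightarrow> f absolutely_integrable_on K)"

definition weight :: "(real^'n \<Rightarrow> real) \<Rightarrow> bool" where
  "weight w \<longleftrightarrow> (\<forall>x. 0 \<le> w x) \<and> locally_integrable w"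

definition wmeas :: "(real^'n \<Rightarrow> real) \<Rightarrow> (real^'n) set \<Rightarrow> ennreal" where
  "wmeas w E = (\<integral>\<^sup>+x\<in>E. ennreal (w x) \<partial>lebesgue)"

text \<open>Real powers on \<open>[0,\<infinity>]\<close>, with \<open>0\<^sup>p = \<infinity>\<close> and \<open>\<infinity>\<^sup>p = 0\<close> for \<open>p < 0\<close>,
  and \<open>x\<^sup>0 = 1\<close> for all \<open>x\<close>.\<close>

definition epowr :: "ennreal \<Rightarrow> real \<Rightarrow> ennreal" where
  "epowr x p =
    (if p = 0 then 1
     else if x = 0 then (if p < 0 then \<infinity> else 0)
     else if x = \<infinity> then (if p < 0 then 0 else \<infinity>)
     else ennreal (enn2real x powr p))"

text \<open>The exponent \<open>1/s\<close> for \<open>1 \<le> s \<le> \<infinity>\<close>, with \<open>1/\<infinity> = 0\<close>.\<close>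

definition recip :: "ennreal \<Rightarrow> real" where
  "recip s = enn2real (1 / s)"

definition Ls_norm :: "ennreal \<Rightarrow> (real^'n \<Rightarrow> real) \<Rightarrow> (real^'n \<Rightarrow> ennreal) \<Rightarrow> ennreal" where
  "Ls_norm s \<mu> F =
    (if s = \<infinity> then esssup (density lebesgue (\<lambda>y. ennreal (\<mu> y))) F
     else epowr (\<integral>\<^sup>+y. epowr (F y) (enn2real s) * ennreal (\<mu> y) \<partial>lebesgue) (recip s))"

text \<open>The quotient \<open>1 / w\<close> is formed in \<open>[0,\<infinity>]\<close>, so that it is \<open>\<infinity>\<close> where \<open>w\<close> vanishes.\<close>

definition A1_class :: "real \<Rightarrow> (real^'n \<Rightarrow> real) \<Rightarrow> bool" where
  "A1_class q w \<longleftrightarrow> weight w \<and>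
    (\<exists>C>0. \<forall>y. \<forall>r>0.
      epowr (wmeas (\<lambda>x. w x powr q) (ball y r) / emeasure lebesgue (ball y r)) (1 / q)
        * esssup (restrict_space lebesgue (ball y r)) (\<lambda>x. 1 / ennreal (w x))
      \<le> ennreal C)"

definition doubling :: "(real^'n \<Rightarrow> real) \<Rightarrow> bool" where
  "doubling \<mu> \<longleftrightarrow> weight \<mu> \<and>
    (\<exists>C>0. \<forall>y. \<forall>r>0. wmeas \<mu> (ball y (2 * r)) \<le> ennreal C * wmeas \<mu> (ball y r))"

definition ball_mean :: "(real^'n \<Rightarrow> complex) \<Rightarrow> (real^'n) set \<Rightarrow> complex" where
  "ball_mean b B = (LINT x:B|lebesgue. b x) / complex_of_real (measure lebesgue B)"

definition BMO_norm :: "(real^'n \<Rightarrow> complex) \<Rightarrow> ennreal" where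
  "BMO_norm b =
    (SUP (y, r) \<in> UNIV \<times> {0<..}.
      (\<integral>\<^sup>+x\<in>ball y r. ennreal (norm (b x - ball_mean b (ball y r))) \<partial>lebesgue)
        / emeasure lebesgue (ball y r))"

definition BMO :: "(real^'n \<Rightarrow> complex) set" where
  "BMO = {b. locally_integrable b \<and> BMO_norm b < \<infinity>}"

definition riesz_const :: "real \<Rightarrow> real \<Rightarrow> real" where
  "riesz_const n \<gamma> = pi powr (n / 2) * 2 powr \<gamma> * Gamma (\<gamma> / 2) / Gamma ((n - \<gamma>) / 2)"

text \<open>At points \<open>x\<close> where the integral does not converge absolutely, the Bochner integral
  returns \<open>0\<close>.\<close>

definition commutator ::
    "(real^'n \<Rightarrow> complex) \<Rightarrow> real \<Rightarrow> (real^'n \<Rightarrow> complex) \<Rightarrow> real^'n \<Rightarrow> complex" where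
  "commutator b \<gamma> f x =
    complex_of_real (1 / riesz_const (real CARD('n)) \<gamma>) *
    (LINT y|lebesgue. (b x - b y) * f y
        / complex_of_real (norm (x - y) powr (real CARD('n) - \<gamma>)))"

text \<open>Since \<open>ln 0 = 0\<close>, this gives \<open>\<Phi>(0) = 0\<close>, as it should.\<close>

definition Phi :: "real \<Rightarrow> real" where
  "Phi t = t * (1 + max (ln t) 0)"

definition LlogL_norm :: "(real^'n \<Rightarrow> real) \<Rightarrow> (real^'n) set \<Rightarrow> (real^'n \<Rightarrow> real) \<Rightarrow> ennreal" where
  "LlogL_norm \<nu> B f =
    Inf {ennreal \<sigma> | \<sigma>. 0 < \<sigma> \<and>
      (\<integral>\<^sup>+x\<in>B. ennreal (Phi (\<bar>f x\<bar> / \<sigma>) * \<nu> x) \<partial>lebesgue) / wmeas \<nu> B \<le> 1}"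

definition amalgam_LlogL_norm ::
    "real \<Rightarrow> ennreal \<Rightarrow> (real^'n \<Rightarrow> real) \<Rightarrow> (real^'n \<Rightarrow> real) \<Rightarrow> (real^'n \<Rightarrow> real)
      \<Rightarrow> (real^'n \<Rightarrow> real) \<Rightarrow> ennreal" where
  "amalgam_LlogL_norm \<alpha> s \<nu> w \<mu> f =
    (SUP r\<in>{0<..}. Ls_norm s \<mu> (\<lambda>y.
      epowr (wmeas w (ball y r)) (1 / \<alpha> - 1 - recip s)
        * wmeas \<nu> (ball y r) * LlogL_norm \<nu> (ball y r) f))"

end

theory Submission
  imports Defs
begin

text \<open>Write \<open>\<omega> = w\<^sup>q dx\<close>. The \<open>A\<^bsub>1,q\<^esub>\<close> condition says that almost every \<open>y\<close> satisfies
  \<open>r\<^bsup>\<gamma>-n\<^esup> \<le> C w(y) \<omega>(B(y,r))\<^bsup>-1/q\<^esup>\<close> for all \<open>r\<close>; it makes \<open>w\<close> and \<open>\<omega>\<close> doubling, reverse doubling,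
  and good enough for a John--Nirenberg inequality with respect to either measure. With
  \<open>u = 1 + |b - b\<^sub>B|\<close> the kernel of the commutator is at most \<open>u(x) u(y) |x - y|\<^bsup>\<gamma>-n\<^esup>\<close>.

  On a ball \<open>B\<close>, split the function at \<open>2B\<close>. For the near part, integrate the commutator over its
  level set \<open>E\<close> against \<open>\<omega>\<close> and cover \<open>2B\<close> by Vitali balls of \<open>\<omega>\<close>-measure comparable to
  \<open>\<omega>(E)\<close>; on each of them the dual potential of \<open>E\<close> is bounded by \<open>w(y) u(y) \<omega>(E)\<^bsup>1-1/q\<^esup>\<close>, and
  Young's inequality for \<open>\<Phi>\<close> and the exponential brings in the Luxemburg norm over \<open>2B\<close>.
  For the far part, sum over the dilates \<open>2\<^sup>jB\<close> and use Chebyshev's inequality. Since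
  \<open>1/\<beta> - 1/s > 0\<close>, reverse doubling makes both parts at most a geometric series of the terms of
  the amalgam norm at the radii \<open>2\<^sup>jr\<close> with the same center, so that only the norm
  on \<open>L\<^sup>s(\<mu>)\<close> of such a series has to be estimated.\<close>

section \<open>Weights satisfying a pointwise maximal bound\<close>

text \<open>The obstacle is that \<open>b\<close> is unbounded: over a set \<open>E\<close> inside a
  ball \<open>B\<close> the average deviation of \<open>b\<close> from its mean over
  \<open>B\<close> may grow like log(\<omega>(B)/\<omega>(E)), and moving the mean to a larger ball
  costs a logarithm as well. Every such logarithm is traded for a small power \<open>p\<close> of
  the ratio of measures. With \<kappa> = 1/q, \<open>p\<close> is half of the exponent gap at hand:
  (1 - \<kappa>)/2 for kernel shells inside the reference ball, \<kappa>/2 for those outside, (t +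
  \<kappa>)/2 for the far part, where t + \<kappa> = 1/\<beta> - 1/s. One half of the gap pays for
  the logarithm; the other, through reverse doubling, makes the shells summable. All means of
  \<open>b\<close> are Lebesgue means, so \<open>u\<close> is the same function whether it is
  integrated against \<open>w powr q\<close> in the variable \<open>x\<close> or against
  \<open>w\<close> in the variable \<open>y\<close>. The level \<lambda> disappears at once, because
  |f|/\<lambda> is at most \<Phi>(|f|/\<lambda>) and the commutator is linear in
  \<open>f\<close>.\<close>

declare emeasure_completion [simp del] measure_completion [simp del]

section \<open>Lebesgue measure with a density, and measurability on products\<close>

definition weighted :: "(real^'n \<Rightarrow> real) \<Rightarrow> (real^'n) measure" where
  "weighted v = density lebesgue (\<lambda>x. ennreal (v x))"

lemma space_weighted [simp]: "space (weighted v) = UNIV"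
  and sets_weighted [simp, measurable_cong]: "sets (weighted v) = sets lebesgue"
  by (simp_all add: weighted_def)

lemma sets_lebesgue_ball [measurable, simp]: "ball (y :: real^'n) r \<in> sets lebesgue"
  by simp

lemma id_lebesgue_borel [measurable]: "(\<lambda>x::real^'n. x) \<in> borel_measurable lebesgue"
  using id_borel_measurable_lebesgue by (simp add: id_def)

lemma sigma_finite_lebesgue: "sigma_finite_measure (lebesgue :: (real^'n) measure)"
proof
  show "\<exists>A::(real^'n) set set. countable A \<and> A \<subseteq> sets lebesgue \<and> \<Union> A = space lebesgue \<and>
      (\<forall>a\<in>A. emeasure lebesgue a \<noteq> \<infinity>)"
  proof (intro exI conjI)
    show "countable (range (\<lambda>k::nat. ball (0::real^'n) (real k)))" by simp
    show "\<Union> (range (\<lambda>k::nat. ball (0::real^'n) (real k))) = space lebesgue"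
      using reals_Archimedean2 by auto
    show "\<forall>a\<in>range (\<lambda>k::nat. ball (0::real^'n) (real k)). emeasure lebesgue a \<noteq> \<infinity>"
      using bounded_set_imp_lmeasurable[of "ball (0::real^'n) _"] by (auto simp: fmeasurable_def less_top)
  qed auto
qed

lemma pair_sigma_finite_lebesgue:
  "pair_sigma_finite (lebesgue :: (real^'n) measure) (lebesgue :: (real^'m) measure)"
  by (intro pair_sigma_finite.intro sigma_finite_lebesgue)

lemma measurable_lebesgue_pair_fst [measurable]:
  "fst \<in> (lebesgue :: (real^'n) measure) \<Otimes>\<^sub>M M \<rightarrow>\<^sub>M borel"
  using measurable_compose[OF measurable_fst id_lebesgue_borel] by simp

lemma measurable_lebesgue_pair_snd [measurable]:
  "snd \<in> M \<Otimes>\<^sub>M (lebesgue :: (real^'n) measure) \<rightarrow>\<^sub>M borel"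
  using measurable_compose[OF measurable_snd id_lebesgue_borel] by simp

lemma emeasure_weighted:
  assumes "v \<in> borel_measurable lebesgue" "E \<in> sets lebesgue"
  shows "emeasure (weighted v) E = wmeas v E"
  unfolding weighted_def wmeas_def using assms by (intro emeasure_density) auto

lemma ball_subset_ballI:
  fixes y :: "'a::metric_space"
  assumes "dist x y + r \<le> R"
  shows "ball y r \<subseteq> ball x R"
proof
  fix z assume "z \<in> ball y r"
  then have "dist x z < R"
    using assms dist_triangle[of x z y] by (simp only: mem_ball)
  then show "z \<in> ball x R" by simp
qed

lemma ennreal_mult_le_multD:
  assumes "ennreal a * ennreal b \<le> ennreal c * ennreal d" "0 \<le> a" "0 \<le> b" "0 \<le> c" "0 \<le> d"
  shows "a * b \<le> c * d"
proof -
  have "ennreal (a * b) \<le> ennreal (c * d)"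
    using assms by (metis ennreal_mult)
  then show ?thesis
    using assms by (subst (asm) ennreal_le_iff) auto
qed

lemma emeasure_lebesgue_bounded_fin:
  "E \<in> sets lebesgue \<Longrightarrow> bounded E \<Longrightarrow> emeasure lebesgue (E :: (real^'n) set) < \<infinity>"
  using fmeasurableD2[OF bounded_set_imp_lmeasurable, of E] by (simp only: less_top infinity_ennreal_def not_False_eq_True)

lemma emeasure_ball_real:
  fixes y :: "real^'n"
  shows "emeasure lebesgue (ball y r) = ennreal (measure lebesgue (ball y r))"
  using emeasure_lebesgue_bounded_fin[OF sets_lebesgue_ball bounded_ball, of y r]
  by (intro emeasure_eq_ennreal_measure) (metis infinity_ennreal_def less_irrefl)

lemma measure_ball_scale:
  fixes y :: "real^'n"
  assumes "0 \<le> r"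
  shows "measure lebesgue (ball y r) = r ^ CARD('n) * unit_ball_vol (real CARD('n))"
  by (subst measure_completion) (simp_all add: content_ball[OF assms] mult.commute)

lemma measure_ball_pos:
  fixes y :: "real^'n"
  assumes "0 < r"
  shows "0 < measure lebesgue (ball y r)"
  using assms by (subst measure_completion) simp_all

text \<open>The Muckenhoupt class A1 in centered form: almost everywhere \<open>v\<close> dominates
  a fixed multiple of its own centered maximal function. One null set serves all radii, so the bound
  may be used with balls that depend on the point. Both \<open>w\<close> and \<open>w powr q\<close>
  become instances.\<close>

locale A1_weight =
  fixes C :: real and v :: "real^'n \<Rightarrow> real"
  assumes v_measurable [measurable]: "v \<in> borel_measurable lebesgue"
    and v_nonneg [simp]: "0 \<le> v x"
    and C_pos: "0 < C"
    and emeasure_ball_pos: "0 < r \<Longrightarrow> 0 < emeasure (weighted v) (ball y r)"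
    and emeasure_ball_fin: "emeasure (weighted v) (ball y r) < \<infinity>"
    and maximal_bound: "AE y in lebesgue. \<forall>r>0.
      emeasure (weighted v) (ball y r) \<le> ennreal (C * r ^ CARD('n) * v y)"
begin

definition vol :: "real^'n \<Rightarrow> real \<Rightarrow> real" where
  "vol y r = measure (weighted v) (ball y r)"

lemma emeasure_ball_vol: "emeasure (weighted v) (ball y r) = ennreal (vol y r)"
  unfolding vol_def using emeasure_ball_fin by (simp add: emeasure_eq_ennreal_measure less_top)

lemma vol_pos: "0 < r \<Longrightarrow> 0 < vol y r"
  using emeasure_ball_pos[of r y] by (simp add: emeasure_ball_vol)

lemma vol_nonneg [simp]: "0 \<le> vol y r"
  by (simp add: vol_def)

lemma emeasure_bounded_fin: "E \<subseteq> ball y r \<Longrightarrow> emeasure (weighted v) E < \<infinity>"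
  using emeasure_mono[of E "ball y r" "weighted v"] emeasure_ball_fin[of y r] by (simp add: le_less_trans)

lemma measure_le_vol:
  assumes "E \<subseteq> ball y r"
  shows "measure (weighted v) E \<le> vol y r"
proof -
  have "emeasure (weighted v) E \<le> emeasure (weighted v) (ball y r)"
    using assms by (intro emeasure_mono) auto
  then show ?thesis
    unfolding vol_def measure_def using emeasure_ball_fin[of y r] by (intro enn2real_mono) auto
qed

lemma vol_mono: "ball y r \<subseteq> ball z R \<Longrightarrow> vol y r \<le> vol z R"
  using measure_le_vol[of "ball y r" z R] by (simp add: vol_def)

lemma maximal_vol: "AE y in lebesgue. \<forall>r>0. vol y r \<le> C * r ^ CARD('n) * v y"
  using maximal_bound C_pos by (simp add: emeasure_ball_vol)

lemma maximal_vol_shift: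
  "AE x in lebesgue. \<forall>y r R. 0 < R \<longrightarrow> dist x y + r \<le> R \<longrightarrow> vol y r \<le> C * R ^ CARD('n) * v x"
  using maximal_vol
proof eventually_elim
  case (elim x)
  show ?case
  proof (intro allI impI)
    fix y r R assume "0 < R" "dist x y + r \<le> R"
    have "vol y r \<le> vol x R"
      by (intro vol_mono ball_subset_ballI) fact
    also have "\<dots> \<le> C * R ^ CARD('n) * v x"
      using elim \<open>0 < R\<close> by blast
    finally show "vol y r \<le> C * R ^ CARD('n) * v x" .
  qed
qed

lemma nn_integral_weighted:
  assumes "f \<in> borel_measurable lebesgue"
  shows "(\<integral>\<^sup>+x. f x \<partial>weighted v) = (\<integral>\<^sup>+x. ennreal (v x) * f x \<partial>lebesgue)"
  using assms by (simp add: weighted_def nn_integral_density)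

text \<open>Turns a pointwise lower bound for the weight into a comparison of Lebesgue measure and
  weighted measure; doubling and the loss on small subsets are both read off from it.\<close>

lemma emeasure_lower_bound:
  assumes [measurable]: "G \<in> sets lebesgue" and ae: "AE x in lebesgue. x \<in> G \<longrightarrow> a \<le> k * v x"
    and k: "0 \<le> k"
  shows "ennreal a * emeasure lebesgue G \<le> ennreal k * emeasure (weighted v) G"
proof -
  have "ennreal a * emeasure lebesgue G = (\<integral>\<^sup>+x. ennreal a * indicator G x \<partial>lebesgue)"
    by (simp add: nn_integral_cmult)
  also have "\<dots> \<le> (\<integral>\<^sup>+x. ennreal k * (ennreal (v x) * indicator G x) \<partial>lebesgue)"
    using ae by (intro nn_integral_mono_AE)
      (auto elim!: eventually_mono simp: indicator_def ennreal_mult[OF k, symmetric] intro!: ennreal_leI)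
  also have "\<dots> = ennreal k * emeasure (weighted v) G"
    by (simp add: nn_integral_cmult weighted_def emeasure_density)
  finally show ?thesis .
qed

text \<open>For \<open>x\<close> in \<open>ball y r\<close> the ball of radius \<open>2 * r\<close>
  about \<open>y\<close> lies in \<open>ball x (4 * r)\<close>; averaging the maximal bound over
  such \<open>x\<close> gives the quotient. The maximum with 1 makes the powers of \<open>D\<close>
  increasing.\<close>

definition D :: real where
  "D = max 1 (C * 4 ^ CARD('n) / unit_ball_vol (real CARD('n)))"

lemma D_ge_1: "1 \<le> D"
  by (simp add: D_def)

lemma doubling:
  assumes "0 < r"
  shows "vol y (2 * r) \<le> D * vol y r"
proof -
  let ?\<kappa> = "unit_ball_vol (real CARD('n))"
  have \<kappa>: "0 < ?\<kappa>" by simp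
  have "AE x in lebesgue. x \<in> ball y r \<longrightarrow> vol y (2 * r) \<le> (C * (4 * r) ^ CARD('n)) * v x"
    using maximal_vol_shift
  proof eventually_elim
    case (elim x)
    show ?case
    proof
      assume "x \<in> ball y r"
      then have "dist x y + 2 * r \<le> 4 * r"
        using assms by (simp only: mem_ball dist_commute[of x y])
      then show "vol y (2 * r) \<le> (C * (4 * r) ^ CARD('n)) * v x"
        using elim assms by (metis mult_pos_pos zero_less_numeral)
    qed
  qed
  then have "ennreal (vol y (2 * r)) * emeasure lebesgue (ball y r)
      \<le> ennreal (C * (4 * r) ^ CARD('n)) * emeasure (weighted v) (ball y r)"
    using assms C_pos by (intro emeasure_lower_bound) auto
  then have "vol y (2 * r) * (r ^ CARD('n) * ?\<kappa>) \<le> C * (4 * r) ^ CARD('n) * vol y r"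
    using assms C_pos unfolding emeasure_ball_real emeasure_ball_vol
    by (subst measure_ball_scale[symmetric, of r y]) (auto intro!: ennreal_mult_le_multD)
  then have "vol y (2 * r) * ?\<kappa> * r ^ CARD('n) \<le> (C * 4 ^ CARD('n) * vol y r) * r ^ CARD('n)"
    by (simp add: power_mult_distrib mult_ac)
  then have "vol y (2 * r) * ?\<kappa> \<le> C * 4 ^ CARD('n) * vol y r"
    using assms by simp
  then have "vol y (2 * r) \<le> C * 4 ^ CARD('n) / ?\<kappa> * vol y r"
    using \<kappa> by (simp add: field_simps)
  also have "\<dots> \<le> D * vol y r"
    by (intro mult_right_mono) (auto simp: D_def)
  finally show ?thesis .
qed

lemma doubling_iterate:
  assumes "0 < r"
  shows "vol y (2 ^ k * r) \<le> D ^ k * vol y r"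
proof (induction k)
  case (Suc k)
  have "vol y (2 * (2 ^ k * r)) \<le> D * vol y (2 ^ k * r)"
    using assms by (intro doubling) auto
  also have "\<dots> \<le> D * (D ^ k * vol y r)"
    using Suc D_ge_1 by (intro mult_left_mono) auto
  finally show ?case by (simp add: mult_ac)
qed auto

lemma vol_le_doubling:
  assumes "0 < r" "ball z R \<subseteq> ball y (2 ^ k * r)"
  shows "vol z R \<le> D ^ k * vol y r"
  using vol_mono[OF assms(2)] doubling_iterate[OF assms(1), of y k] by linarith

text \<open>A weak A-infinity condition, losing a fixed fraction of the weighted measure. This is all
  that a stopping-time argument requires, so no reverse Hoelder inequality is needed.\<close>

lemma half_measure_subset:
  assumes Q [measurable]: "Q \<in> sets lebesgue" and F [measurable]: "F \<in> sets lebesgue"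
    and FQ: "F \<subseteq> Q" "Q \<subseteq> ball y r"
    and L: "0 < L" and pos: "0 < measure lebesgue Q"
    and ae: "AE x in lebesgue. x \<in> Q \<longrightarrow> measure (weighted v) Q \<le> L * measure lebesgue Q * v x"
    and half: "measure lebesgue F \<le> measure lebesgue Q / 2"
  shows "measure (weighted v) F \<le> (1 - 1 / (2 * L)) * measure (weighted v) Q"
proof -
  have fin: "emeasure lebesgue Q < \<infinity>" "emeasure (weighted v) Q < \<infinity>"
    using FQ emeasure_bounded_fin emeasure_lebesgue_bounded_fin[OF Q bounded_subset[OF bounded_ball]] by auto
  have fin': "emeasure lebesgue (Q - F) < \<infinity>" "emeasure (weighted v) (Q - F) < \<infinity>"
    using fin emeasure_mono[of "Q - F" Q lebesgue] emeasure_mono[of "Q - F" Q "weighted v"]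
    by (auto simp: le_less_trans)
  \<comment> \<open>The weight is tested on the complement \<open>Q - F\<close>, which keeps at
    least half of the Lebesgue measure of \<open>Q\<close> and therefore at least the fraction
    \<open>1 / (2 * L)\<close> of its weighted measure.\<close>
  have "ennreal (measure (weighted v) Q) * emeasure lebesgue (Q - F)
      \<le> ennreal (L * measure lebesgue Q) * emeasure (weighted v) (Q - F)"
    using ae L by (intro emeasure_lower_bound) (auto elim!: eventually_mono)
  then have 1: "measure (weighted v) Q * measure lebesgue (Q - F)
      \<le> L * measure lebesgue Q * measure (weighted v) (Q - F)"
    using fin' L
    by (intro ennreal_mult_le_multD) (auto simp: emeasure_eq_ennreal_measure less_top)
  have 2: "measure lebesgue (Q - F) = measure lebesgue Q - measure lebesgue F"
    using fin(1) FQ by (intro measure_Diff) (auto simp: less_top)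
  have 3: "measure (weighted v) (Q - F) = measure (weighted v) Q - measure (weighted v) F"
    using fin(2) FQ by (intro measure_Diff) (auto simp: less_top)
  have "measure (weighted v) Q * (measure lebesgue Q / 2) \<le> measure (weighted v) Q * measure lebesgue (Q - F)"
    using half 2 by (intro mult_left_mono) auto
  with 1 have "(measure (weighted v) Q / 2) * measure lebesgue Q
      \<le> (L * measure (weighted v) (Q - F)) * measure lebesgue Q"
    by (simp add: mult_ac)
  then have "measure (weighted v) Q / 2 \<le> L * measure (weighted v) (Q - F)"
    using pos by simp
  then show ?thesis
    using L unfolding 3 by (simp add: field_simps)
qed

definition \<theta> :: real where
  "\<theta> = 1 - 1 / (2 * max 1 (C * 2 ^ CARD('n) / unit_ball_vol (real CARD('n))))"

lemma \<theta>_bounds: "0 < \<theta>" "\<theta> < 1"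
proof -
  define m where "m = max 1 (C * 2 ^ CARD('n) / unit_ball_vol (real CARD('n)))"
  have "1 \<le> m" by (simp add: m_def)
  then have "0 < 1 - 1 / (2 * m)" "1 - 1 / (2 * m) < 1"
    by (simp_all add: field_simps)
  then show "0 < \<theta>" "\<theta> < 1"
    by (simp_all add: \<theta>_def m_def)
qed

text \<open>The inner ball fills at most half of the outer one in Lebesgue measure, the dimension
  being at least 1, so a fixed fraction of the weighted measure lies off the inner ball. The factor
  \<open>2 ^ CARD('n)\<close> in \<open>\<theta>\<close> comes from enclosing
  \<open>ball y (2 * r)\<close> in a ball of twice its radius about any of its points.\<close>

lemma reverse_doubling:
  assumes "0 < r"
  shows "vol y r \<le> \<theta> * vol y (2 * r)"
proof -
  let ?\<kappa> = "unit_ball_vol (real CARD('n))"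
  let ?L = "max 1 (C * 2 ^ CARD('n) / ?\<kappa>)"
  have \<kappa>: "0 < ?\<kappa>" by simp
  have "measure (weighted v) (ball y r) \<le> (1 - 1 / (2 * ?L)) * measure (weighted v) (ball y (2 * r))"
  proof (rule half_measure_subset)
    show "measure lebesgue (ball y r) \<le> measure lebesgue (ball y (2 * r)) / 2"
    proof -
      have "(2::real) ^ 1 \<le> 2 ^ CARD('n)"
        by (intro power_increasing) (auto simp: Suc_leI)
      then have "2 * (r ^ CARD('n) * ?\<kappa>) \<le> 2 ^ CARD('n) * (r ^ CARD('n) * ?\<kappa>)"
        using assms \<kappa> by (intro mult_right_mono) auto
      then show ?thesis
        using assms by (simp add: measure_ball_scale power_mult_distrib mult_ac)
    qed
    show "AE x in lebesgue. x \<in> ball y (2 * r) \<longrightarrow>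
        measure (weighted v) (ball y (2 * r)) \<le> ?L * measure lebesgue (ball y (2 * r)) * v x"
      using maximal_vol_shift
    proof eventually_elim
      case (elim x)
      show ?case
      proof
        assume "x \<in> ball y (2 * r)"
        then have "dist x y + 2 * r \<le> 2 * (2 * r)"
          using assms by (simp only: mem_ball dist_commute[of x y])
        then have "vol y (2 * r) \<le> C * (2 * (2 * r)) ^ CARD('n) * v x"
          using elim assms by (metis mult_pos_pos zero_less_numeral)
        also have "\<dots> = (C * 2 ^ CARD('n) / ?\<kappa>) * ((2 * r) ^ CARD('n) * ?\<kappa>) * v x"
        proof -
          have "?\<kappa> \<noteq> 0" using \<kappa> by linarith
          then show ?thesis by (simp only: power_mult_distrib[of 2 "2 * r"]) (simp only: divide_inverse mult_ac, simp)
        qed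
        also have "\<dots> \<le> ?L * ((2 * r) ^ CARD('n) * ?\<kappa>) * v x"
          using \<kappa> assms by (intro mult_right_mono) auto
        finally show "measure (weighted v) (ball y (2 * r)) \<le> ?L * measure lebesgue (ball y (2 * r)) * v x"
          using assms by (simp add: measure_ball_scale vol_def)
      qed
    qed
  qed (use assms measure_ball_pos[of "2*r" y] in auto)
  then show ?thesis
    by (simp add: vol_def \<theta>_def)
qed

lemma reverse_doubling_iterate:
  assumes "0 < r"
  shows "vol y r \<le> \<theta> ^ k * vol y (2 ^ k * r)"
proof (induction k)
  case (Suc k)
  have "\<theta> ^ k * vol y (2 ^ k * r) \<le> \<theta> ^ k * (\<theta> * vol y (2 * (2 ^ k * r)))"
    using assms \<theta>_bounds by (intro mult_left_mono reverse_doubling) auto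
  with Suc show ?case by (simp add: mult_ac)
qed auto

end

section \<open>Dyadic cubes and dyadic means\<close>

text \<open>Half-open, so that the cubes obtained by halving the side partition the cube exactly. A
  child is indexed by the set of coordinates in which it takes the upper half, and
  \<open>upper\<close> reads this index off a point.\<close>

definition cube :: "real^'n \<Rightarrow> real \<Rightarrow> (real^'n) set" where
  "cube a l = {x. \<forall>i. a $ i \<le> x $ i \<and> x $ i < a $ i + l}"

definition child :: "real^'n \<Rightarrow> real \<Rightarrow> 'n set \<Rightarrow> real^'n" where
  "child a l S = (\<chi> i. if i \<in> S then a $ i + l / 2 else a $ i)"

definition upper :: "real^'n \<Rightarrow> real \<Rightarrow> real^'n \<Rightarrow> 'n set" where
  "upper a l x = {i. a $ i + l / 2 \<le> x $ i}"

lemma mem_child_iff: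
  assumes "0 < l"
  shows "x \<in> cube (child a l S) (l / 2) \<longleftrightarrow> x \<in> cube a l \<and> upper a l x = S"
proof -
  have "x \<in> cube (child a l S) (l / 2) \<longleftrightarrow>
      (\<forall>i. (a $ i \<le> x $ i \<and> x $ i < a $ i + l) \<and> (a $ i + l / 2 \<le> x $ i \<longleftrightarrow> i \<in> S))"
    unfolding cube_def child_def mem_Collect_eq
  proof (intro iff_allI)
    fix i
    show "(vec_lambda (\<lambda>i. if i \<in> S then a $ i + l / 2 else a $ i) $ i \<le> x $ i \<and>
        x $ i < vec_lambda (\<lambda>i. if i \<in> S then a $ i + l / 2 else a $ i) $ i + l / 2) \<longleftrightarrow>
        (a $ i \<le> x $ i \<and> x $ i < a $ i + l) \<and> (a $ i + l / 2 \<le> x $ i \<longleftrightarrow> i \<in> S)"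
      using assms by (cases "i \<in> S") (simp_all, linarith+)
  qed
  then show ?thesis
    by (auto simp: cube_def upper_def)
qed

lemma child_subset: "0 < l \<Longrightarrow> cube (child a l S) (l / 2) \<subseteq> cube a l"
  by (auto simp: mem_child_iff)

lemma cube_eq_UN_child: "0 < l \<Longrightarrow> cube a l = (\<Union>S. cube (child a l S) (l / 2))"
  by (auto simp: mem_child_iff)

lemma sets_cube [measurable, simp]: "cube a l \<in> sets lebesgue"
proof -
  have "cube a l = (\<Inter>i. {x. x $ i \<ge> a $ i} \<inter> {x. x $ i < a $ i + l})"
    by (auto simp: cube_def)
  also have "\<dots> \<in> sets borel"
    by (intro sets.finite_INT sets.Int borel_closed borel_open closed_halfspace_component_ge_cart
        open_halfspace_component_lt_cart) auto
  finally show ?thesis by (rule sets_completionI_sets[of _ lborel, simplified])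
qed

lemma emeasure_cube:
  fixes a :: "real^'n"
  assumes l: "0 < l"
  shows "emeasure lebesgue (cube a l) = ennreal (l ^ CARD('n))"
proof -
  define e where "e = a + l *\<^sub>R (1::real^'n)"
  have bx: "box a e \<subseteq> cube a l" "cube a l \<subseteq> cbox a e"
    by (auto simp: cube_def mem_box_cart e_def less_imp_le)
  have ne: "a \<bullet> i \<le> e \<bullet> i" if "i \<in> Basis" for i
  proof -
    have "\<exists>k. i = axis k 1"
      using that by (auto simp: Basis_vec_def)
    then obtain k where "i = axis k 1" ..
    then show ?thesis
      using l by (simp add: e_def inner_axis)
  qed
  have pr: "(\<Prod>i\<in>Basis. (e - a) \<bullet> i) = l ^ CARD('n)"
  proof -
    have "(e - a) \<bullet> i = l" if "i \<in> Basis" for i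
    proof -
      have "\<exists>k. i = axis k 1"
        using that by (auto simp: Basis_vec_def)
      then obtain k where "i = axis k 1" ..
      then show ?thesis
        by (simp add: e_def inner_axis)
    qed
    then have "(\<Prod>i\<in>Basis. (e - a) \<bullet> i) = (\<Prod>i\<in>(Basis :: (real^'n) set). l)"
      by (intro prod.cong) auto
    then show ?thesis by simp
  qed
  have b1: "emeasure lebesgue (box a e) = ennreal (l ^ CARD('n))"
    unfolding pr[symmetric] using ne emeasure_lborel_box[of a e]
    by (subst emeasure_completion) auto
  have b2: "emeasure lebesgue (cbox a e) = ennreal (l ^ CARD('n))"
    unfolding pr[symmetric] using ne emeasure_lborel_cbox[of a e]
    by (subst emeasure_completion) auto
  have "emeasure lebesgue (box a e) \<le> emeasure lebesgue (cube a l)"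
    by (intro emeasure_mono bx) auto
  moreover have "emeasure lebesgue (cube a l) \<le> emeasure lebesgue (cbox a e)"
    by (intro emeasure_mono bx) auto
  ultimately show ?thesis
    unfolding b1 b2 by (rule antisym[rotated])
qed

lemma measure_cube: "0 < l \<Longrightarrow> measure lebesgue (cube (a :: real^'n) l) = l ^ CARD('n)"
  by (simp add: measure_def emeasure_cube)

lemma cube_dist:
  fixes x y :: "real^'n"
  assumes "x \<in> cube a l" "y \<in> cube a l"
  shows "dist x y \<le> real CARD('n) * l"
proof -
  have "norm (x - y) \<le> (\<Sum>i\<in>UNIV. \<bar>(x - y) $ i\<bar>)"
    by (rule norm_le_l1_cart)
  also have "\<dots> \<le> (\<Sum>i\<in>(UNIV :: 'n set). l)"
  proof (rule sum_mono)
    fix i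
    show "\<bar>(x - y) $ i\<bar> \<le> l"
      using assms[unfolded cube_def mem_Collect_eq, THEN spec, of i] by (simp add: abs_le_iff)
  qed
  finally show ?thesis by (simp add: dist_norm)
qed

lemma vertex_mem_cube: "0 < l \<Longrightarrow> a \<in> cube a l"
  by (simp add: cube_def)

lemma cube_subset_ball:
  fixes a :: "real^'n"
  assumes "x \<in> cube a l" "real CARD('n) * l < R"
  shows "cube a l \<subseteq> ball x R"
  using cube_dist[OF assms(1)] assms(2) by (auto simp only: mem_ball subset_iff intro: le_less_trans)

lemma bounded_cube: "bounded (cube (a :: real^'n) l)"
proof (cases "cube a l = {}")
  case False
  then obtain x where "x \<in> cube a l" by auto
  from cube_subset_ball[OF this, of "real CARD('n) * l + 1"] show ?thesis
    by (intro bounded_subset[OF bounded_ball]) auto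
qed simp

text \<open>Each child may carry a formula of its own, as functions defined by recursion along the
  dyadic tree require; \<open>M\<close> is left open because both Lebesgue measure and the weighted
  measure are split this way.\<close>

lemma nn_integral_cube_split:
  fixes a :: "real^'n"
  assumes l: "0 < l" and M [measurable_cong]: "sets M = sets lebesgue"
    and [measurable]: "\<And>S. f S \<in> borel_measurable lebesgue"
    and eq: "\<And>x. x \<in> cube a l \<Longrightarrow> g x = f (upper a l x) x"
  shows "(\<integral>\<^sup>+x\<in>cube a l. g x \<partial>M) = (\<Sum>S\<in>UNIV. \<integral>\<^sup>+x\<in>cube (child a l S) (l / 2). f S x \<partial>M)"
proof -
  have "(\<integral>\<^sup>+x\<in>cube a l. g x \<partial>M) = (\<integral>\<^sup>+x. (\<Sum>S\<in>UNIV. f S x * indicator (cube (child a l S) (l / 2)) x) \<partial>M)"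
  proof (intro nn_integral_cong)
    fix x
    have "(\<Sum>S\<in>UNIV. f S x * indicator (cube (child a l S) (l / 2)) x) =
        (\<Sum>S\<in>UNIV. if S = upper a l x then f S x * indicator (cube a l) x else 0)"
      using l by (intro sum.cong) (auto simp: mem_child_iff indicator_def)
    then show "g x * indicator (cube a l) x = (\<Sum>S\<in>UNIV. f S x * indicator (cube (child a l S) (l / 2)) x)"
      using eq[of x] by (auto simp: indicator_def)
  qed
  also have "\<dots> = (\<Sum>S\<in>UNIV. \<integral>\<^sup>+x\<in>cube (child a l S) (l / 2). f S x \<partial>M)"
    by (intro nn_integral_sum) measurable
  finally show ?thesis .
qed

lemma measurable_upper [measurable]:
  fixes a :: "real^'n"
  shows "upper a l \<in> lebesgue \<rightarrow>\<^sub>M count_space UNIV"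
proof -
  have "upper a l -` {S} \<inter> space lebesgue \<in> sets lebesgue" for S :: "'n set"
  proof -
    have "upper a l -` {S} \<inter> space lebesgue =
        (\<Inter>i. if i \<in> S then {x. x $ i \<ge> a $ i + l / 2} else {x. x $ i < a $ i + l / 2})"
      (is "_ = ?R")
    proof (intro set_eqI)
      fix x
      have "x \<in> (if i \<in> S then {x. x $ i \<ge> a $ i + l / 2} else {x. x $ i < a $ i + l / 2})
          \<longleftrightarrow> (a $ i + l / 2 \<le> x $ i \<longleftrightarrow> i \<in> S)" for i
        by (cases "i \<in> S") (simp_all add: not_le)
      then have "x \<in> ?R \<longleftrightarrow> upper a l x = S"
        unfolding upper_def set_eq_iff mem_Collect_eq INT_iff by blast
      then show "x \<in> upper a l -` {S} \<inter> space lebesgue \<longleftrightarrow> x \<in> ?R"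
        by simp
    qed
    also have "?R \<in> sets borel"
      by (intro sets.finite_INT) (auto intro!: borel_closed borel_open
        closed_halfspace_component_ge_cart open_halfspace_component_lt_cart)
    finally show ?thesis by (rule sets_completionI_sets[of _ lborel, simplified])
  qed
  then show ?thesis
    by (subst measurable_count_space_eq2) (simp_all only: finite, blast)
qed

section \<open>Dyadic means and their convergence\<close>

lemma norm_ball_mean_diff_le:
  fixes b :: "real^'n \<Rightarrow> complex"
  assumes Q: "Q \<in> sets lebesgue" "emeasure lebesgue Q < \<infinity>" "0 < measure lebesgue Q"
    and b: "set_integrable lebesgue Q b"
  shows "ennreal (norm (ball_mean b Q - c) * measure lebesgue Q) \<le> (\<integral>\<^sup>+x\<in>Q. ennreal (norm (b x - c)) \<partial>lebesgue)"
proof -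
  have c: "set_integrable lebesgue Q (\<lambda>x. c)"
    using Q by (simp add: set_integrable_def less_top)
  have int: "set_integrable lebesgue Q (\<lambda>x. b x - c)"
    by (intro set_integral_diff b c)
  have "(LINT x:Q|lebesgue. b x - c) = (LINT x:Q|lebesgue. b x) - (LINT x:Q|lebesgue. c)"
    by (intro set_integral_diff b c)
  also have "(LINT x:Q|lebesgue. c) = of_real (measure lebesgue Q) * c"
    using Q by (simp add: set_lebesgue_integral_def less_top scaleR_conv_of_real)
  also have "(LINT x:Q|lebesgue. b x) - of_real (measure lebesgue Q) * c = (ball_mean b Q - c) * of_real (measure lebesgue Q)"
    using Q by (simp add: ball_mean_def field_simps)
  finally have "ennreal (norm (ball_mean b Q - c) * measure lebesgue Q) = ennreal (norm (LINT x:Q|lebesgue. b x - c))"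
    by (simp add: norm_mult)
  also have "\<dots> \<le> (\<integral>\<^sup>+x. ennreal (norm (indicator Q x *\<^sub>R (b x - c))) \<partial>lebesgue)"
    unfolding set_lebesgue_integral_def
    by (intro integral_norm_bound_ennreal) (use int in \<open>simp add: set_integrable_def\<close>)
  also have "\<dots> = (\<integral>\<^sup>+x\<in>Q. ennreal (norm (b x - c)) \<partial>lebesgue)"
    by (intro nn_integral_cong) (auto simp: indicator_def)
  finally show ?thesis .
qed

text \<open>For \<open>x\<close> in the cube, the conditional expectation of \<open>b\<close> on the
  dyadic cubes of generation \<open>m\<close> below it. The recursion descends from the root, so
  that statements for all cubes are proved by induction on the number of generations left.\<close>

primrec dyadic_mean :: "(real^'n \<Rightarrow> complex) \<Rightarrow> nat \<Rightarrow> real^'n \<Rightarrow> real \<Rightarrow> real^'n \<Rightarrow> complex" where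
  "dyadic_mean b 0 a l x = ball_mean b (cube a l)"
| "dyadic_mean b (Suc m) a l x = dyadic_mean b m (child a l (upper a l x)) (l / 2) x"

lemma measurable_dyadic_mean [measurable]: "dyadic_mean b m a l \<in> borel_measurable lebesgue"
proof (induction m arbitrary: a l)
  case (Suc m)
  have "(\<lambda>x. dyadic_mean b m (child a l (upper a l x)) (l / 2) x) \<in> borel_measurable lebesgue"
    by (rule measurable_compose_countable[where f = "\<lambda>S x. dyadic_mean b m (child a l S) (l / 2) x"])
      (auto intro: Suc)
  then show ?case by (simp add: fun_eq_iff cong: measurable_cong)
qed (simp add: fun_eq_iff cong: measurable_cong)


lemma set_integrable_locally_integrable:
  assumes "locally_integrable f" "Q \<in> sets lebesgue" "bounded Q"
  shows "set_integrable lebesgue Q f"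
proof -
  obtain R where R: "Q \<subseteq> cball 0 R"
    using assms(3) unfolding bounded_iff by (auto simp: subset_iff)
  have "set_integrable lebesgue (cball 0 R) f"
    using assms(1) unfolding locally_integrable_def by (metis compact_cball)
  then show ?thesis
    by (rule set_integrable_subset) (use assms R in auto)
qed

lemma locally_integrable_measurable:
  fixes f :: "real^'n \<Rightarrow> 'b::euclidean_space"
  assumes "locally_integrable f"
  shows "f \<in> borel_measurable lebesgue"
proof (rule borel_measurable_LIMSEQ_metric)
  fix k :: nat
  have "set_integrable lebesgue (ball 0 (real k)) f"
    using assms by (intro set_integrable_locally_integrable) auto
  then show "(\<lambda>x. indicat_real (ball 0 (real k)) x *\<^sub>R f x) \<in> borel_measurable lebesgue"
    unfolding set_integrable_def by (rule borel_measurable_integrable)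
next
  fix x :: "real^'n"
  obtain N :: nat where "norm x < real N"
    using reals_Archimedean2 by blast
  then have "\<forall>k\<ge>N. indicat_real (ball 0 (real k)) x *\<^sub>R f x = f x"
    by (auto simp: indicator_def)
  then show "(\<lambda>k. indicat_real (ball 0 (real k)) x *\<^sub>R f x) \<longlonglongrightarrow> f x"
    by (intro tendsto_eventually) (auto simp: eventually_sequentially)
qed

lemma continuous_locally_integrable:
  fixes f :: "real^'n \<Rightarrow> 'b::euclidean_space"
  assumes "continuous_on UNIV f"
  shows "locally_integrable f"
  unfolding locally_integrable_def
proof (intro allI impI)
  fix K :: "(real^'n) set" assume K: "compact K"
  then obtain a b where ab: "K \<subseteq> cbox a b"
    using bounded_subset_cbox_symmetric compact_imp_bounded by metis
  have "f absolutely_integrable_on cbox a b"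
    using assms by (intro absolutely_integrable_continuous) (rule continuous_on_subset, auto)
  then show "f absolutely_integrable_on K"
    by (rule set_integrable_subset) (use K ab lmeasurable_compact fmeasurableD in blast)+
qed

lemma dyadic_mean_diff:
  assumes f: "locally_integrable f" and g: "locally_integrable g"
  shows "dyadic_mean (\<lambda>x. f x - g x) m a l x = dyadic_mean f m a l x - dyadic_mean g m a l x"
proof (induction m arbitrary: a l)
  case 0
  show ?case
    using set_integrable_locally_integrable[OF f sets_cube bounded_cube, of a l]
      set_integrable_locally_integrable[OF g sets_cube bounded_cube, of a l]
    by (simp add: ball_mean_def diff_divide_distrib)
qed simp

lemma cube_mean_diff_le:
  fixes b :: "real^'n \<Rightarrow> complex"
  assumes "locally_integrable b" "0 < l"
  shows "ennreal (norm (ball_mean b (cube a l) - c) * l ^ CARD('n)) \<le> (\<integral>\<^sup>+x\<in>cube a l. ennreal (norm (b x - c)) \<partial>lebesgue)"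
proof -
  have "ennreal (norm (ball_mean b (cube a l) - c) * measure lebesgue (cube a l))
      \<le> (\<integral>\<^sup>+x\<in>cube a l. ennreal (norm (b x - c)) \<partial>lebesgue)"
    using assms by (intro norm_ball_mean_diff_le set_integrable_locally_integrable)
      (simp_all add: emeasure_cube measure_cube bounded_cube)
  then show ?thesis
    using assms by (simp add: measure_cube)
qed

text \<open>Conditional expectation contracts the L1 norm: at the last generation this is the
  triangle inequality for a mean, and the children add up.\<close>

lemma nn_integral_dyadic_mean_le:
  fixes b :: "real^'n \<Rightarrow> complex"
  assumes b: "locally_integrable b" and l: "0 < l"
  shows "(\<integral>\<^sup>+x\<in>cube a l. ennreal (norm (dyadic_mean b m a l x)) \<partial>lebesgue)
    \<le> (\<integral>\<^sup>+x\<in>cube a l. ennreal (norm (b x)) \<partial>lebesgue)"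
  using l
proof (induction m arbitrary: a l)
  case 0
  then show ?case
    using cube_mean_diff_le[OF b 0, of a 0]
    by (simp add: nn_integral_cmult emeasure_cube ennreal_mult)
next
  case (Suc m)
  note [measurable] = locally_integrable_measurable[OF b]
  have "(\<integral>\<^sup>+x\<in>cube a l. ennreal (norm (dyadic_mean b (Suc m) a l x)) \<partial>lebesgue) =
      (\<Sum>S\<in>UNIV. \<integral>\<^sup>+x\<in>cube (child a l S) (l / 2). ennreal (norm (dyadic_mean b m (child a l S) (l / 2) x)) \<partial>lebesgue)"
    by (rule nn_integral_cube_split) (use Suc.prems in auto)
  also have "\<dots> \<le> (\<Sum>S\<in>UNIV. \<integral>\<^sup>+x\<in>cube (child a l S) (l / 2). ennreal (norm (b x)) \<partial>lebesgue)"
    using Suc by (intro sum_mono) auto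
  also have "\<dots> = (\<integral>\<^sup>+x\<in>cube a l. ennreal (norm (b x)) \<partial>lebesgue)"
    by (rule nn_integral_cube_split[symmetric]) (use Suc.prems in auto)
  finally show ?case .
qed

text \<open>The cube of generation \<open>m\<close> containing \<open>x\<close> has diameter at most
  \<open>real CARD('n) * l / 2 ^ m\<close>, so only values of \<open>g\<close> that close to
  \<open>x\<close> enter the mean. This bound reproduces itself when \<open>l\<close> is halved and
  \<open>m\<close> lowered by one.\<close>

lemma dyadic_mean_continuous:
  fixes g :: "real^'n \<Rightarrow> complex"
  assumes g: "locally_integrable g" and "0 < l" "x \<in> cube a l"
    and "\<And>y. y \<in> cube a l \<Longrightarrow> dist y x \<le> real CARD('n) * l / 2 ^ m \<Longrightarrow> norm (g y - g x) \<le> \<epsilon>"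
  shows "norm (dyadic_mean g m a l x - g x) \<le> \<epsilon>"
  using assms(2-)
proof (induction m arbitrary: a l)
  case 0
  have "norm (g y - g x) \<le> \<epsilon>" if "y \<in> cube a l" for y
    using 0(3)[OF that] cube_dist[OF that 0(2)] by simp
  then have "(\<integral>\<^sup>+y\<in>cube a l. ennreal (norm (g y - g x)) \<partial>lebesgue) \<le> (\<integral>\<^sup>+y\<in>cube a l. ennreal \<epsilon> \<partial>lebesgue)"
    by (intro nn_integral_mono) (auto simp: indicator_def intro: ennreal_leI)
  also have "\<dots> = ennreal \<epsilon> * ennreal (l ^ CARD('n))"
    using 0 by (simp add: nn_integral_cmult emeasure_cube)
  finally have "ennreal (norm (ball_mean g (cube a l) - g x) * l ^ CARD('n)) \<le> ennreal \<epsilon> * ennreal (l ^ CARD('n))"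
    using cube_mean_diff_le[OF g 0(1), of a "g x"] by (rule order_trans[rotated])
  moreover have "0 \<le> \<epsilon>"
    using 0(3)[OF 0(2)] 0(1) by simp
  ultimately have "norm (ball_mean g (cube a l) - g x) * l ^ CARD('n) \<le> \<epsilon> * l ^ CARD('n)"
    using 0(1) by (intro ennreal_mult_le_multD) (auto simp: ennreal_mult)
  then show ?case
    using 0(1) by simp
next
  case (Suc m)
  let ?a = "child a l (upper a l x)"
  have "norm (dyadic_mean g m ?a (l / 2) x - g x) \<le> \<epsilon>"
  proof (rule Suc.IH)
    show "x \<in> cube ?a (l / 2)"
      using Suc.prems by (simp add: mem_child_iff)
    fix y assume "y \<in> cube ?a (l / 2)" "dist y x \<le> real CARD('n) * (l / 2) / 2 ^ m"
    then show "norm (g y - g x) \<le> \<epsilon>"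
      using Suc.prems(3)[of y] child_subset[OF Suc.prems(1)] by auto
  qed (use Suc.prems in simp)
  then show ?case by simp
qed

text \<open>Two truncations reduce density to dominated convergence: \<open>f\<close> is cut at
  height \<open>k\<close>, and an almost everywhere approximation by continuous functions is cut at
  the same height, which bounds it on a set of finite measure.\<close>

lemma continuous_approx_L1:
  fixes f :: "real^'n \<Rightarrow> complex"
  assumes [measurable]: "f \<in> borel_measurable lebesgue" "Q \<in> sets lebesgue"
    and Q: "emeasure lebesgue Q < \<infinity>" and f: "(\<integral>\<^sup>+x\<in>Q. ennreal (norm (f x)) \<partial>lebesgue) < \<infinity>"
    and e: "0 < \<epsilon>"
  obtains g where "continuous_on UNIV g" "(\<integral>\<^sup>+x\<in>Q. ennreal (norm (f x - g x)) \<partial>lebesgue) \<le> ennreal \<epsilon>"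
proof -
  \<comment> \<open>For \<open>k > 0\<close> the radial retraction onto the disc of radius
    \<open>k\<close>: continuous, and the identity where the modulus is at most
    \<open>k\<close>.\<close>
  define clamp :: "real \<Rightarrow> complex \<Rightarrow> complex" where "clamp k z = (k / max k (norm z)) *\<^sub>R z" for k z
  have clamp_cont: "continuous_on UNIV (clamp k)" if "0 < k" for k
    unfolding clamp_def using that by (intro continuous_intros) (auto simp: max_def)
  have clamp_le: "norm (clamp k z) \<le> k" "norm (clamp k z) \<le> norm z" if "0 < k" for k z
  proof -
    have "k / max k (norm z) * norm z \<le> k"
      using that by (simp add: field_simps max_def)
    moreover have "k / max k (norm z) * norm z \<le> 1 * norm z"
      using that by (intro mult_right_mono) (auto simp: divide_le_eq max_def)
    ultimately show "norm (clamp k z) \<le> k" "norm (clamp k z) \<le> norm z"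
      using that by (simp_all add: clamp_def max_def)
  qed
  have clamp_eq: "clamp k z = z" if "norm z \<le> k" "0 < k" for k z
    using that by (simp add: clamp_def max_def)
  have [measurable]: "clamp k \<in> borel_measurable borel" if "0 < k" for k
    using clamp_cont[OF that] by (rule borel_measurable_continuous_onI)
  have [measurable]: "(\<lambda>x. clamp k (f x)) \<in> borel_measurable lebesgue" if "0 < k" for k
    using that by measurable
  have "(\<lambda>i. \<integral>\<^sup>+x. ennreal (norm (indicat_real Q x *\<^sub>R f x - indicat_real Q x *\<^sub>R clamp (real (Suc i)) (f x))) \<partial>lebesgue) \<longlonglongrightarrow> 0"
  proof (rule nn_integral_dominated_convergence_norm)
    show "AE x in lebesgue. norm (indicat_real Q x *\<^sub>R clamp (real (Suc i)) (f x)) \<le> indicat_real Q x * norm (f x)" for i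
      using clamp_le by (auto simp: indicator_def)
    have "(\<integral>\<^sup>+x. ennreal (indicat_real Q x * norm (f x)) \<partial>lebesgue) = (\<integral>\<^sup>+x\<in>Q. ennreal (norm (f x)) \<partial>lebesgue)"
      by (intro nn_integral_cong) (auto simp: indicator_def)
    with f show "(\<integral>\<^sup>+x. ennreal (indicat_real Q x * norm (f x)) \<partial>lebesgue) < \<infinity>" by simp
    show "AE x in lebesgue. (\<lambda>i. indicat_real Q x *\<^sub>R clamp (real (Suc i)) (f x)) \<longlonglongrightarrow> indicat_real Q x *\<^sub>R f x"
    proof (rule AE_I2)
      fix x
      obtain N :: nat where "norm (f x) < real N"
        using reals_Archimedean2 by blast
      then have "\<forall>i\<ge>N. clamp (real (Suc i)) (f x) = f x"
        by (auto intro!: clamp_eq)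
      then show "(\<lambda>i. indicat_real Q x *\<^sub>R clamp (real (Suc i)) (f x)) \<longlonglongrightarrow> indicat_real Q x *\<^sub>R f x"
        by (intro tendsto_eventually) (auto simp: eventually_sequentially)
    qed
  qed measurable
  then have "\<forall>\<^sub>F i in sequentially. (\<integral>\<^sup>+x. ennreal (norm (indicat_real Q x *\<^sub>R f x - indicat_real Q x *\<^sub>R clamp (real (Suc i)) (f x))) \<partial>lebesgue) < ennreal (\<epsilon> / 2)"
    using e by (intro order_tendstoD(2)) auto
  then obtain i where i: "(\<integral>\<^sup>+x. ennreal (norm (indicat_real Q x *\<^sub>R f x - indicat_real Q x *\<^sub>R clamp (real (Suc i)) (f x))) \<partial>lebesgue) < ennreal (\<epsilon> / 2)"
    by (auto simp: eventually_sequentially)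
  define k where "k = real (Suc i)"
  have k: "0 < k" by (simp add: k_def)
  \<comment> \<open>This notion of measurability supplies continuous functions that converge to
    \<open>f\<close> off a negligible set.\<close>
  have "f measurable_on UNIV"
    by (rule lebesgue_measurable_imp_measurable_on) auto
  then obtain N h where N: "negligible N" and h: "\<And>n. continuous_on UNIV (h n)"
    and lim: "\<And>x. x \<notin> N \<Longrightarrow> (\<lambda>n. h n x) \<longlonglongrightarrow> f x"
    unfolding measurable_on_def by auto
  have hc: "continuous_on UNIV (\<lambda>x. clamp k (h n x))" for n
    using continuous_on_compose2[OF clamp_cont[OF k] h] by simp
  have [measurable]: "(\<lambda>x. clamp k (h n x)) \<in> borel_measurable lebesgue" for n
    by (intro measurable_completion) (simp add: borel_measurable_continuous_onI hc)
  have "AE x in lebesgue. x \<notin> N"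
    using N by (simp add: AE_not_in negligible_iff_null_sets)
  then have AElim: "AE x in lebesgue. (\<lambda>n. indicat_real Q x *\<^sub>R clamp k (h n x)) \<longlonglongrightarrow> indicat_real Q x *\<^sub>R clamp k (f x)"
  proof eventually_elim
    case (elim x)
    have "isCont (clamp k) (f x)"
      using clamp_cont[OF k] by (simp add: continuous_on_eq_continuous_at)
    then have "(\<lambda>n. clamp k (h n x)) \<longlonglongrightarrow> clamp k (f x)"
      using lim[OF elim] by (rule isCont_tendsto_compose)
    then show ?case by (intro tendsto_intros)
  qed
  have "(\<lambda>n. \<integral>\<^sup>+x. ennreal (norm (indicat_real Q x *\<^sub>R clamp k (f x) - indicat_real Q x *\<^sub>R clamp k (h n x))) \<partial>lebesgue) \<longlonglongrightarrow> 0"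
  proof (rule nn_integral_dominated_convergence_norm)
    show "AE x in lebesgue. norm (indicat_real Q x *\<^sub>R clamp k (h n x)) \<le> indicat_real Q x * k" for n
      using clamp_le(1)[OF k] by (auto simp: indicator_def)
    have "(\<integral>\<^sup>+x. ennreal (indicat_real Q x * k) \<partial>lebesgue) = (\<integral>\<^sup>+x. ennreal k * indicator Q x \<partial>lebesgue)"
      by (intro nn_integral_cong) (auto simp: indicator_def)
    also have "\<dots> < \<infinity>"
      using Q by (simp add: nn_integral_cmult ennreal_mult_less_top)
    finally show "(\<integral>\<^sup>+x. ennreal (indicat_real Q x * k) \<partial>lebesgue) < \<infinity>" .
  qed (use AElim k in measurable)
  then have "\<forall>\<^sub>F n in sequentially. (\<integral>\<^sup>+x. ennreal (norm (indicat_real Q x *\<^sub>R clamp k (f x) - indicat_real Q x *\<^sub>R clamp k (h n x))) \<partial>lebesgue) < ennreal (\<epsilon> / 2)"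
    using e by (intro order_tendstoD(2)) auto
  then obtain n where n: "(\<integral>\<^sup>+x. ennreal (norm (indicat_real Q x *\<^sub>R clamp k (f x) - indicat_real Q x *\<^sub>R clamp k (h n x))) \<partial>lebesgue) < ennreal (\<epsilon> / 2)"
    by (auto simp: eventually_sequentially)
  have "(\<integral>\<^sup>+x\<in>Q. ennreal (norm (f x - clamp k (h n x))) \<partial>lebesgue) \<le>
      (\<integral>\<^sup>+x. ennreal (norm (indicat_real Q x *\<^sub>R f x - indicat_real Q x *\<^sub>R clamp k (f x)))
        + ennreal (norm (indicat_real Q x *\<^sub>R clamp k (f x) - indicat_real Q x *\<^sub>R clamp k (h n x))) \<partial>lebesgue)"
  proof (intro nn_integral_mono)
    fix x
    show "ennreal (norm (f x - clamp k (h n x))) * indicator Q x \<le>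
        ennreal (norm (indicat_real Q x *\<^sub>R f x - indicat_real Q x *\<^sub>R clamp k (f x)))
        + ennreal (norm (indicat_real Q x *\<^sub>R clamp k (f x) - indicat_real Q x *\<^sub>R clamp k (h n x)))"
      using norm_triangle_ineq[of "f x - clamp k (f x)" "clamp k (f x) - clamp k (h n x)"]
      by (auto simp: indicator_def simp flip: ennreal_plus intro!: ennreal_leI)
  qed
  also have "\<dots> = (\<integral>\<^sup>+x. ennreal (norm (indicat_real Q x *\<^sub>R f x - indicat_real Q x *\<^sub>R clamp k (f x))) \<partial>lebesgue)
      + (\<integral>\<^sup>+x. ennreal (norm (indicat_real Q x *\<^sub>R clamp k (f x) - indicat_real Q x *\<^sub>R clamp k (h n x))) \<partial>lebesgue)"
    using k by (intro nn_integral_add) measurable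
  also have "\<dots> \<le> ennreal (\<epsilon> / 2) + ennreal (\<epsilon> / 2)"
    using i n by (intro add_mono) (auto simp: k_def)
  also have "\<dots> = ennreal \<epsilon>"
    using e by (simp flip: ennreal_plus)
  finally show ?thesis
    by (rule that[OF hc])
qed

text \<open>Replace \<open>b\<close> by a continuous \<open>g\<close> close to it in mean;
  contraction handles the means of \<open>b - g\<close>, and uniform continuity of \<open>g\<close>
  on a ball containing the cube handles the rest.\<close>

lemma dyadic_mean_L1:
  fixes b :: "real^'n \<Rightarrow> complex"
  assumes b: "locally_integrable b" and l: "0 < l" and e: "0 < \<epsilon>"
  shows "\<exists>m0. \<forall>m\<ge>m0. (\<integral>\<^sup>+x\<in>cube a l. ennreal (norm (dyadic_mean b m a l x - b x)) \<partial>lebesgue) \<le> ennreal \<epsilon>"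
proof -
  let ?d = "real CARD('n)"
  note [measurable] = locally_integrable_measurable[OF b]
  have "integrable lebesgue (\<lambda>x. indicat_real (cube a l) x *\<^sub>R b x)"
    using set_integrable_locally_integrable[OF b sets_cube bounded_cube] by (simp add: set_integrable_def)
  then have "(\<integral>\<^sup>+x. ennreal (norm (indicat_real (cube a l) x *\<^sub>R b x)) \<partial>lebesgue) < \<infinity>"
    by (simp add: integrable_iff_bounded)
  also have "(\<integral>\<^sup>+x. ennreal (norm (indicat_real (cube a l) x *\<^sub>R b x)) \<partial>lebesgue)
      = (\<integral>\<^sup>+x\<in>cube a l. ennreal (norm (b x)) \<partial>lebesgue)"
    by (intro nn_integral_cong) (auto simp: indicator_def)
  finally obtain g where g: "continuous_on UNIV g"
    and g1: "(\<integral>\<^sup>+x\<in>cube a l. ennreal (norm (b x - g x)) \<partial>lebesgue) \<le> ennreal (\<epsilon> / 3)"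
    using l e by (rule_tac continuous_approx_L1[of b "cube a l" "\<epsilon> / 3"]) (auto simp: emeasure_cube)
  have gi: "locally_integrable g"
    using g by (rule continuous_locally_integrable)
  note [measurable] = locally_integrable_measurable[OF gi]
  have sub: "cube a l \<subseteq> cball a (?d * l)"
    using cube_dist[OF vertex_mem_cube[OF l]] by auto
  have "uniformly_continuous_on (cball a (?d * l)) g"
    using g by (intro compact_uniformly_continuous) (auto intro: continuous_on_subset)
  \<comment> \<open>A uniform error \<open>e'\<close> contributes \<open>\<epsilon> / 3\<close>
    after integration over the cube.\<close>
  moreover define e' where "e' = \<epsilon> / 3 / l ^ CARD('n)"
  moreover have "0 < e'"
    using e l by (simp add: e'_def)
  ultimately obtain \<delta> where d: "0 < \<delta>"
    "\<And>x y. x \<in> cball a (?d * l) \<Longrightarrow> y \<in> cball a (?d * l) \<Longrightarrow> dist y x < \<delta> \<Longrightarrow> dist (g y) (g x) < e'"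
    unfolding uniformly_continuous_on_def by metis
  obtain m0 :: nat where m0: "?d * l / \<delta> < 2 ^ m0"
    using real_arch_pow[of 2 "?d * l / \<delta>"] by auto
  show ?thesis
  proof (intro exI allI impI)
    fix m assume "m0 \<le> m"
    then have "(2::real) ^ m0 \<le> 2 ^ m"
      by (intro power_increasing) auto
    with m0 have "?d * l / \<delta> < 2 ^ m" by linarith
    then have dm: "?d * l / 2 ^ m < \<delta>"
      using d(1) by (simp add: field_simps)
    have gm: "norm (dyadic_mean g m a l x - g x) \<le> e'" if "x \<in> cube a l" for x
    proof (rule dyadic_mean_continuous[OF gi l that])
      fix y assume "y \<in> cube a l" "dist y x \<le> ?d * l / 2 ^ m"
      then have "dist (g y) (g x) < e'"
        using dm sub that by (intro d(2)) auto
      then show "norm (g y - g x) \<le> e'"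
        by (simp add: dist_norm)
    qed
    have "(\<integral>\<^sup>+x\<in>cube a l. ennreal (norm (dyadic_mean b m a l x - b x)) \<partial>lebesgue) \<le>
      (\<integral>\<^sup>+x. ennreal (norm (dyadic_mean (\<lambda>x. b x - g x) m a l x)) * indicator (cube a l) x
        + (ennreal (norm (b x - g x)) * indicator (cube a l) x + ennreal e' * indicator (cube a l) x) \<partial>lebesgue)"
    proof (intro nn_integral_mono)
      fix x
      have "norm (dyadic_mean b m a l x - b x) \<le> norm (dyadic_mean b m a l x - dyadic_mean g m a l x)
          + (norm (b x - g x) + e')" if "x \<in> cube a l"
        using gm[OF that] norm_triangle_ineq[of "dyadic_mean b m a l x - dyadic_mean g m a l x" "dyadic_mean g m a l x - b x"]
          norm_triangle_ineq[of "dyadic_mean g m a l x - g x" "g x - b x"] norm_minus_commute[of "b x" "g x"]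
        by simp
      then show "ennreal (norm (dyadic_mean b m a l x - b x)) * indicator (cube a l) x \<le>
        ennreal (norm (dyadic_mean (\<lambda>x. b x - g x) m a l x)) * indicator (cube a l) x
        + (ennreal (norm (b x - g x)) * indicator (cube a l) x + ennreal e' * indicator (cube a l) x)"
        using \<open>0 < e'\<close>
        by (auto simp: indicator_def dyadic_mean_diff[OF b gi] simp flip: ennreal_plus intro!: ennreal_leI)
    qed
    also have "\<dots> = (\<integral>\<^sup>+x\<in>cube a l. ennreal (norm (dyadic_mean (\<lambda>x. b x - g x) m a l x)) \<partial>lebesgue)
        + ((\<integral>\<^sup>+x\<in>cube a l. ennreal (norm (b x - g x)) \<partial>lebesgue) + (\<integral>\<^sup>+x\<in>cube a l. ennreal e' \<partial>lebesgue))"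
      by (simp add: nn_integral_add)
    also have "(\<integral>\<^sup>+x\<in>cube a l. ennreal e' \<partial>lebesgue) = ennreal (\<epsilon> / 3)"
      using l \<open>0 < e'\<close> by (simp add: nn_integral_cmult emeasure_cube e'_def flip: ennreal_mult)
    also have "(\<integral>\<^sup>+x\<in>cube a l. ennreal (norm (dyadic_mean (\<lambda>x. b x - g x) m a l x)) \<partial>lebesgue)
        \<le> (\<integral>\<^sup>+x\<in>cube a l. ennreal (norm (b x - g x)) \<partial>lebesgue)"
    proof (rule nn_integral_dyadic_mean_le[OF _ l])
      show "locally_integrable (\<lambda>x. b x - g x)"
        using b gi unfolding locally_integrable_def by (auto intro: set_integral_diff)
    qed
    also note g1
    also have "ennreal (\<epsilon> / 3) + (ennreal (\<epsilon> / 3) + ennreal (\<epsilon> / 3)) = ennreal \<epsilon>"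
      using e by (simp flip: ennreal_plus)
    finally show "(\<integral>\<^sup>+x\<in>cube a l. ennreal (norm (dyadic_mean b m a l x - b x)) \<partial>lebesgue) \<le> ennreal \<epsilon>"
      using g1 by (simp add: add_mono)
  qed
qed

text \<open>Convergence in mean yields almost everywhere convergence along a subsequence, which is
  enough for the later application of Fatou's lemma.\<close>

lemma dyadic_mean_AE_subseq:
  fixes b :: "real^'n \<Rightarrow> complex"
  assumes b: "locally_integrable b" and l: "0 < l"
  obtains \<rho> :: "nat \<Rightarrow> nat"
  where "AE x in lebesgue. x \<in> cube a l \<longrightarrow> (\<lambda>m. dyadic_mean b (\<rho> m) a l x) \<longlonglongrightarrow> b x"
proof -
  note [measurable] = locally_integrable_measurable[OF b]
  let ?u = "\<lambda>m x. indicat_real (cube a l) x *\<^sub>R (dyadic_mean b m a l x - b x)"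
  \<comment> \<open>From \<open>m0\<close> on the error has integral at most 1; this gives the
    integrability that the passage to a subsequence asks for, and explains the shift by
    \<open>m0\<close> below.\<close>
  obtain m0 where m0: "\<And>m. m0 \<le> m \<Longrightarrow>
      (\<integral>\<^sup>+x\<in>cube a l. ennreal (norm (dyadic_mean b m a l x - b x)) \<partial>lebesgue) \<le> ennreal 1"
    using dyadic_mean_L1[OF b l, of 1] by auto
  have nn: "(\<integral>\<^sup>+x. ennreal (norm (?u m x)) \<partial>lebesgue)
      = (\<integral>\<^sup>+x\<in>cube a l. ennreal (norm (dyadic_mean b m a l x - b x)) \<partial>lebesgue)" for m
    by (intro nn_integral_cong) (auto simp: indicator_def)
  have int: "integrable lebesgue (?u (m0 + m))" for m
    unfolding integrable_iff_bounded nn using m0[of "m0 + m"] by (auto intro: le_less_trans)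
  have "(\<lambda>m. \<integral>x. norm (?u (m0 + m) x) \<partial>lebesgue) \<longlonglongrightarrow> 0"
  proof (rule LIMSEQ_I)
    fix \<epsilon> :: real assume e: "0 < \<epsilon>"
    obtain m1 where m1: "\<And>m. m1 \<le> m \<Longrightarrow>
      (\<integral>\<^sup>+x\<in>cube a l. ennreal (norm (dyadic_mean b m a l x - b x)) \<partial>lebesgue) \<le> ennreal (\<epsilon> / 2)"
      using dyadic_mean_L1[OF b l, of "\<epsilon> / 2"] e by auto
    have "norm ((\<integral>x. norm (?u (m0 + m) x) \<partial>lebesgue) - 0) < \<epsilon>" if "m1 \<le> m" for m
    proof -
      have "ennreal (\<integral>x. norm (?u (m0 + m) x) \<partial>lebesgue) = (\<integral>\<^sup>+x. ennreal (norm (?u (m0 + m) x)) \<partial>lebesgue)"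
        using int[of m] by (intro nn_integral_eq_integral[symmetric] integrable_norm) auto
      also have "\<dots> \<le> ennreal (\<epsilon> / 2)"
        unfolding nn using that by (intro m1) auto
      finally have "(\<integral>x. norm (?u (m0 + m) x) \<partial>lebesgue) \<le> \<epsilon> / 2"
        using e by (subst (asm) ennreal_le_iff) auto
      moreover have "0 \<le> (\<integral>x. norm (?u (m0 + m) x) \<partial>lebesgue)"
        by (intro integral_nonneg_AE) auto
      ultimately show ?thesis
        using e by (simp only: real_norm_def)
    qed
    then show "\<exists>no. \<forall>n\<ge>no. norm ((\<integral>x. norm (?u (m0 + n) x) \<partial>lebesgue) - 0) < \<epsilon>" by blast
  qed
  from tendsto_L1_AE_subseq[OF int this] obtain r :: "nat \<Rightarrow> nat"
    where r: "AE x in lebesgue. (\<lambda>n. ?u (m0 + r n) x) \<longlonglongrightarrow> 0"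
    by blast
  show thesis
  proof (rule that[of "\<lambda>n. m0 + r n"])
    show "AE x in lebesgue. x \<in> cube a l \<longrightarrow> (\<lambda>m. dyadic_mean b (m0 + r m) a l x) \<longlonglongrightarrow> b x"
      using r
    proof eventually_elim
      case (elim x)
      show ?case
      proof
        assume "x \<in> cube a l"
        with elim have "(\<lambda>n. dyadic_mean b (m0 + r n) a l x - b x) \<longlonglongrightarrow> 0" by simp
        then show "(\<lambda>n. dyadic_mean b (m0 + r n) a l x) \<longlonglongrightarrow> b x"
          by (rule LIM_zero_cancel)
      qed
    qed
  qed
qed

lemma emeasure_eq_measure_fin: "emeasure M A < \<infinity> \<Longrightarrow> emeasure M A = ennreal (measure M A)"
  by (intro emeasure_eq_ennreal_measure) auto

section \<open>A weighted John--Nirenberg inequality\<close>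

lemma nn_integral_exp_shift:
  fixes b :: "'a \<Rightarrow> complex"
  assumes "0 \<le> c" and [measurable]: "b \<in> borel_measurable M" "A \<in> sets M"
  shows "(\<integral>\<^sup>+x\<in>A. ennreal (exp (c * norm (b x - z))) \<partial>M)
    \<le> ennreal (exp (c * norm (z' - z))) * (\<integral>\<^sup>+x\<in>A. ennreal (exp (c * norm (b x - z'))) \<partial>M)"
proof -
  have "(\<integral>\<^sup>+x\<in>A. ennreal (exp (c * norm (b x - z))) \<partial>M)
      \<le> (\<integral>\<^sup>+x. ennreal (exp (c * norm (z' - z))) * (ennreal (exp (c * norm (b x - z'))) * indicator A x) \<partial>M)"
  proof (intro nn_integral_mono)
    fix x
    have "c * norm (b x - z) \<le> c * (norm (z' - z) + norm (b x - z'))"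
      using assms(1) norm_triangle_ineq[of "z' - z" "b x - z'"] by (intro mult_left_mono) auto
    then have "exp (c * norm (b x - z)) \<le> exp (c * norm (z' - z)) * exp (c * norm (b x - z'))"
      by (simp add: ring_distribs flip: exp_add)
    then show "ennreal (exp (c * norm (b x - z))) * indicator A x \<le>
        ennreal (exp (c * norm (z' - z))) * (ennreal (exp (c * norm (b x - z'))) * indicator A x)"
      by (auto simp: indicator_def simp flip: ennreal_mult intro!: ennreal_leI)
  qed
  also have "\<dots> = ennreal (exp (c * norm (z' - z))) * (\<integral>\<^sup>+x\<in>A. ennreal (exp (c * norm (b x - z'))) \<partial>M)"
    by (intro nn_integral_cmult) measurable
  finally show ?thesis .
qed

text \<open>What the stopping argument asks of the measure \<open>M\<close>: finiteness on cubes,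
  absolute continuity, and in \<open>half\<close> the loss of a fixed fraction \<open>\<eta>\<close>
  on subsets filling at most half of a cube. The oscillation of \<open>b\<close> itself is measured
  by Lebesgue measure.\<close>

locale dyadic_oscillation =
  fixes M :: "(real^'n) measure" and b :: "real^'n \<Rightarrow> complex" and N \<eta> :: real
  assumes sets_M [measurable_cong]: "sets M = sets lebesgue"
    and fin_M: "emeasure M (cube a l) < \<infinity>"
    and null_M: "absolutely_continuous lebesgue M"
    and b: "locally_integrable b"
    and N: "0 < N"
    and osc: "0 < l \<Longrightarrow> (\<integral>\<^sup>+x\<in>cube a l. ennreal (norm (b x - ball_mean b (cube a l))) \<partial>lebesgue)
      \<le> ennreal (N * l ^ CARD('n))"
    and eta: "0 < \<eta>" "\<eta> \<le> 1"
    and half: "0 < l \<Longrightarrow> F \<in> sets lebesgue \<Longrightarrow> F \<subseteq> cube a l \<Longrightarrow> measure lebesgue F \<le> l ^ CARD('n) / 2 \<Longrightarrow>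
      measure M F \<le> (1 - \<eta>) * measure M (cube a l)"
begin

lemma b_measurable [measurable]: "b \<in> borel_measurable lebesgue"
  using b by (rule locally_integrable_measurable)

lemma cube_sets_M [simp, measurable]: "cube a l \<in> sets M"
  by (simp add: sets_M)

definition osc_int :: "complex \<Rightarrow> real^'n \<Rightarrow> real \<Rightarrow> ennreal" where
  "osc_int z a l = (\<integral>\<^sup>+x\<in>cube a l. ennreal (norm (b x - z)) \<partial>lebesgue)"

lemma osc_int_split: "0 < l \<Longrightarrow> osc_int z a l = (\<Sum>S\<in>UNIV. osc_int z (child a l S) (l / 2))"
  unfolding osc_int_def by (rule nn_integral_cube_split) auto

lemma osc_int_child: "0 < l \<Longrightarrow> osc_int z (child a l S) (l / 2) \<le> osc_int z a l"
  unfolding osc_int_def using child_subset[of l a S]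
  by (intro nn_integral_mono) (auto simp: indicator_def)

text \<open>Stopping is confined to a finite dyadic tree; the passage from dyadic means to \<open>b\<close> then
  uses convergence in mean and Fatou's lemma instead of Lebesgue's differentiation theorem.\<close>

primrec stop :: "nat \<Rightarrow> complex \<Rightarrow> real^'n \<Rightarrow> real \<Rightarrow> (real^'n) set" where
  "stop 0 z a l = (if osc_int z a l \<le> ennreal (2 * N * l ^ CARD('n)) then {} else cube a l)"
| "stop (Suc m) z a l = (if osc_int z a l \<le> ennreal (2 * N * l ^ CARD('n))
     then (\<Union>S. stop m z (child a l S) (l / 2)) else cube a l)"

lemma stop_sets [measurable, simp]: "stop m z a l \<in> sets lebesgue"
  by (induction m arbitrary: a l) auto

lemma stop_subset: "0 < l \<Longrightarrow> stop m z a l \<subseteq> cube a l"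
proof (induction m arbitrary: a l)
  case (Suc m)
  have "stop m z (child a l S) (l / 2) \<subseteq> cube a l" for S
    using Suc.IH[of "l / 2" "child a l S"] Suc.prems child_subset[of l a S] by auto
  then show ?case by auto
qed simp

lemma disjoint_stop: "0 < l \<Longrightarrow> disjoint_family_on (\<lambda>S. stop m z (child a l S) (l / 2)) UNIV"
  unfolding disjoint_family_on_def
proof (intro ballI impI)
  fix S S' :: "'n set" assume l: "0 < l" and ne: "S \<noteq> S'"
  have "cube (child a l S) (l / 2) \<inter> cube (child a l S') (l / 2) = {}"
    using l ne by (auto simp: mem_child_iff)
  then show "stop m z (child a l S) (l / 2) \<inter> stop m z (child a l S') (l / 2) = {}"
    using stop_subset[of "l / 2" m z "child a l S"] stop_subset[of "l / 2" m z "child a l S'"] l by auto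
qed

text \<open>Chebyshev on the selected cubes: on each of them the average of
  \<open>norm (b x - z)\<close> exceeds \<open>2 * N\<close>, and they do not overlap. At the root,
  with \<open>z\<close> its mean, the integral is at most \<open>N * l ^ CARD('n)\<close>, so the
  selected cubes fill at most half of it.\<close>

lemma emeasure_stop_le: "0 < l \<Longrightarrow> ennreal (2 * N) * emeasure lebesgue (stop m z a l) \<le> osc_int z a l"
proof (induction m arbitrary: a l)
  case 0
  then show ?case
    using N by (auto simp: emeasure_cube not_le simp flip: ennreal_mult)
next
  case (Suc m)
  show ?case
  proof (cases "osc_int z a l \<le> ennreal (2 * N * l ^ CARD('n))")
    case True
    have "ennreal (2 * N) * emeasure lebesgue (stop (Suc m) z a l)
        \<le> ennreal (2 * N) * (\<Sum>S\<in>UNIV. emeasure lebesgue (stop m z (child a l S) (l / 2)))"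
      using True by (intro mult_left_mono) (auto intro!: emeasure_subadditive_finite)
    also have "\<dots> \<le> (\<Sum>S\<in>UNIV. osc_int z (child a l S) (l / 2))"
      unfolding sum_distrib_left using Suc by (intro sum_mono) auto
    finally show ?thesis
      using Suc.prems by (simp add: osc_int_split[of l z a])
  next
    case False
    then show ?thesis
      using N Suc.prems by (auto simp: emeasure_cube not_le simp flip: ennreal_mult)
  qed
qed

text \<open>The mean over a cube whose parent is not selected is within
  \<open>2 ^ CARD('n) * (2 * N)\<close> of \<open>z\<close>, since passing to a child multiplies the
  average of \<open>norm (b x - z)\<close> by at most \<open>2 ^ CARD('n)\<close>. The rate makes
  the exponential of that distance at most \<open>1 + \<eta> / 2\<close>.\<close>

definition rate :: real where "rate = ln (1 + \<eta> / 2) / (2 ^ CARD('n) * (2 * N))"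

lemma rate_pos: "0 < rate"
  using eta N by (simp add: rate_def)

definition exp_int :: "nat \<Rightarrow> complex \<Rightarrow> real^'n \<Rightarrow> real \<Rightarrow> ennreal" where
  "exp_int m z a l = (\<integral>\<^sup>+x\<in>cube a l. ennreal (exp (rate * norm (dyadic_mean b m a l x - z))) \<partial>M)"

text \<open>An unselected cube of the last generation costs the factor
  \<open>1 + \<eta> / 2\<close>; a selected cube costs this factor times the
  \<open>4 / \<eta>\<close> of the inductive bound around its own mean. Both summands are measures,
  so the bound adds up over children.\<close>

definition exp_bound :: "nat \<Rightarrow> complex \<Rightarrow> real^'n \<Rightarrow> real \<Rightarrow> ennreal" where
  "exp_bound m z a l = ennreal (1 + \<eta> / 2) * (emeasure M (cube a l) + ennreal (4 / \<eta>) * emeasure M (stop m z a l))"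

lemma exp_int_split:
  "0 < l \<Longrightarrow> exp_int (Suc m) z a l = (\<Sum>S\<in>UNIV. exp_int m z (child a l S) (l / 2))"
  unfolding exp_int_def by (rule nn_integral_cube_split) (auto simp: sets_M)

lemma exp_bound_split:
  assumes l: "0 < l" and "osc_int z a l \<le> ennreal (2 * N * l ^ CARD('n))"
  shows "exp_bound (Suc m) z a l = (\<Sum>S\<in>UNIV. exp_bound m z (child a l S) (l / 2))"
proof -
  have 1: "emeasure M (cube a l) = (\<Sum>S\<in>UNIV. emeasure M (cube (child a l S) (l / 2)))"
  proof -
    have "disjoint_family_on (\<lambda>S. cube (child a l S) (l / 2)) UNIV"
      using l by (auto simp: disjoint_family_on_def mem_child_iff)
    then show ?thesis
      unfolding cube_eq_UN_child[OF l, of a] by (intro sum_emeasure[symmetric]) auto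
  qed
  have 2: "emeasure M (stop (Suc m) z a l) = (\<Sum>S\<in>UNIV. emeasure M (stop m z (child a l S) (l / 2)))"
    using assms disjoint_stop[OF l] by (simp del: sum_emeasure) (intro sum_emeasure[symmetric]; auto simp: sets_M)
  show ?thesis
    unfolding exp_bound_def 1 2 sum_distrib_left sum.distrib[symmetric] ..
qed

lemma norm_mean_le:
  assumes l: "0 < l" and "osc_int z a l \<le> ennreal (2 ^ CARD('n) * (2 * N) * l ^ CARD('n))"
  shows "exp (rate * norm (ball_mean b (cube a l) - z)) \<le> 1 + \<eta> / 2"
proof -
  have "ennreal (norm (ball_mean b (cube a l) - z) * l ^ CARD('n)) \<le> ennreal (2 ^ CARD('n) * (2 * N) * l ^ CARD('n))"
    using cube_mean_diff_le[OF b l] assms(2) unfolding osc_int_def by (rule order_trans)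
  then have "norm (ball_mean b (cube a l) - z) * l ^ CARD('n) \<le> 2 ^ CARD('n) * (2 * N) * l ^ CARD('n)"
    using N l by (subst (asm) ennreal_le_iff) auto
  then have "norm (ball_mean b (cube a l) - z) \<le> 2 ^ CARD('n) * (2 * N)"
    using l by simp
  then have "rate * norm (ball_mean b (cube a l) - z) \<le> rate * (2 ^ CARD('n) * (2 * N))"
    using rate_pos by (intro mult_left_mono) auto
  also have "\<dots> = ln (1 + \<eta> / 2)"
    using N by (simp add: rate_def)
  finally show ?thesis
    using eta by (metis exp_le_cancel_iff exp_ln add_pos_pos half_gt_zero zero_less_one)
qed

lemma exp_int_shift:
  "exp_int m z a l \<le> ennreal (exp (rate * norm (z' - z))) * exp_int m z' a l"
  unfolding exp_int_def using rate_pos by (intro nn_integral_exp_shift) auto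

text \<open>A selected cube may have any number of generations left below it, hence all
  \<open>k \<le> m\<close> and all cubes at once.\<close>

definition bounded_upto :: "nat \<Rightarrow> bool" where
  "bounded_upto m \<longleftrightarrow> (\<forall>k\<le>m. \<forall>a. \<forall>l>0. exp_int k (ball_mean b (cube a l)) a l \<le> ennreal (4 / \<eta>) * emeasure M (cube a l))"

lemma exp_int_step:
  assumes l: "0 < l" and ns: "osc_int z a l \<le> ennreal (2 * N * l ^ CARD('n))"
    and IH: "\<And>a l. 0 < l \<Longrightarrow> osc_int z a l \<le> ennreal (2 ^ CARD('n) * (2 * N) * l ^ CARD('n)) \<Longrightarrow>
      exp_int m z a l \<le> exp_bound m z a l"
  shows "exp_int (Suc m) z a l \<le> exp_bound (Suc m) z a l"
  unfolding exp_bound_split[OF l ns] exp_int_split[OF l]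
proof (intro sum_mono IH)
  fix S
  have "osc_int z (child a l S) (l / 2) \<le> osc_int z a l"
    using l by (rule osc_int_child)
  also note ns
  also have "2 * N * l ^ CARD('n) = 2 ^ CARD('n) * (2 * N) * (l / 2) ^ CARD('n)"
    by (simp add: power_divide)
  finally show "osc_int z (child a l S) (l / 2) \<le> ennreal (2 ^ CARD('n) * (2 * N) * (l / 2) ^ CARD('n))" .
qed (use l in auto)

text \<open>There are two thresholds: selection happens at \<open>2 * N\<close>, while the
  hypothesis tolerates the average that a child may inherit from a parent that was not selected. An
  unselected cube is split; a selected one is recentered at its own mean, where
  \<open>bounded_upto\<close> applies.\<close>

lemma exp_int_le_bound:
  assumes "bounded_upto m" "0 < l" "osc_int z a l \<le> ennreal (2 ^ CARD('n) * (2 * N) * l ^ CARD('n))"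
  shows "exp_int m z a l \<le> exp_bound m z a l"
  using assms
proof (induction m arbitrary: a l)
  case 0
  have "exp_int 0 z a l = ennreal (exp (rate * norm (ball_mean b (cube a l) - z))) * emeasure M (cube a l)"
    by (simp add: exp_int_def nn_integral_cmult)
  also have "\<dots> \<le> ennreal (1 + \<eta> / 2) * emeasure M (cube a l)"
    using norm_mean_le[OF 0(2,3)] by (intro mult_right_mono ennreal_leI) auto
  also have "\<dots> \<le> exp_bound 0 z a l"
    unfolding exp_bound_def by (intro mult_left_mono) auto
  finally show ?case .
next
  case (Suc m)
  show ?case
  proof (cases "osc_int z a l \<le> ennreal (2 * N * l ^ CARD('n))")
    case True
    have "bounded_upto m"
      using Suc.prems(1) by (auto simp: bounded_upto_def)
    then show ?thesis
      using Suc.IH by (intro exp_int_step[OF Suc.prems(2) True]) auto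
  next
    case False
    have "exp_int (Suc m) z a l \<le> ennreal (exp (rate * norm (ball_mean b (cube a l) - z)))
        * exp_int (Suc m) (ball_mean b (cube a l)) a l"
      by (rule exp_int_shift)
    also have "\<dots> \<le> ennreal (1 + \<eta> / 2) * (ennreal (4 / \<eta>) * emeasure M (cube a l))"
      using norm_mean_le[OF Suc.prems(2,3)] Suc.prems(1,2) unfolding bounded_upto_def
      by (intro mult_mono ennreal_leI) auto
    also have "\<dots> \<le> exp_bound (Suc m) z a l"
      using False by (auto simp: exp_bound_def intro: mult_left_mono)
    finally show ?thesis .
  qed
qed

text \<open>The root is not selected around its own mean, so one generation is used up and strong
  induction applies below it. The selected cubes carry at most the fraction
  \<open>1 - \<eta>\<close> of the measure, and \<open>(1 + \<eta> / 2) * (1 + 4 / \<eta> * (1 -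
  \<eta>)) \<le> 4 / \<eta>\<close> closes the induction with a constant that does not deteriorate
  with \<open>m\<close>.\<close>

lemma exp_int_mean_le: "0 < l \<Longrightarrow> exp_int m (ball_mean b (cube a l)) a l \<le> ennreal (4 / \<eta>) * emeasure M (cube a l)"
proof (induction m arbitrary: a l rule: less_induct)
  case (less m)
  show ?case
  proof (cases m)
    case 0
    have "exp_int 0 (ball_mean b (cube a l)) a l = 1 * emeasure M (cube a l)"
      by (simp add: exp_int_def)
    also have "\<dots> \<le> ennreal (4 / \<eta>) * emeasure M (cube a l)"
      using eta by (intro mult_right_mono) auto
    finally show ?thesis by (simp add: 0)
  next
    case (Suc k)
    let ?z = "ball_mean b (cube a l)"
    have bu: "bounded_upto k"
      using less by (auto simp: bounded_upto_def Suc)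
    have o: "osc_int ?z a l \<le> ennreal (N * l ^ CARD('n))"
      using osc[OF less.prems] by (simp add: osc_int_def)
    also have "\<dots> \<le> ennreal (2 * N * l ^ CARD('n))"
      using N less.prems by (intro ennreal_leI) auto
    finally have ns: "osc_int ?z a l \<le> ennreal (2 * N * l ^ CARD('n))" .
    have fs: "emeasure lebesgue (stop m ?z a l) < \<infinity>" "emeasure M (stop m ?z a l) < \<infinity>"
    proof -
      have "emeasure lebesgue (stop m ?z a l) \<le> emeasure lebesgue (cube a l)"
        "emeasure M (stop m ?z a l) \<le> emeasure M (cube a l)"
        using stop_subset[OF less.prems] by (auto intro!: emeasure_mono)
      then show "emeasure lebesgue (stop m ?z a l) < \<infinity>" "emeasure M (stop m ?z a l) < \<infinity>"
        using fin_M[of a l] less.prems by (auto simp: emeasure_cube intro: le_less_trans)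
    qed
    have "ennreal (2 * N) * ennreal (measure lebesgue (stop m ?z a l)) \<le> ennreal (N * l ^ CARD('n))"
      unfolding emeasure_eq_measure_fin[OF fs(1), symmetric]
      using emeasure_stop_le[OF less.prems] o by (rule order_trans)
    also have "\<dots> = ennreal N * ennreal (l ^ CARD('n))"
      using N less.prems by (intro ennreal_mult) auto
    finally have "ennreal (2 * N) * ennreal (measure lebesgue (stop m ?z a l)) \<le> ennreal N * ennreal (l ^ CARD('n))" .
    then have "2 * N * measure lebesgue (stop m ?z a l) \<le> N * l ^ CARD('n)"
      using N less.prems by (intro ennreal_mult_le_multD) auto
    then have "measure lebesgue (stop m ?z a l) \<le> l ^ CARD('n) / 2"
      using N by simp
    then have st: "measure M (stop m ?z a l) \<le> (1 - \<eta>) * measure M (cube a l)"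
      using less.prems by (intro half stop_subset) auto
    have "exp_int m ?z a l \<le> exp_bound m ?z a l"
      unfolding Suc using bu by (intro exp_int_step[OF less.prems ns] exp_int_le_bound)
    also have "\<dots> = ennreal ((1 + \<eta> / 2) * (measure M (cube a l) + 4 / \<eta> * measure M (stop m ?z a l)))"
      using eta unfolding exp_bound_def emeasure_eq_measure_fin[OF fs(2)] emeasure_eq_measure_fin[OF fin_M]
      by (simp flip: ennreal_mult ennreal_plus)
    also have "\<dots> \<le> ennreal (4 / \<eta> * measure M (cube a l))"
    proof (intro ennreal_leI)
      have alg: "x * (t + k * (u * t)) = (x * (1 + k * u)) * t" for x t k u :: real
        by (simp add: algebra_simps)
      have "(1 + \<eta> / 2) * (measure M (cube a l) + 4 / \<eta> * measure M (stop m ?z a l))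
          \<le> (1 + \<eta> / 2) * (measure M (cube a l) + 4 / \<eta> * ((1 - \<eta>) * measure M (cube a l)))"
        using st eta by (intro mult_left_mono add_left_mono) auto
      also have "\<dots> = ((1 + \<eta> / 2) * (1 + 4 / \<eta> * (1 - \<eta>))) * measure M (cube a l)"
        by (rule alg)
      also have "\<dots> \<le> 4 / \<eta> * measure M (cube a l)"
      proof (rule mult_right_mono)
        show "(1 + \<eta> / 2) * (1 + 4 / \<eta> * (1 - \<eta>)) \<le> 4 / \<eta>"
          using eta by (simp add: field_simps)
      qed simp
      finally show "(1 + \<eta> / 2) * (measure M (cube a l) + 4 / \<eta> * measure M (stop m ?z a l))
          \<le> 4 / \<eta> * measure M (cube a l)" .
    qed
    also have "\<dots> = ennreal (4 / \<eta>) * emeasure M (cube a l)"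
      using eta unfolding emeasure_eq_measure_fin[OF fin_M] by (intro ennreal_mult) auto
    finally show ?thesis .
  qed
qed

lemma exponential_integrability:
  assumes l: "0 < l"
  shows "(\<integral>\<^sup>+x\<in>cube a l. ennreal (exp (rate * norm (b x - ball_mean b (cube a l)))) \<partial>M)
    \<le> ennreal (4 / \<eta>) * emeasure M (cube a l)"
proof -
  let ?z = "ball_mean b (cube a l)"
  obtain \<rho> where "AE x in lebesgue. x \<in> cube a l \<longrightarrow> (\<lambda>m. dyadic_mean b (\<rho> m) a l x) \<longlonglongrightarrow> b x"
    using dyadic_mean_AE_subseq[OF b l] by blast
  \<comment> \<open>Absolute continuity carries the convergence from Lebesgue measure to
    \<open>M\<close>.\<close>
  then have ae: "AE x in M. x \<in> cube a l \<longrightarrow> (\<lambda>m. dyadic_mean b (\<rho> m) a l x) \<longlonglongrightarrow> b x"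
    by (rule absolutely_continuous_AE[OF _ null_M, rotated]) (simp add: sets_M)
  let ?f = "\<lambda>m x. ennreal (exp (rate * norm (dyadic_mean b m a l x - ?z))) * indicator (cube a l) x"
  have "(\<integral>\<^sup>+x\<in>cube a l. ennreal (exp (rate * norm (b x - ?z))) \<partial>M)
      = (\<integral>\<^sup>+x. liminf (\<lambda>m. ?f (\<rho> m) x) \<partial>M)"
  proof (intro nn_integral_cong_AE)
    show "AE x in M. ennreal (exp (rate * norm (b x - ?z))) * indicator (cube a l) x = liminf (\<lambda>m. ?f (\<rho> m) x)"
      using ae
    proof eventually_elim
      case (elim x)
      have "(\<lambda>m. ?f (\<rho> m) x) \<longlonglongrightarrow> ennreal (exp (rate * norm (b x - ?z))) * indicator (cube a l) x"
      proof (cases "x \<in> cube a l")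
        case True
        then have "(\<lambda>m. ennreal (exp (rate * norm (dyadic_mean b (\<rho> m) a l x - ?z)))) \<longlonglongrightarrow>
            ennreal (exp (rate * norm (b x - ?z)))"
          using elim by (intro tendsto_intros) auto
        then show ?thesis
          using True by simp
      qed simp
      then show ?case
        by (simp add: lim_imp_Liminf)
    qed
  qed
  also have "\<dots> \<le> liminf (\<lambda>m. \<integral>\<^sup>+x. ?f (\<rho> m) x \<partial>M)"
    by (intro nn_integral_liminf) measurable
  also have "\<dots> \<le> liminf (\<lambda>m::nat. ennreal (4 / \<eta>) * emeasure M (cube a l))"
    using exp_int_mean_le[OF l, unfolded exp_int_def] by (intro Liminf_mono always_eventually) auto
  also have "\<dots> = ennreal (4 / \<eta>) * emeasure M (cube a l)"
    by (simp add: Liminf_const)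
  finally show ?thesis .
qed

end

section \<open>Mean oscillation on balls and on cubes\<close>

lemma BMO_ball_bound:
  fixes b :: "real^'n \<Rightarrow> complex"
  assumes "b \<in> BMO"
  obtains N where "0 < N" "\<And>y r. 0 < r \<Longrightarrow>
    (\<integral>\<^sup>+x\<in>ball y r. ennreal (norm (b x - ball_mean b (ball y r))) \<partial>lebesgue) \<le> ennreal (N * r ^ CARD('n))"
proof -
  have fin: "BMO_norm b < \<infinity>" using assms by (simp add: BMO_def)
  \<comment> \<open>Adding 1 keeps \<open>N\<close> positive also for constant \<open>b\<close>; the
    volume of the unit ball is absorbed.\<close>
  define N where "N = (enn2real (BMO_norm b) + 1) * unit_ball_vol (real CARD('n))"
  have "0 < N" by (simp add: N_def add_nonneg_pos)
  moreover have "(\<integral>\<^sup>+x\<in>ball y r. ennreal (norm (b x - ball_mean b (ball y r))) \<partial>lebesgue) \<le> ennreal (N * r ^ CARD('n))"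
    (is "?I \<le> _") if r: "0 < r" for y r
  proof -
    have "?I / emeasure lebesgue (ball y r) \<le> BMO_norm b"
      unfolding BMO_norm_def using r by (intro SUP_upper2[of "(y, r)"]) auto
    also have "\<dots> \<le> ennreal (enn2real (BMO_norm b) + 1)"
      using fin by (cases "BMO_norm b") auto
    finally have 1: "?I / ennreal (measure lebesgue (ball y r)) \<le> ennreal (enn2real (BMO_norm b) + 1)"
      by (simp only: emeasure_ball_real)
    have "?I = ?I / ennreal (measure lebesgue (ball y r)) * ennreal (measure lebesgue (ball y r))"
      using measure_ball_pos[OF r, of y] by (simp only: ennreal_divide_times) (simp add: ennreal_mult_divide_eq)
    also have "\<dots> \<le> ennreal (enn2real (BMO_norm b) + 1) * ennreal (measure lebesgue (ball y r))"
      using 1 by (intro mult_right_mono) auto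
    also have "\<dots> = ennreal (N * r ^ CARD('n))"
      using r by (subst ennreal_mult[symmetric]) (auto simp: measure_ball_scale N_def mult_ac)
    finally show ?thesis .
  qed
  ultimately show ?thesis by (rule that)
qed

lemma BMO_locally_integrable: "b \<in> BMO \<Longrightarrow> locally_integrable b"
  by (simp add: BMO_def)

text \<open>A cube lies in a ball about its vertex of radius \<open>(CARD('n) + 1) * l\<close>. The
  oscillation is first taken around the mean over that ball; exchanging it for the mean over the
  cube costs the factor 2 in \<open>N'\<close>.\<close>

lemma BMO_cube_bound:
  fixes b :: "real^'n \<Rightarrow> complex"
  assumes "b \<in> BMO"
  obtains N where "0 < N" "\<And>a l. 0 < l \<Longrightarrow>
    (\<integral>\<^sup>+x\<in>cube a l. ennreal (norm (b x - ball_mean b (cube a l))) \<partial>lebesgue) \<le> ennreal (N * l ^ CARD('n))"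
proof -
  note b = BMO_locally_integrable[OF assms]
  note [measurable] = locally_integrable_measurable[OF b]
  let ?d = "real CARD('n) + 1"
  obtain N where N: "0 < N" "\<And>y r. 0 < r \<Longrightarrow>
    (\<integral>\<^sup>+x\<in>ball y r. ennreal (norm (b x - ball_mean b (ball y r))) \<partial>lebesgue) \<le> ennreal (N * r ^ CARD('n))"
    by (rule BMO_ball_bound[OF assms]) blast
  define N' where "N' = 2 * N * ?d ^ CARD('n)"
  have "0 < N'" using N(1) by (simp add: N'_def)
  moreover have "(\<integral>\<^sup>+x\<in>cube a l. ennreal (norm (b x - ball_mean b (cube a l))) \<partial>lebesgue) \<le> ennreal (N' * l ^ CARD('n))"
    if l: "0 < l" for a :: "real^'n" and l
  proof -
    let ?B = "ball a (?d * l)"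
    have sub: "cube a l \<subseteq> ?B"
      using l by (intro cube_subset_ball vertex_mem_cube) auto
    have J: "(\<integral>\<^sup>+x\<in>cube a l. ennreal (norm (b x - ball_mean b ?B)) \<partial>lebesgue) \<le> ennreal (N * (?d * l) ^ CARD('n))"
    proof -
      have "(\<integral>\<^sup>+x\<in>cube a l. ennreal (norm (b x - ball_mean b ?B)) \<partial>lebesgue)
          \<le> (\<integral>\<^sup>+x\<in>?B. ennreal (norm (b x - ball_mean b ?B)) \<partial>lebesgue)"
        using sub by (intro nn_integral_mono) (auto simp: indicator_def)
      also have "\<dots> \<le> ennreal (N * (?d * l) ^ CARD('n))"
        using l by (intro N) auto
      finally show ?thesis .
    qed
    have "(\<integral>\<^sup>+x\<in>cube a l. ennreal (norm (b x - ball_mean b (cube a l))) \<partial>lebesgue)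
        \<le> (\<integral>\<^sup>+x. ennreal (norm (b x - ball_mean b ?B)) * indicator (cube a l) x
            + ennreal (norm (ball_mean b (cube a l) - ball_mean b ?B)) * indicator (cube a l) x \<partial>lebesgue)"
    proof (intro nn_integral_mono)
      fix x
      show "ennreal (norm (b x - ball_mean b (cube a l))) * indicator (cube a l) x \<le>
        ennreal (norm (b x - ball_mean b ?B)) * indicator (cube a l) x
            + ennreal (norm (ball_mean b (cube a l) - ball_mean b ?B)) * indicator (cube a l) x"
        using norm_triangle_ineq4[of "b x - ball_mean b ?B" "ball_mean b (cube a l) - ball_mean b ?B"]
        by (auto simp: indicator_def simp flip: ennreal_plus intro!: ennreal_leI)
    qed
    also have "\<dots> = (\<integral>\<^sup>+x\<in>cube a l. ennreal (norm (b x - ball_mean b ?B)) \<partial>lebesgue)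
       + ennreal (norm (ball_mean b (cube a l) - ball_mean b ?B) * l ^ CARD('n))"
      using l by (simp add: nn_integral_add nn_integral_cmult emeasure_cube ennreal_mult)
    also have "\<dots> \<le> ennreal (N * (?d * l) ^ CARD('n)) + ennreal (N * (?d * l) ^ CARD('n))"
      using J cube_mean_diff_le[OF b l, of a "ball_mean b ?B"] by (intro add_mono) auto
    also have "\<dots> = ennreal (N' * l ^ CARD('n))"
      using N(1) l by (simp add: N'_def power_mult_distrib flip: ennreal_plus)
    finally show ?thesis .
  qed
  ultimately show ?thesis by (rule that)
qed

context A1_weight
begin

text \<open>Cubes carry the dyadic argument, balls carry the rest. A ball is enclosed in the cube of
  side \<open>2 * r\<close> around it; doubling compares the measures, and the two Lebesgue means
  differ by at most a constant \<open>\<delta>\<close>, which changes the exponential integral by a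
  bounded factor.\<close>

lemma John_Nirenberg_ball:
  assumes b: "b \<in> BMO"
  shows "\<exists>c>0. \<exists>K>0. \<forall>y r. 0 < r \<longrightarrow>
    (\<integral>\<^sup>+x\<in>ball y r. ennreal (exp (c * norm (b x - ball_mean b (ball y r)))) \<partial>weighted v) \<le> ennreal (K * vol y r)"
proof -
  let ?d = "real CARD('n) + 1"
  note bl = BMO_locally_integrable[OF b]
  note [measurable] = locally_integrable_measurable[OF bl]
  obtain N where N: "0 < N" "\<And>(a :: real^'n) l. 0 < l \<Longrightarrow>
    (\<integral>\<^sup>+x\<in>cube a l. ennreal (norm (b x - ball_mean b (cube a l))) \<partial>lebesgue) \<le> ennreal (N * l ^ CARD('n))"
    by (rule BMO_cube_bound[OF b]) blast
  \<comment> \<open>A cube lies in the ball of radius \<open>(CARD('n) + 1) * l\<close> about each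
    of its points, so by the maximal bound subsets filling at most half of it miss at least the
    fraction \<open>1 / (2 * L)\<close> of its weighted measure.\<close>
  define L where "L = max 1 (C * ?d ^ CARD('n))"
  have L: "1 \<le> L" by (simp add: L_def)
  have finc: "emeasure (weighted v) (cube a l) < \<infinity>" for a l
    using bounded_cube[of a l] unfolding bounded_subset_cball
    by (meson emeasure_bounded_fin bounded_cube bounded_subset_ballD)
  interpret JN: dyadic_oscillation "weighted v" b N "1 / (2 * L)"
  proof
    show "absolutely_continuous lebesgue (weighted v)"
      unfolding weighted_def by (intro absolutely_continuousI_density) measurable
    fix F and a :: "real^'n" and l :: real
    assume l: "0 < l" and F: "F \<in> sets lebesgue" "F \<subseteq> cube a l" "measure lebesgue F \<le> l ^ CARD('n) / 2"
    show "measure (weighted v) F \<le> (1 - 1 / (2 * L)) * measure (weighted v) (cube a l)"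
    proof (rule half_measure_subset[OF sets_cube F(1,2)])
      show "cube a l \<subseteq> ball a (?d * l)"
        using l by (intro cube_subset_ball vertex_mem_cube) auto
      show "measure lebesgue F \<le> measure lebesgue (cube a l) / 2" "0 < measure lebesgue (cube a l)"
        using F l by (simp_all add: measure_cube)
      show "AE x in lebesgue. x \<in> cube a l \<longrightarrow> measure (weighted v) (cube a l) \<le> L * measure lebesgue (cube a l) * v x"
        using maximal_vol
      proof eventually_elim
        case (elim x)
        show ?case
        proof
          assume "x \<in> cube a l"
          then have "cube a l \<subseteq> ball x (?d * l)"
            using l by (intro cube_subset_ball) auto
          then have "measure (weighted v) (cube a l) \<le> vol x (?d * l)"
            by (rule measure_le_vol)
          also have "\<dots> \<le> C * (?d * l) ^ CARD('n) * v x"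
            using elim l by (metis add_nonneg_pos mult_pos_pos of_nat_0_le_iff zero_less_one)
          also have "\<dots> = (C * ?d ^ CARD('n)) * l ^ CARD('n) * v x"
            by (simp add: power_mult_distrib)
          also have "\<dots> \<le> L * l ^ CARD('n) * v x"
            using l by (intro mult_right_mono) (auto simp: L_def)
          finally show "measure (weighted v) (cube a l) \<le> L * measure lebesgue (cube a l) * v x"
            using l by (simp add: measure_cube)
        qed
      qed
    qed (use L in auto)
  qed (use N L bl finc in \<open>auto simp: field_simps\<close>)
  obtain k where k: "2 * ?d < 2 ^ k"
    using real_arch_pow[of 2 "2 * ?d"] by auto
  let ?\<kappa> = "unit_ball_vol (real CARD('n))"
  have \<kappa>: "0 < ?\<kappa>" by simp
  define \<delta> where "\<delta> = N * 2 ^ CARD('n) / ?\<kappa>"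
  define K where "K = exp (JN.rate * \<delta>) * (4 * (2 * L)) * D ^ k"
  have "(\<integral>\<^sup>+x\<in>ball y r. ennreal (exp (JN.rate * norm (b x - ball_mean b (ball y r)))) \<partial>weighted v) \<le> ennreal (K * vol y r)"
    if r: "0 < r" for y r
  proof -
    define a where "a = y - r *\<^sub>R (1 :: real^'n)"
    let ?Q = "cube a (2 * r)" and ?B = "ball y r"
    have BQ: "?B \<subseteq> ?Q"
    proof
      fix x assume "x \<in> ?B"
      then have "\<bar>(x - y) $ i\<bar> < r" for i
        using component_le_norm_cart[of "x - y" i] by (simp add: dist_norm norm_minus_commute)
      then have "- r < x $ i - y $ i \<and> x $ i - y $ i < r" for i
        by (simp add: abs_less_iff) (metis minus_less_iff minus_diff_eq)
      then have "y $ i - r \<le> x $ i \<and> x $ i < y $ i - r + 2 * r" for i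
        by (smt (verit))
      then show "x \<in> ?Q"
        by (simp add: cube_def a_def)
    qed
    have "y \<in> ?Q" using BQ r by auto
    then have "?Q \<subseteq> ball y (2 ^ k * r)"
      using r k by (intro cube_subset_ball) (auto simp: algebra_simps)
    then have vQ: "measure (weighted v) ?Q \<le> D ^ k * vol y r"
      using measure_le_vol doubling_iterate[OF r] by (meson order_trans)
    have "ennreal (norm (ball_mean b ?B - ball_mean b ?Q) * measure lebesgue ?B)
        \<le> (\<integral>\<^sup>+x\<in>?B. ennreal (norm (b x - ball_mean b ?Q)) \<partial>lebesgue)"
      using bl measure_ball_pos[OF r, of y]
      by (intro norm_ball_mean_diff_le set_integrable_locally_integrable) (auto simp: emeasure_ball_real)
    also have "\<dots> \<le> (\<integral>\<^sup>+x\<in>?Q. ennreal (norm (b x - ball_mean b ?Q)) \<partial>lebesgue)"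
      using BQ by (intro nn_integral_mono) (auto simp: indicator_def)
    also have "\<dots> \<le> ennreal (N * (2 * r) ^ CARD('n))"
      using r by (intro N) auto
    finally have "norm (ball_mean b ?B - ball_mean b ?Q) * (r ^ CARD('n) * ?\<kappa>) \<le> N * (2 * r) ^ CARD('n)"
      using r N(1) by (subst (asm) ennreal_le_iff) (auto simp: measure_ball_scale)
    then have "(norm (ball_mean b ?B - ball_mean b ?Q) * ?\<kappa>) * r ^ CARD('n) \<le> (N * 2 ^ CARD('n)) * r ^ CARD('n)"
      by (simp add: power_mult_distrib mult_ac)
    then have "norm (ball_mean b ?B - ball_mean b ?Q) * ?\<kappa> \<le> N * 2 ^ CARD('n)"
      using r by simp
    then have mean: "norm (ball_mean b ?Q - ball_mean b ?B) \<le> \<delta>"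
      using \<kappa> by (simp add: \<delta>_def pos_le_divide_eq norm_minus_commute)
    have "(\<integral>\<^sup>+x\<in>?B. ennreal (exp (JN.rate * norm (b x - ball_mean b ?B))) \<partial>weighted v)
        \<le> ennreal (exp (JN.rate * norm (ball_mean b ?Q - ball_mean b ?B))) *
          (\<integral>\<^sup>+x\<in>?B. ennreal (exp (JN.rate * norm (b x - ball_mean b ?Q))) \<partial>weighted v)"
      using JN.rate_pos by (intro nn_integral_exp_shift) auto
    also have "\<dots> \<le> ennreal (exp (JN.rate * \<delta>)) *
          (\<integral>\<^sup>+x\<in>?Q. ennreal (exp (JN.rate * norm (b x - ball_mean b ?Q))) \<partial>weighted v)"
      using JN.rate_pos mean BQ by (intro mult_mono nn_integral_mono) (auto simp: indicator_def intro!: ennreal_leI)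
    also have "\<dots> \<le> ennreal (exp (JN.rate * \<delta>)) * (ennreal (4 / (1 / (2 * L))) * emeasure (weighted v) ?Q)"
      using r by (intro mult_left_mono JN.exponential_integrability) auto
    also have "\<dots> = ennreal (exp (JN.rate * \<delta>) * (4 * (2 * L)) * measure (weighted v) ?Q)"
      using L unfolding emeasure_eq_measure_fin[OF finc] by (simp add: mult.assoc flip: ennreal_mult)
    also have "\<dots> \<le> ennreal (exp (JN.rate * \<delta>) * (4 * (2 * L)) * (D ^ k * vol y r))"
      using vQ L by (intro ennreal_leI mult_left_mono) auto
    finally show ?thesis by (simp add: K_def mult.assoc)
  qed
  moreover have "0 < K"
    using L D_ge_1 by (simp add: K_def)
  ultimately show ?thesis
    using JN.rate_pos by blast
qed

end

section \<open>Deviation from a mean, integrated over small sets\<close>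

locale A1_BMO = A1_weight C v for C :: real and v :: "real^'n \<Rightarrow> real" +
  fixes b :: "real^'n \<Rightarrow> complex" and c K :: real
  assumes b_measurable [measurable]: "b \<in> borel_measurable lebesgue"
    and c_pos: "0 < c" and K_pos: "0 < K"
    and John_Nirenberg: "0 < r \<Longrightarrow>
      (\<integral>\<^sup>+x\<in>ball y r. ennreal (exp (c * norm (b x - ball_mean b (ball y r)))) \<partial>weighted v) \<le> ennreal (K * vol y r)"
begin

text \<open>Always the Lebesgue mean of \<open>b\<close>, so that instances for different weights
  share this function. The summand 1 lets \<open>norm (b x - b y)\<close> be bounded by a product of
  deviations instead of a sum.\<close>

definition deviation :: "real^'n \<Rightarrow> real \<Rightarrow> real^'n \<Rightarrow> real" where
  "deviation y r x = 1 + norm (b x - ball_mean b (ball y r))"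

lemma deviation_measurable [measurable]: "deviation y r \<in> borel_measurable lebesgue"
  unfolding deviation_def by measurable

lemma deviation_ge_1: "1 \<le> deviation y r x"
  by (simp add: deviation_def)

lemma deviation_nonneg [simp]: "0 \<le> deviation y r x"
  using deviation_ge_1[of y r x] by linarith

text \<open>The summands pay for the constant 1 in the deviation, for the exponential integral with
  its constant \<open>K\<close>, and for \<open>ln x \<le> x powr p / p\<close>.\<close>

definition dev_const :: "real \<Rightarrow> real" where
  "dev_const p = 1 + K / c + 1 / (p * c)"

lemma dev_const_ge_1: "0 < p \<Longrightarrow> 1 \<le> dev_const p"
  using c_pos K_pos by (simp add: dev_const_def)

text \<open>Since \<open>c * t \<le> L + exp (c * t - L)\<close>, exponential integrability turns into a gain of
  \<open>ln (vol y r / f)\<close> on a subset of measure \<open>f\<close>, and any positive power absorbs the logarithm.\<close>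

lemma deviation_integral:
  assumes r: "0 < r" and F [measurable]: "F \<in> sets lebesgue" and sub: "F \<subseteq> ball y r" and p: "0 < p" "p < 1"
    and f: "measure (weighted v) F \<le> f"
  shows "(\<integral>\<^sup>+x\<in>F. ennreal (deviation y r x) \<partial>weighted v)
    \<le> ennreal (dev_const p * f powr (1 - p) * vol y r powr p)"
proof -
  define g where "g = measure (weighted v) F"
  have eF: "emeasure (weighted v) F = ennreal g"
    unfolding g_def by (rule emeasure_eq_measure_fin) (rule emeasure_bounded_fin[OF sub])
  show ?thesis
  proof (cases "g = 0")
    case True
    then have "AE x in weighted v. x \<notin> F"
      using eF by (intro AE_not_in) (simp add: null_sets_def)
    then have "(\<integral>\<^sup>+x\<in>F. ennreal (deviation y r x) \<partial>weighted v) = (\<integral>\<^sup>+x. 0 \<partial>weighted v)"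
      by (intro nn_integral_cong_AE) (auto elim!: eventually_mono)
    then show ?thesis by simp
  next
    case False
    then have g: "0 < g"
      using g_def by (simp add: less_le)
    define V where "V = vol y r"
    have gV: "g \<le> V"
      using measure_le_vol[OF sub] by (simp add: g_def V_def)
    with g have V: "0 < V" by linarith
    \<comment> \<open>Makes \<open>exp (- L)\<close> equal to \<open>g / V\<close>, which scales the
      exponential integral over the whole ball, of size at most \<open>K * V\<close>, down to the
      measure \<open>g\<close> of \<open>F\<close>.\<close>
    define L where "L = ln (V / g)"
    have eL: "exp (- L) = g / V"
      using g V by (simp add: L_def exp_minus)
    have "(\<integral>\<^sup>+x\<in>F. ennreal (deviation y r x) \<partial>weighted v)
        \<le> (\<integral>\<^sup>+x. ennreal (1 + L / c) * indicator F x
            + ennreal (g / V / c) * (ennreal (exp (c * norm (b x - ball_mean b (ball y r)))) * indicator (ball y r) x) \<partial>weighted v)"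
    proof (intro nn_integral_mono)
      fix x
      let ?t = "norm (b x - ball_mean b (ball y r))"
      have L0: "0 \<le> L" using g gV by (simp add: L_def)
      have "c * ?t - L \<le> exp (c * ?t - L)"
        using exp_ge_add_one_self[of "c * ?t - L"] by linarith
      moreover have "exp (c * ?t - L) = g / V * exp (c * ?t)"
        unfolding eL[symmetric] by (simp flip: exp_add)
      ultimately have "c * ?t \<le> L + g / V * exp (c * ?t)"
        by linarith
      then have "?t \<le> (L + g / V * exp (c * ?t)) / c"
        using c_pos by (simp add: pos_le_divide_eq mult.commute)
      then have "deviation y r x \<le> 1 + L / c + g / V / c * exp (c * ?t)"
        by (simp add: deviation_def add_divide_distrib)
      then show "ennreal (deviation y r x) * indicator F x \<le> ennreal (1 + L / c) * indicator F x
            + ennreal (g / V / c) * (ennreal (exp (c * ?t)) * indicator (ball y r) x)"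
        using g V c_pos sub L0
        by (auto simp: indicator_def simp flip: ennreal_mult ennreal_plus intro!: ennreal_leI)
    qed
    also have "\<dots> = ennreal (1 + L / c) * ennreal g + ennreal (g / V / c) *
        (\<integral>\<^sup>+x\<in>ball y r. ennreal (exp (c * norm (b x - ball_mean b (ball y r)))) \<partial>weighted v)"
      by (subst nn_integral_add) (auto simp: nn_integral_cmult eF)
    also have "\<dots> \<le> ennreal (1 + L / c) * ennreal g + ennreal (g / V / c) * ennreal (K * V)"
      unfolding V_def by (intro add_left_mono mult_left_mono John_Nirenberg r) auto
    also have "\<dots> = ennreal ((1 + L / c) * g + g / V / c * (K * V))"
      using g gV V c_pos K_pos by (simp add: L_def flip: ennreal_mult ennreal_plus)
    also have "\<dots> \<le> ennreal (dev_const p * f powr (1 - p) * vol y r powr p)"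
    proof (rule ennreal_leI)
      have q1: "1 \<le> (V / g) powr p"
        using g gV p by (intro ge_one_powr_ge_zero) auto
      have "L \<le> (V / g) powr p / p"
        unfolding L_def using g gV p by (intro ln_powr_bound) auto
      then have "L / c \<le> (V / g) powr p / p / c"
        using c_pos by (intro divide_right_mono) auto
      moreover have "K / c * 1 \<le> K / c * (V / g) powr p"
        using q1 K_pos c_pos by (intro mult_left_mono) auto
      ultimately have "1 + L / c + K / c \<le> dev_const p * (V / g) powr p"
        using q1 by (simp add: dev_const_def algebra_simps)
      then have "(1 + L / c + K / c) * g \<le> (dev_const p * (V / g) powr p) * g"
        using g by (intro mult_right_mono) auto
      also have "\<dots> = dev_const p * g powr (1 - p) * V powr p"
        using g V by (simp add: powr_divide powr_diff)
      also have "\<dots> \<le> dev_const p * f powr (1 - p) * V powr p"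
        using g f p dev_const_ge_1[OF p(1)] unfolding g_def
        by (intro mult_right_mono mult_left_mono powr_mono2) auto
      finally show "(1 + L / c) * g + g / V / c * (K * V) \<le> dev_const p * f powr (1 - p) * vol y r powr p"
        using V by (simp add: V_def[symmetric] algebra_simps)
    qed
    finally show ?thesis .
  qed
qed

text \<open>The difference of the means is at most the sum of the two deviations at every point, so
  it suffices to average over the smaller ball against the weighted measure. This replaces a chain
  of intermediate balls; the usual logarithm of the ratio appears as a power.\<close>

lemma mean_difference:
  assumes \<rho>: "0 < \<rho>" and r: "0 < r" and sub: "ball z \<rho> \<subseteq> ball y r" and p: "0 < p" "p < 1"
  shows "norm (ball_mean b (ball z \<rho>) - ball_mean b (ball y r)) \<le> 2 * dev_const p * (vol y r / vol z \<rho>) powr p"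
proof -
  let ?d = "norm (ball_mean b (ball z \<rho>) - ball_mean b (ball y r))"
  have V: "0 < vol z \<rho>" "vol z \<rho> \<le> vol y r"
    using vol_pos[OF \<rho>] vol_mono[OF sub] by auto
  have "ennreal (?d * vol z \<rho>) = (\<integral>\<^sup>+x\<in>ball z \<rho>. ennreal ?d \<partial>weighted v)"
    by (simp add: nn_integral_cmult emeasure_ball_vol ennreal_mult)
  also have "\<dots> \<le> (\<integral>\<^sup>+x. ennreal (deviation z \<rho> x) * indicator (ball z \<rho>) x
      + ennreal (deviation y r x) * indicator (ball z \<rho>) x \<partial>weighted v)"
  proof (intro nn_integral_mono)
    fix x
    have "?d \<le> deviation z \<rho> x + deviation y r x"
      using norm_triangle_ineq4[of "b x - ball_mean b (ball y r)" "b x - ball_mean b (ball z \<rho>)"]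
      by (simp add: deviation_def)
    then show "ennreal ?d * indicator (ball z \<rho>) x \<le> ennreal (deviation z \<rho> x) * indicator (ball z \<rho>) x
      + ennreal (deviation y r x) * indicator (ball z \<rho>) x"
      by (auto simp: indicator_def simp flip: ennreal_plus intro!: ennreal_leI)
  qed
  also have "\<dots> = (\<integral>\<^sup>+x\<in>ball z \<rho>. ennreal (deviation z \<rho> x) \<partial>weighted v)
      + (\<integral>\<^sup>+x\<in>ball z \<rho>. ennreal (deviation y r x) \<partial>weighted v)"
    by (intro nn_integral_add) measurable
  also have "\<dots> \<le> ennreal (dev_const p * vol z \<rho> powr (1 - p) * vol z \<rho> powr p)
      + ennreal (dev_const p * vol z \<rho> powr (1 - p) * vol y r powr p)"
    using assms by (intro add_mono deviation_integral) (auto simp: vol_def)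
  also have "\<dots> = ennreal (dev_const p * vol z \<rho> powr (1 - p) * vol z \<rho> powr p
      + dev_const p * vol z \<rho> powr (1 - p) * vol y r powr p)"
    using dev_const_ge_1[OF p(1)] by (intro ennreal_plus[symmetric]) auto
  finally have "?d * vol z \<rho> \<le> dev_const p * vol z \<rho> powr (1 - p) * vol z \<rho> powr p
      + dev_const p * vol z \<rho> powr (1 - p) * vol y r powr p"
    using dev_const_ge_1[OF p(1)] by (subst (asm) ennreal_le_iff) auto
  also have "\<dots> \<le> dev_const p * vol z \<rho> powr (1 - p) * vol y r powr p
      + dev_const p * vol z \<rho> powr (1 - p) * vol y r powr p"
    using dev_const_ge_1[OF p(1)] V p by (intro add_right_mono mult_left_mono powr_mono2) auto
  also have "\<dots> = (2 * dev_const p * (vol y r / vol z \<rho>) powr p) * vol z \<rho>"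
    using V by (simp add: powr_divide powr_diff)
  finally show ?thesis
    using V by simp
qed

text \<open>The mean is taken over a smaller ball than the one containing \<open>F\<close>.
  Exchanging the means costs \<open>(vol y r / vol y \<rho>) powr p\<close>, and
  \<open>f \<le> vol y \<rho>\<close> lets this be absorbed by the factor
  \<open>(vol y r / f) powr p\<close> already present.\<close>

lemma deviation_integral_shift:
  assumes \<rho>: "0 < \<rho>" "\<rho> \<le> r" and F [measurable]: "F \<in> sets lebesgue" and sub: "F \<subseteq> ball y r" and p: "0 < p" "p < 1"
    and f: "measure (weighted v) F \<le> f" "f \<le> vol y \<rho>"
  shows "(\<integral>\<^sup>+x\<in>F. ennreal (deviation y \<rho> x) \<partial>weighted v)
    \<le> ennreal (3 * dev_const p * f powr (1 - p) * vol y r powr p)"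
proof -
  have r: "0 < r" using \<rho> by linarith
  let ?d = "norm (ball_mean b (ball y \<rho>) - ball_mean b (ball y r))"
  have V: "0 < vol y \<rho>" using \<rho> by (intro vol_pos)
  have f0: "0 \<le> f" using f(1) measure_nonneg[of "weighted v" F] by linarith
  have A: "1 \<le> dev_const p" using p by (intro dev_const_ge_1)
  have eF: "emeasure (weighted v) F = ennreal (measure (weighted v) F)"
    by (rule emeasure_eq_measure_fin) (rule emeasure_bounded_fin[OF sub])
  have "(\<integral>\<^sup>+x\<in>F. ennreal (deviation y \<rho> x) \<partial>weighted v)
      \<le> (\<integral>\<^sup>+x. ennreal (deviation y r x) * indicator F x + ennreal ?d * indicator F x \<partial>weighted v)"
  proof (intro nn_integral_mono)
    fix x
    have "deviation y \<rho> x \<le> deviation y r x + ?d"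
      using norm_triangle_ineq4[of "b x - ball_mean b (ball y r)" "ball_mean b (ball y \<rho>) - ball_mean b (ball y r)"]
      by (simp add: deviation_def)
    then show "ennreal (deviation y \<rho> x) * indicator F x
        \<le> ennreal (deviation y r x) * indicator F x + ennreal ?d * indicator F x"
      by (auto simp: indicator_def simp flip: ennreal_plus intro!: ennreal_leI)
  qed
  also have "\<dots> = (\<integral>\<^sup>+x\<in>F. ennreal (deviation y r x) \<partial>weighted v) + ennreal ?d * emeasure (weighted v) F"
    by (subst nn_integral_add) (auto simp: nn_integral_cmult)
  also have "\<dots> \<le> ennreal (dev_const p * f powr (1 - p) * vol y r powr p)
      + ennreal (2 * dev_const p * (vol y r / vol y \<rho>) powr p) * ennreal f"
    unfolding eF using assms r
    by (intro add_mono mult_mono ennreal_leI deviation_integral mean_difference) (auto intro!: ball_subset_ballI)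
  also have "\<dots> = ennreal (dev_const p * f powr (1 - p) * vol y r powr p
      + 2 * dev_const p * (vol y r / vol y \<rho>) powr p * f)"
    using A f0 by (simp flip: ennreal_mult ennreal_plus)
  also have "\<dots> \<le> ennreal (3 * dev_const p * f powr (1 - p) * vol y r powr p)"
  proof (rule ennreal_leI)
    have "(vol y r / vol y \<rho>) powr p * f \<le> f powr (1 - p) * vol y r powr p"
    proof (cases "f = 0")
      case False
      with f0 have fp: "0 < f" by simp
      have "(vol y r / vol y \<rho>) powr p \<le> (vol y r / f) powr p"
        using fp f(2) p by (intro powr_mono2 divide_left_mono) auto
      then have "(vol y r / vol y \<rho>) powr p * f \<le> (vol y r / f) powr p * f"
        using fp by (intro mult_right_mono) auto
      also have "\<dots> = f powr (1 - p) * vol y r powr p"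
        using fp by (simp add: powr_divide powr_diff)
      finally show ?thesis .
    qed simp
    then have "2 * dev_const p * ((vol y r / vol y \<rho>) powr p * f) \<le> 2 * dev_const p * (f powr (1 - p) * vol y r powr p)"
      using A by (intro mult_left_mono) auto
    then show "dev_const p * f powr (1 - p) * vol y r powr p + 2 * dev_const p * (vol y r / vol y \<rho>) powr p * f
        \<le> 3 * dev_const p * f powr (1 - p) * vol y r powr p"
      by (simp add: algebra_simps)
  qed
  finally show ?thesis .
qed

end

section \<open>The commutator near its support\<close>

lemma ennreal_le_suminf: "f i \<le> (\<Sum>i. f i :: ennreal)"
  using sum_le_suminf[OF summableI, of "{i}" f] by simp

lemma suminf_ennreal_geometric:
  assumes "0 \<le> x" "0 \<le> t" "t < 1"
  shows "(\<Sum>i. ennreal (x * t ^ i)) = ennreal (x / (1 - t))"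
proof (rule suminf_ennreal_eq)
  show "(\<lambda>i. x * t ^ i) sums (x / (1 - t))"
    using sums_mult[OF geometric_sums, of t x] assms by simp
qed (use assms in auto)

lemma exists_dyadic_scale_below:
  fixes R d :: real
  assumes "0 < d" "d < R"
  obtains i :: nat where "R / 2 ^ Suc i \<le> d" "d < R / 2 ^ i"
proof -
  obtain m :: nat where "R / d < 2 ^ m"
    using real_arch_pow[of 2 "R / d"] by auto
  then have ex: "R / 2 ^ m \<le> d"
    using assms by (simp add: field_simps)
  define i where "i = (LEAST i. R / 2 ^ i \<le> d)"
  have 1: "R / 2 ^ i \<le> d"
    unfolding i_def using ex by (rule LeastI)
  then obtain j where j: "i = Suc j"
    using assms by (cases i) auto
  have "\<not> R / 2 ^ j \<le> d"
    using not_less_Least[of j "\<lambda>i. R / 2 ^ i \<le> d"] j unfolding i_def by simp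
  with 1 j show ?thesis by (intro that[of j]) auto
qed

lemma exists_dyadic_scale_above:
  fixes R d :: real
  assumes "0 < R" "R \<le> d"
  obtains i :: nat where "2 ^ i * R \<le> d" "d < 2 ^ Suc i * R"
proof -
  obtain m :: nat where "d / R < 2 ^ m"
    using real_arch_pow[of 2 "d / R"] by auto
  then have ex: "d < 2 ^ m * R"
    using assms by (simp add: field_simps)
  define i where "i = (LEAST i. d < 2 ^ i * R)"
  have 1: "d < 2 ^ i * R"
    unfolding i_def using ex by (rule LeastI)
  then obtain j where j: "i = Suc j"
    using assms by (cases i) auto
  have "\<not> d < 2 ^ j * R"
    using not_less_Least[of j "\<lambda>i. d < 2 ^ i * R"] j unfolding i_def by simp
  with 1 j show ?thesis by (intro that[of j]) auto
qed

text \<open>The complementary pair of L log L and exp L. It is \<open>1 + x \<le> exp x\<close> at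
  \<open>x = t - ln s\<close>, multiplied by \<open>s\<close>.\<close>

lemma Young_exp_Phi:
  assumes "0 \<le> s"
  shows "s * t \<le> Phi s + exp t"
proof (cases "s = 0")
  case False
  then have s: "0 < s" using assms by simp
  have "1 + (t - ln s) \<le> exp (t - ln s)"
    by (rule exp_ge_add_one_self)
  then have "s * (1 + (t - ln s)) \<le> s * exp (t - ln s)"
    using s by (intro mult_left_mono) auto
  also have "\<dots> = exp t"
    using s by (simp add: exp_diff)
  finally have "s * t \<le> s * ln s - s + exp t"
    by (simp add: algebra_simps)
  also have "s * ln s \<le> s * (1 + max (ln s) 0)"
    using s by (intro mult_left_mono) auto
  finally show ?thesis
    using s by (simp add: Phi_def)
qed (simp add: Phi_def)

text \<open>The normalizing constant is left out. On the diagonal \<open>0 powr p = 0\<close> and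
  \<open>1 / 0 = 0\<close> give the value 0, so upper bounds hold there trivially.\<close>

definition riesz_kernel :: "real \<Rightarrow> real^'n \<Rightarrow> real^'n \<Rightarrow> real" where
  "riesz_kernel \<gamma> x y = 1 / norm (x - y) powr (real CARD('n) - \<gamma>)"

lemma riesz_kernel_nonneg [simp]: "0 \<le> riesz_kernel \<gamma> x y"
  by (simp add: riesz_kernel_def)

lemma measurable_riesz_kernel [measurable]:
  "(\<lambda>z. riesz_kernel \<gamma> (fst z) (snd z)) \<in> borel_measurable (lebesgue \<Otimes>\<^sub>M (lebesgue :: (real^'n) measure))"
  unfolding riesz_kernel_def by measurable

lemma measurable_riesz_kernel_fst [measurable]:
  "(\<lambda>x. riesz_kernel \<gamma> x y) \<in> borel_measurable lebesgue"
  unfolding riesz_kernel_def by measurable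

lemma riesz_kernel_le:
  fixes x y :: "real^'n"
  assumes "0 < r" "r \<le> norm (x - y)" "\<gamma> < real CARD('n)"
  shows "riesz_kernel \<gamma> x y \<le> r powr - (real CARD('n) - \<gamma>)"
proof -
  have "norm (x - y) powr - (real CARD('n) - \<gamma>) \<le> r powr - (real CARD('n) - \<gamma>)"
    using assms by (intro powr_mono2') auto
  then show ?thesis
    unfolding riesz_kernel_def by (simp only: powr_minus_divide)
qed

text \<open>Off the diagonal the term whose shell contains \<open>x\<close> already bounds the
  kernel. Full balls replace the shells since only an upper bound is wanted, and \<open>R\<close>
  separates the scales treated by \<open>inner_shell\<close> from those treated by
  \<open>outer_shell\<close>.\<close>

lemma riesz_kernel_shells:
  fixes x y :: "real^'n"
  assumes R: "0 < R" and \<gamma>: "\<gamma> < real CARD('n)"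
  shows "ennreal (riesz_kernel \<gamma> x y) \<le>
    (\<Sum>i. ennreal ((R / 2 ^ Suc i) powr - (real CARD('n) - \<gamma>)) * indicator (ball y (R / 2 ^ i)) x) +
    (\<Sum>i. ennreal ((2 ^ i * R) powr - (real CARD('n) - \<gamma>)) * indicator (ball y (2 ^ Suc i * R)) x)"
    (is "_ \<le> suminf ?f + suminf ?g")
proof -
  consider "x = y" | "x \<noteq> y" "norm (x - y) < R" | "R \<le> norm (x - y)" by linarith
  then show ?thesis
  proof cases
    case 1
    then show ?thesis by (simp add: riesz_kernel_def)
  next
    case 2
    then obtain i where i: "R / 2 ^ Suc i \<le> norm (x - y)" "norm (x - y) < R / 2 ^ i"
      using exists_dyadic_scale_below[of "norm (x - y)" R] by auto
    have "ennreal (riesz_kernel \<gamma> x y) \<le> ?f i"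
      using i R riesz_kernel_le[OF _ i(1) \<gamma>] by (auto simp: dist_norm norm_minus_commute intro!: ennreal_leI)
    also have "\<dots> \<le> suminf ?f"
      by (rule ennreal_le_suminf)
    also have "\<dots> \<le> suminf ?f + suminf ?g"
      by simp
    finally show ?thesis .
  next
    case 3
    then obtain i where i: "2 ^ i * R \<le> norm (x - y)" "norm (x - y) < 2 ^ Suc i * R"
      using exists_dyadic_scale_above[of R "norm (x - y)"] R by auto
    have "ennreal (riesz_kernel \<gamma> x y) \<le> ?g i"
      using i R riesz_kernel_le[OF _ i(1) \<gamma>] by (auto simp: dist_norm norm_minus_commute intro!: ennreal_leI)
    also have "\<dots> \<le> suminf ?g"
      by (rule ennreal_le_suminf)
    also have "\<dots> \<le> suminf ?f + suminf ?g"
      by simp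
    finally show ?thesis .
  qed
qed

section \<open>The dual potential of a set\<close>

locale commutator_setting =
  om: A1_BMO Co "\<lambda>x. w x powr q" b co Ko + W: A1_BMO Cw w b cw Kw
  for w :: "real^'n \<Rightarrow> real" and b :: "real^'n \<Rightarrow> complex" and q Co co Ko Cw cw Kw :: real +
  fixes \<gamma> :: real
  assumes gamma: "0 < \<gamma>" "\<gamma> < real CARD('n)"
    and q_def: "q = real CARD('n) / (real CARD('n) - \<gamma>)"
begin

abbreviation \<omega> :: "(real^'n) measure" where
  "\<omega> \<equiv> weighted (\<lambda>x. w x powr q)"

definition \<kappa> :: real where "\<kappa> = 1 / q"

lemma kappa: "0 < \<kappa>" "\<kappa> < 1" "real CARD('n) * \<kappa> = real CARD('n) - \<gamma>" "q * \<kappa> = 1"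
proof -
  have k: "\<kappa> = (real CARD('n) - \<gamma>) / real CARD('n)"
    unfolding \<kappa>_def by (subst q_def) simp
  show "0 < \<kappa>" "\<kappa> < 1" "real CARD('n) * \<kappa> = real CARD('n) - \<gamma>"
    using gamma unfolding k by simp_all
  then show "q * \<kappa> = 1"
    unfolding \<kappa>_def by auto
qed

text \<open>The power \<open>\<kappa>\<close> of the maximal bound for \<open>w powr q\<close>: the
  radius gets the exponent \<open>CARD('n) * \<kappa> = CARD('n) - \<gamma>\<close> of the kernel,
  and the weight becomes \<open>w\<close> itself.\<close>

lemma kernel_size:
  "AE y in lebesgue. \<forall>r>0. r powr - (real CARD('n) - \<gamma>) \<le> Co powr \<kappa> * w y * om.vol y r powr - \<kappa>"
  using om.maximal_vol
proof eventually_elim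
  case (elim y)
  show ?case
  proof (intro allI impI)
    fix r :: real assume r: "0 < r"
    have V: "0 < om.vol y r" using r by (rule om.vol_pos)
    have "om.vol y r powr \<kappa> \<le> (Co * r ^ CARD('n) * w y powr q) powr \<kappa>"
      using elim r kappa V by (intro powr_mono2) auto
    also have "\<dots> = Co powr \<kappa> * (r powr real CARD('n)) powr \<kappa> * (w y powr q) powr \<kappa>"
      using r om.C_pos by (simp add: powr_mult powr_realpow)
    also have "\<dots> = Co powr \<kappa> * r powr (real CARD('n) - \<gamma>) * w y"
      by (simp add: powr_powr kappa)
    finally have "om.vol y r powr \<kappa> * om.vol y r powr - \<kappa> \<le> Co powr \<kappa> * r powr (real CARD('n) - \<gamma>) * w y * om.vol y r powr - \<kappa>"
      by (intro mult_right_mono) auto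
    then have "1 * r powr - (real CARD('n) - \<gamma>) \<le> (Co powr \<kappa> * r powr (real CARD('n) - \<gamma>) * w y * om.vol y r powr - \<kappa>) * r powr - (real CARD('n) - \<gamma>)"
      using V by (intro mult_right_mono) (auto simp flip: powr_add)
    also have "\<dots> = (r powr (real CARD('n) - \<gamma>) * r powr - (real CARD('n) - \<gamma>)) * (Co powr \<kappa> * w y * om.vol y r powr - \<kappa>)"
      by (simp only: mult_ac)
    also have "r powr (real CARD('n) - \<gamma>) * r powr - (real CARD('n) - \<gamma>) = 1"
      using r by (simp flip: powr_add)
    finally show "r powr - (real CARD('n) - \<gamma>) \<le> Co powr \<kappa> * w y * om.vol y r powr - \<kappa>"
      by simp
  qed
qed

text \<open>The powers of \<open>om.D\<close> count doublings. Inside,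
  \<open>om.D powr \<kappa>\<close> compares a ball with the one of half its radius, and
  \<open>om.D ^ 5\<close> is one doubling on top of the assumed \<open>om.D ^ 4\<close>. Outside,
  three doublings move the center from \<open>z\<close> to \<open>y\<close> and one more enters the
  lower bound for the measure of the shell.\<close>

definition inner_const :: real where
  "inner_const = Co powr \<kappa> * om.D powr \<kappa> * om.dev_const ((1 - \<kappa>) / 2) * (om.D ^ 5) powr (1 - \<kappa>)"

definition outer_const :: real where
  "outer_const = Co powr \<kappa> * (3 * om.dev_const (\<kappa> / 2)) * (om.D ^ 4) powr (\<kappa> / 2)"

definition kernel_const :: real where
  "kernel_const = inner_const / (1 - om.\<theta> powr ((1 - \<kappa>) / 2)) + outer_const / (1 - om.\<theta> powr (\<kappa> / 2))"

text \<open>With \<open>f\<close> the measure of the \<open>i\<close>-th ball about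
  \<open>y\<close>, the kernel gives \<open>f powr - \<kappa>\<close> and the deviation
  \<open>f powr (1 - p) * V powr p\<close>. For \<open>p = (1 - \<kappa>) / 2\<close> the product is
  \<open>f powr p * V powr p\<close>, and \<open>f \<le> \<theta> ^ i * V\<close> leaves
  \<open>V powr (1 - \<kappa>)\<close> times a decaying factor; \<open>Ve\<close> and doubling bound
  \<open>V\<close> by a multiple of \<open>e\<close>.\<close>

lemma inner_shell:
  assumes y: "\<forall>r>0. r powr - (real CARD('n) - \<gamma>) \<le> Co powr \<kappa> * w y * om.vol y r powr - \<kappa>"
    and R: "0 < R" and yz: "y \<in> ball z R" and E [measurable]: "E \<in> sets lebesgue"
    and e: "0 < e" and Ve: "om.vol z R \<le> om.D ^ 4 * e"
  shows "ennreal ((R / 2 ^ Suc i) powr - (real CARD('n) - \<gamma>)) *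
      (\<integral>\<^sup>+x\<in>E \<inter> ball y (R / 2 ^ i). ennreal (om.deviation z (2 * R) x) \<partial>\<omega>)
    \<le> ennreal (inner_const * w y * e powr (1 - \<kappa>) * (om.\<theta> powr ((1 - \<kappa>) / 2)) ^ i)"
proof -
  define p where "p = (1 - \<kappa>) / 2"
  have p: "0 < p" "p < 1" "1 - p = \<kappa> + p" "2 * p = 1 - \<kappa>"
    using kappa by (auto simp: p_def field_simps)
  define f where "f = om.vol y (R / 2 ^ i)"
  define V where "V = om.vol z (2 * R)"
  have f: "0 < f" and V: "0 < V"
    using R by (auto simp: f_def V_def intro: om.vol_pos)
  have D: "1 \<le> om.D" by (rule om.D_ge_1)
  have A: "1 \<le> om.dev_const p" using p by (intro om.dev_const_ge_1)
  have RR: "R / 2 ^ i \<le> R"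
    using R by (simp add: divide_le_eq mult_le_cancel_left1)
  have dyz: "dist z y < R" using yz by simp
  have yR: "om.vol y R \<le> V"
    unfolding V_def using dyz by (intro om.vol_mono ball_subset_ballI) linarith
  have "f \<le> om.\<theta> ^ i * om.vol y R"
    using om.reverse_doubling_iterate[of "R / 2 ^ i" y i] R by (simp add: f_def)
  also have "\<dots> \<le> om.\<theta> ^ i * V"
    using yR om.\<theta>_bounds by (intro mult_left_mono) auto
  finally have fV: "f \<le> om.\<theta> ^ i * V" .
  have "f \<le> om.D * om.vol y (R / 2 ^ Suc i)"
    using om.doubling[of "R / 2 ^ Suc i" y] R by (simp add: f_def)
  then have "f / om.D \<le> om.vol y (R / 2 ^ Suc i)"
    using D by (simp add: field_simps)
  then have "om.vol y (R / 2 ^ Suc i) powr - \<kappa> \<le> (f / om.D) powr - \<kappa>"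
    using f D kappa by (intro powr_mono2') auto
  also have "\<dots> = om.D powr \<kappa> * f powr - \<kappa>"
    using f D by (simp add: powr_divide powr_minus field_simps)
  finally have kb: "om.vol y (R / 2 ^ Suc i) powr - \<kappa> \<le> om.D powr \<kappa> * f powr - \<kappa>" .
  have "(R / 2 ^ Suc i) powr - (real CARD('n) - \<gamma>) \<le> Co powr \<kappa> * w y * om.vol y (R / 2 ^ Suc i) powr - \<kappa>"
    using y R by simp
  also have "\<dots> \<le> Co powr \<kappa> * w y * (om.D powr \<kappa> * f powr - \<kappa>)"
    using kb by (intro mult_left_mono) auto
  finally have k: "(R / 2 ^ Suc i) powr - (real CARD('n) - \<gamma>) \<le> Co powr \<kappa> * w y * (om.D powr \<kappa> * f powr - \<kappa>)" .
  have I: "(\<integral>\<^sup>+x\<in>E \<inter> ball y (R / 2 ^ i). ennreal (om.deviation z (2 * R) x) \<partial>\<omega>)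
      \<le> ennreal (om.dev_const p * f powr (1 - p) * V powr p)"
    unfolding V_def
  proof (rule om.deviation_integral)
    have "ball y (R / 2 ^ i) \<subseteq> ball z (2 * R)"
      using RR dyz by (intro ball_subset_ballI) linarith
    then show "E \<inter> ball y (R / 2 ^ i) \<subseteq> ball z (2 * R)" by blast
    show "measure \<omega> (E \<inter> ball y (R / 2 ^ i)) \<le> f"
      unfolding f_def by (intro om.measure_le_vol) blast
  qed (use R p in auto)
  have "ennreal ((R / 2 ^ Suc i) powr - (real CARD('n) - \<gamma>)) *
      (\<integral>\<^sup>+x\<in>E \<inter> ball y (R / 2 ^ i). ennreal (om.deviation z (2 * R) x) \<partial>\<omega>)
    \<le> ennreal (Co powr \<kappa> * w y * (om.D powr \<kappa> * f powr - \<kappa>)) * ennreal (om.dev_const p * f powr (1 - p) * V powr p)"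
    using k I by (intro mult_mono ennreal_leI) auto
  also have "\<dots> = ennreal ((Co powr \<kappa> * w y * (om.D powr \<kappa> * f powr - \<kappa>)) * (om.dev_const p * f powr (1 - p) * V powr p))"
    using A by (intro ennreal_mult[symmetric]) auto
  also have "\<dots> \<le> ennreal (inner_const * w y * e powr (1 - \<kappa>) * (om.\<theta> powr p) ^ i)"
  proof (rule ennreal_leI)
    have fp: "f powr - \<kappa> * f powr (1 - p) = f powr p"
    proof -
      have "- \<kappa> + (1 - p) = p" using p by linarith
      then show ?thesis by (metis powr_add)
    qed
    have "f powr p * V powr p \<le> (om.\<theta> ^ i * V) powr p * V powr p"
      using fV f p by (intro mult_right_mono powr_mono2) auto
    also have "\<dots> = (om.\<theta> ^ i) powr p * (V powr p * V powr p)"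
      using V om.\<theta>_bounds by (simp add: powr_mult)
    also have "V powr p * V powr p = V powr (1 - \<kappa>)"
      using p(4) by (simp flip: powr_add)
    also have "(om.\<theta> ^ i) powr p = (om.\<theta> powr p) ^ i"
      using om.\<theta>_bounds by (simp add: powr_realpow[symmetric] powr_powr powr_power mult.commute)
    also have "V powr (1 - \<kappa>) \<le> (om.D ^ 5 * e) powr (1 - \<kappa>)"
    proof (rule powr_mono2)
      have "V \<le> om.D * om.vol z R"
        unfolding V_def using R by (rule om.doubling)
      also have "\<dots> \<le> om.D * (om.D ^ 4 * e)"
        using Ve D by (intro mult_left_mono) auto
      finally show "V \<le> om.D ^ 5 * e"
        by (simp add: eval_nat_numeral mult_ac)
    qed (use V kappa in auto)
    also have "(om.D ^ 5 * e) powr (1 - \<kappa>) = (om.D ^ 5) powr (1 - \<kappa>) * e powr (1 - \<kappa>)"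
      using D e by (simp add: powr_mult)
    finally have main: "f powr p * V powr p \<le> (om.\<theta> powr p) ^ i * ((om.D ^ 5) powr (1 - \<kappa>) * e powr (1 - \<kappa>))"
      using om.\<theta>_bounds by (simp add: mult_left_mono)
    have "(Co powr \<kappa> * w y * (om.D powr \<kappa> * f powr - \<kappa>)) * (om.dev_const p * f powr (1 - p) * V powr p)
        = (Co powr \<kappa> * om.D powr \<kappa> * om.dev_const p * w y) * ((f powr - \<kappa> * f powr (1 - p)) * V powr p)"
      by (simp only: mult_ac)
    also have "\<dots> \<le> (Co powr \<kappa> * om.D powr \<kappa> * om.dev_const p * w y) *
        ((om.\<theta> powr p) ^ i * ((om.D ^ 5) powr (1 - \<kappa>) * e powr (1 - \<kappa>)))"
      unfolding fp using main A by (intro mult_left_mono) auto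
    also have "\<dots> = inner_const * w y * e powr (1 - \<kappa>) * (om.\<theta> powr p) ^ i"
      unfolding inner_const_def p_def[symmetric] by (simp only: mult_ac)
    finally show "(Co powr \<kappa> * w y * (om.D powr \<kappa> * f powr - \<kappa>)) * (om.dev_const p * f powr (1 - p) * V powr p)
        \<le> inner_const * w y * e powr (1 - \<kappa>) * (om.\<theta> powr p) ^ i" .
  qed
  finally show ?thesis by (simp only: p_def)
qed

text \<open>Here the measure \<open>e\<close> of \<open>E\<close>, not that of the shell, is the
  better bound. With \<open>U\<close> the measure of the \<open>i\<close>-th ball and
  \<open>p = \<kappa> / 2\<close>, kernel and deviation give a multiple of
  \<open>e powr (1 - p) * U powr - p\<close>, and \<open>e \<le> D * (\<theta> ^ i * U)\<close>
  turns this into \<open>e powr (1 - \<kappa>)\<close> with decay.\<close>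

lemma outer_shell:
  assumes y: "\<forall>r>0. r powr - (real CARD('n) - \<gamma>) \<le> Co powr \<kappa> * w y * om.vol y r powr - \<kappa>"
    and R: "0 < R" and yz: "y \<in> ball z R" and E [measurable]: "E \<in> sets lebesgue" and fin: "emeasure \<omega> E < \<infinity>"
    and e: "0 < e" "measure \<omega> E = e" and eV: "e \<le> om.vol z R"
  shows "ennreal ((2 ^ i * R) powr - (real CARD('n) - \<gamma>)) *
      (\<integral>\<^sup>+x\<in>E \<inter> ball y (2 ^ Suc i * R). ennreal (om.deviation z (2 * R) x) \<partial>\<omega>)
    \<le> ennreal (outer_const * w y * e powr (1 - \<kappa>) * (om.\<theta> powr (\<kappa> / 2)) ^ i)"
proof -
  define p where "p = \<kappa> / 2"
  have p: "0 < p" "p < 1" "p - \<kappa> = - p" "1 - p - p = 1 - \<kappa>"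
    using kappa by (auto simp: p_def field_simps)
  define U where "U = om.vol y (2 ^ i * R)"
  have U: "0 < U" using R by (auto simp: U_def intro: om.vol_pos)
  have D: "1 \<le> om.D" by (rule om.D_ge_1)
  have A: "1 \<le> om.dev_const p" using p by (intro om.dev_const_ge_1)
  have dyz: "dist z y < R" using yz by simp
  have pw: "2 ^ Suc i * R = 2 * (2 ^ i * R)" "2 ^ (i + 2) * R = 4 * (2 ^ i * R)" by simp_all
  have R2: "R \<le> 2 ^ i * R" using R by (simp add: mult_le_cancel_right1)
  have vz: "om.vol z (2 ^ (i + 2) * R) \<le> om.D ^ 3 * U"
    unfolding U_def
  proof (rule om.vol_le_doubling)
    have "dist y z + 2 ^ (i + 2) * R \<le> R + 4 * (2 ^ i * R)"
      using dyz by (simp add: dist_commute power_add)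
    also have "\<dots> \<le> 8 * (2 ^ i * R)" using R2 R by linarith
    also have "8 * (2 ^ i * R) = 2 ^ 3 * (2 ^ i * R)" by simp
    finally show "ball z (2 ^ (i + 2) * R) \<subseteq> ball y (2 ^ 3 * (2 ^ i * R))"
      by (rule ball_subset_ballI)
  qed (use R in auto)
  have k: "(2 ^ i * R) powr - (real CARD('n) - \<gamma>) \<le> Co powr \<kappa> * w y * U powr - \<kappa>"
    using y R by (simp add: U_def)
  have I: "(\<integral>\<^sup>+x\<in>E \<inter> ball y (2 ^ Suc i * R). ennreal (om.deviation z (2 * R) x) \<partial>\<omega>)
      \<le> ennreal (3 * om.dev_const p * e powr (1 - p) * om.vol z (2 ^ (i + 2) * R) powr p)"
  proof (rule om.deviation_integral_shift)
    have "dist z y + 2 ^ Suc i * R \<le> 2 ^ (i + 2) * R"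
      using dyz R2 R unfolding pw by linarith
    then have "ball y (2 ^ Suc i * R) \<subseteq> ball z (2 ^ (i + 2) * R)"
      by (rule ball_subset_ballI)
    then show "E \<inter> ball y (2 ^ Suc i * R) \<subseteq> ball z (2 ^ (i + 2) * R)" by blast
    have "emeasure \<omega> (E \<inter> ball y (2 ^ Suc i * R)) \<le> emeasure \<omega> E"
      by (intro emeasure_mono) auto
    then show "measure \<omega> (E \<inter> ball y (2 ^ Suc i * R)) \<le> e"
      unfolding e(2)[symmetric] measure_def using fin by (intro enn2real_mono) auto
    show "e \<le> om.vol z (2 * R)"
    proof -
      have "om.vol z R \<le> om.vol z (2 * R)"
        using R by (intro om.vol_mono ball_subset_ballI) simp
      with eV show ?thesis by linarith
    qed
    show "2 * R \<le> 2 ^ (i + 2) * R" using R2 R unfolding pw by linarith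
  qed (use R p in auto)
  have "ennreal ((2 ^ i * R) powr - (real CARD('n) - \<gamma>)) *
      (\<integral>\<^sup>+x\<in>E \<inter> ball y (2 ^ Suc i * R). ennreal (om.deviation z (2 * R) x) \<partial>\<omega>)
    \<le> ennreal (Co powr \<kappa> * w y * U powr - \<kappa>) * ennreal (3 * om.dev_const p * e powr (1 - p) * om.vol z (2 ^ (i + 2) * R) powr p)"
    using k I by (intro mult_mono ennreal_leI) auto
  also have "\<dots> = ennreal ((Co powr \<kappa> * w y * U powr - \<kappa>) * (3 * om.dev_const p * e powr (1 - p) * om.vol z (2 ^ (i + 2) * R) powr p))"
    using A by (intro ennreal_mult[symmetric]) auto
  also have "\<dots> \<le> ennreal (outer_const * w y * e powr (1 - \<kappa>) * (om.\<theta> powr p) ^ i)"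
  proof (rule ennreal_leI)
    have "e \<le> om.D * (om.\<theta> ^ i * U)"
    proof -
      have "e \<le> om.vol z R" by (rule eV)
      also have "\<dots> \<le> om.vol y (2 * R)"
        using dyz by (intro om.vol_mono ball_subset_ballI) (simp add: dist_commute)
      also have "\<dots> \<le> om.D * om.vol y R"
        using R by (rule om.doubling)
      also have "\<dots> \<le> om.D * (om.\<theta> ^ i * U)"
        unfolding U_def using R D by (intro mult_left_mono om.reverse_doubling_iterate) auto
      finally show ?thesis .
    qed
    then have "e / (om.D * om.\<theta> ^ i) \<le> U"
      using D om.\<theta>_bounds by (simp add: divide_le_eq mult_ac)
    then have "U powr - p \<le> (e / (om.D * om.\<theta> ^ i)) powr - p"
      using e D om.\<theta>_bounds p by (intro powr_mono2') auto
    also have "\<dots> = e powr - p * om.D powr p * (om.\<theta> ^ i) powr p"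
      using e D om.\<theta>_bounds by (simp add: powr_divide powr_minus powr_mult field_simps)
    also have "(om.\<theta> ^ i) powr p = (om.\<theta> powr p) ^ i"
      using om.\<theta>_bounds by (simp add: powr_realpow[symmetric] powr_powr powr_power mult.commute)
    finally have Up: "U powr - p \<le> e powr - p * om.D powr p * (om.\<theta> powr p) ^ i" .
    have "U powr - \<kappa> * om.vol z (2 ^ (i + 2) * R) powr p \<le> U powr - \<kappa> * (om.D ^ 3 * U) powr p"
      using vz p by (intro mult_left_mono powr_mono2) auto
    also have "\<dots> = (om.D ^ 3) powr p * (U powr - \<kappa> * U powr p)"
      using D U by (simp add: powr_mult)
    also have "U powr - \<kappa> * U powr p = U powr - p"
    proof -
      have "- \<kappa> + p = - p" using p(3) by linarith
      then show ?thesis by (metis powr_add)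
    qed
    also have "(om.D ^ 3) powr p * U powr - p \<le> (om.D ^ 3) powr p * (e powr - p * om.D powr p * (om.\<theta> powr p) ^ i)"
      using Up by (intro mult_left_mono) auto
    also have "\<dots> = ((om.D ^ 3) powr p * om.D powr p) * (e powr - p * (om.\<theta> powr p) ^ i)"
      by (simp only: mult_ac)
    also have "(om.D ^ 3) powr p * om.D powr p = (om.D ^ 4) powr p"
      using D by (simp add: eval_nat_numeral powr_mult[symmetric] mult_ac)
    finally have main: "U powr - \<kappa> * om.vol z (2 ^ (i + 2) * R) powr p
        \<le> (om.D ^ 4) powr p * (e powr - p * (om.\<theta> powr p) ^ i)" .
    have ep: "e powr (1 - p) * e powr - p = e powr (1 - \<kappa>)"
    proof -
      have "(1 - p) + - p = 1 - \<kappa>" using p(4) by linarith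
      then show ?thesis by (metis powr_add)
    qed
    have "(Co powr \<kappa> * w y * U powr - \<kappa>) * (3 * om.dev_const p * e powr (1 - p) * om.vol z (2 ^ (i + 2) * R) powr p)
        = (Co powr \<kappa> * (3 * om.dev_const p) * w y * e powr (1 - p)) * (U powr - \<kappa> * om.vol z (2 ^ (i + 2) * R) powr p)"
      by (simp only: mult_ac)
    also have "\<dots> \<le> (Co powr \<kappa> * (3 * om.dev_const p) * w y * e powr (1 - p)) * ((om.D ^ 4) powr p * (e powr - p * (om.\<theta> powr p) ^ i))"
      using main A by (intro mult_left_mono) auto
    also have "\<dots> = Co powr \<kappa> * (3 * om.dev_const p) * (om.D ^ 4) powr p * w y * (e powr (1 - p) * e powr - p) * (om.\<theta> powr p) ^ i"
      by (simp only: mult_ac)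
    also have "\<dots> = outer_const * w y * e powr (1 - \<kappa>) * (om.\<theta> powr p) ^ i"
      unfolding ep outer_const_def p_def[symmetric] ..
    finally show "(Co powr \<kappa> * w y * U powr - \<kappa>) * (3 * om.dev_const p * e powr (1 - p) * om.vol z (2 ^ (i + 2) * R) powr p)
        \<le> outer_const * w y * e powr (1 - \<kappa>) * (om.\<theta> powr p) ^ i" .
  qed
  finally show ?thesis by (simp only: p_def)
qed

lemma theta_powr: "0 < p \<Longrightarrow> 0 \<le> om.\<theta> powr p \<and> om.\<theta> powr p < 1"
  using om.\<theta>_bounds powr_less_mono2[of p om.\<theta> 1] by simp

lemma consts_nonneg: "0 \<le> inner_const" "0 \<le> outer_const" "0 \<le> kernel_const"
proof -
  have "1 \<le> om.dev_const ((1 - \<kappa>) / 2)" "1 \<le> om.dev_const (\<kappa> / 2)"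
    using kappa by (auto intro!: om.dev_const_ge_1)
  then show "0 \<le> inner_const" "0 \<le> outer_const"
    by (auto simp: inner_const_def outer_const_def)
  then show "0 \<le> kernel_const"
    using theta_powr[of "(1 - \<kappa>) / 2"] theta_powr[of "\<kappa> / 2"] kappa
    by (auto simp: kernel_const_def intro!: add_nonneg_nonneg divide_nonneg_nonneg)
qed

text \<open>The comparability of \<open>e\<close> and \<open>om.vol z R\<close> is used in both
  directions: the inner shells need a ball that is not much larger than \<open>E\<close>, the outer
  ones a ball that is not smaller. Both series are geometric.\<close>

lemma kernel_deviation_integral:
  assumes y: "\<forall>r>0. r powr - (real CARD('n) - \<gamma>) \<le> Co powr \<kappa> * w y * om.vol y r powr - \<kappa>"
    and R: "0 < R" and yz: "y \<in> ball z R" and E [measurable]: "E \<in> sets lebesgue" and fin: "emeasure \<omega> E < \<infinity>"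
    and e: "0 < e" "measure \<omega> E = e" and eV: "e \<le> om.vol z R" "om.vol z R \<le> om.D ^ 4 * e"
  shows "(\<integral>\<^sup>+x\<in>E. ennreal (om.deviation z (2 * R) x * riesz_kernel \<gamma> x y) \<partial>\<omega>)
    \<le> ennreal (kernel_const * w y * e powr (1 - \<kappa>))"
proof -
  let ?n = "real CARD('n)"
  let ?u = "\<lambda>x. ennreal (om.deviation z (2 * R) x)"
  let ?a = "\<lambda>i::nat. ennreal ((R / 2 ^ Suc i) powr - (?n - \<gamma>))" and ?c = "\<lambda>i::nat. ennreal ((2 ^ i * R) powr - (?n - \<gamma>))"
  let ?A = "\<lambda>i x. ?a i * (?u x * indicator (E \<inter> ball y (R / 2 ^ i)) x)"
  let ?B = "\<lambda>i x. ?c i * (?u x * indicator (E \<inter> ball y (2 ^ Suc i * R)) x)"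
  have "(\<integral>\<^sup>+x\<in>E. ennreal (om.deviation z (2 * R) x * riesz_kernel \<gamma> x y) \<partial>\<omega>)
      \<le> (\<integral>\<^sup>+x. (\<Sum>i. ?A i x) + (\<Sum>i. ?B i x) \<partial>\<omega>)"
  proof (intro nn_integral_mono)
    fix x
    have "(?u x * indicator E x) * ennreal (riesz_kernel \<gamma> x y) \<le> (?u x * indicator E x) *
        ((\<Sum>i. ?a i * indicator (ball y (R / 2 ^ i)) x) + (\<Sum>i. ?c i * indicator (ball y (2 ^ Suc i * R)) x))"
      using R gamma by (intro mult_left_mono riesz_kernel_shells) auto
    also have "\<dots> = (\<Sum>i. ?A i x) + (\<Sum>i. ?B i x)"
      unfolding distrib_left ennreal_suminf_cmult[symmetric] by (simp add: indicator_inter_arith mult_ac)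
    finally show "ennreal (om.deviation z (2 * R) x * riesz_kernel \<gamma> x y) * indicator E x \<le> (\<Sum>i. ?A i x) + (\<Sum>i. ?B i x)"
      by (simp add: ennreal_mult mult_ac)
  qed
  also have "\<dots> = (\<integral>\<^sup>+x. (\<Sum>i. ?A i x) \<partial>\<omega>) + (\<integral>\<^sup>+x. (\<Sum>i. ?B i x) \<partial>\<omega>)"
    by (intro nn_integral_add) measurable
  also have "(\<integral>\<^sup>+x. (\<Sum>i. ?A i x) \<partial>\<omega>) = (\<Sum>i. ?a i * (\<integral>\<^sup>+x\<in>E \<inter> ball y (R / 2 ^ i). ?u x \<partial>\<omega>))"
    by (subst nn_integral_suminf, measurable) (simp add: nn_integral_cmult)
  also have "\<dots> \<le> (\<Sum>i. ennreal (inner_const * w y * e powr (1 - \<kappa>) * (om.\<theta> powr ((1 - \<kappa>) / 2)) ^ i))"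
    using inner_shell[OF y R yz E e(1) eV(2)] by (intro suminf_le) auto
  also have "(\<Sum>i. ennreal (inner_const * w y * e powr (1 - \<kappa>) * (om.\<theta> powr ((1 - \<kappa>) / 2)) ^ i))
      = ennreal (inner_const * w y * e powr (1 - \<kappa>) / (1 - om.\<theta> powr ((1 - \<kappa>) / 2)))"
    using consts_nonneg theta_powr[of "(1 - \<kappa>) / 2"] kappa by (intro suminf_ennreal_geometric) auto
  also have "(\<integral>\<^sup>+x. (\<Sum>i. ?B i x) \<partial>\<omega>) = (\<Sum>i. ?c i * (\<integral>\<^sup>+x\<in>E \<inter> ball y (2 ^ Suc i * R). ?u x \<partial>\<omega>))"
    by (subst nn_integral_suminf, measurable) (simp add: nn_integral_cmult)
  also have "\<dots> \<le> (\<Sum>i. ennreal (outer_const * w y * e powr (1 - \<kappa>) * (om.\<theta> powr (\<kappa> / 2)) ^ i))"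
    using outer_shell[OF y R yz E fin e eV(1)] by (intro suminf_le) auto
  also have "(\<Sum>i. ennreal (outer_const * w y * e powr (1 - \<kappa>) * (om.\<theta> powr (\<kappa> / 2)) ^ i))
      = ennreal (outer_const * w y * e powr (1 - \<kappa>) / (1 - om.\<theta> powr (\<kappa> / 2)))"
    using consts_nonneg theta_powr[of "\<kappa> / 2"] kappa by (intro suminf_ennreal_geometric) auto
  also have "ennreal (inner_const * w y * e powr (1 - \<kappa>) / (1 - om.\<theta> powr ((1 - \<kappa>) / 2)))
        + ennreal (outer_const * w y * e powr (1 - \<kappa>) / (1 - om.\<theta> powr (\<kappa> / 2)))
      = ennreal (kernel_const * w y * e powr (1 - \<kappa>))"
    using consts_nonneg theta_powr[of "\<kappa> / 2"] theta_powr[of "(1 - \<kappa>) / 2"] kappa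
    by (subst ennreal_plus[symmetric]) (auto simp: kernel_const_def ring_distribs)
  finally show ?thesis
    by (simp add: add_mono)
qed

end

section \<open>Level sets of the near part\<close>

lemma Phi_nonneg: "0 \<le> t \<Longrightarrow> 0 \<le> Phi t"
  by (simp add: Phi_def)

lemma measurable_Phi [measurable]: "Phi \<in> borel_measurable borel"
  unfolding Phi_def by measurable

lemma measurable_nn_integral_count_space:
  assumes "countable I" and [measurable]: "\<And>i. i \<in> I \<Longrightarrow> f i \<in> borel_measurable M"
  shows "(\<lambda>y. \<integral>\<^sup>+i. f i y \<partial>count_space I) \<in> borel_measurable M"
proof (rule sigma_finite_measure.borel_measurable_nn_integral[OF sigma_finite_measure_count_space_countable[OF assms(1)]])
  show "case_prod (\<lambda>y i. f i y) \<in> borel_measurable (M \<Otimes>\<^sub>M count_space I)"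
    by (subst measurable_pair_swap_iff) (use assms in \<open>auto intro!: measurable_pair_measure_countable1\<close>)
qed

context commutator_setting
begin

definition comm_kernel :: "(real^'n \<Rightarrow> real) \<Rightarrow> real^'n \<Rightarrow> real^'n \<Rightarrow> real" where
  "comm_kernel g x y = norm (b x - b y) * riesz_kernel \<gamma> x y * g y"

lemma measurable_comm_kernel [measurable]:
  assumes [measurable]: "g \<in> borel_measurable lebesgue"
  shows "(\<lambda>z. comm_kernel g (fst z) (snd z)) \<in> borel_measurable (lebesgue \<Otimes>\<^sub>M lebesgue)"
  unfolding comm_kernel_def by measurable

lemma norm_diff_le_deviation: "norm (b x - b y) \<le> om.deviation z r x * om.deviation z r y"
proof -
  have "norm (b x - b y) \<le> norm (b x - ball_mean b (ball z r)) + norm (b y - ball_mean b (ball z r))"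
    using norm_triangle_ineq4[of "b x - ball_mean b (ball z r)" "b y - ball_mean b (ball z r)"] by simp
  also have "\<dots> \<le> om.deviation z r x * om.deviation z r y"
    by (simp add: om.deviation_def algebra_simps)
  finally show ?thesis .
qed

text \<open>Halving the radius drives the measure to 0 by reverse doubling; the last radius at which
  the measure is still at least \<open>e\<close> works, as doubling bounds the measure there by
  \<open>D * e\<close>.\<close>

lemma exists_radius:
  assumes r: "0 < r" and e: "0 < e" "e \<le> om.vol z r"
  shows "\<exists>\<rho>>0. \<rho> \<le> r \<and> e \<le> om.vol z \<rho> \<and> om.vol z \<rho> \<le> om.D * e"
proof -
  have V: "0 < om.vol z r" using r by (rule om.vol_pos)
  obtain m where m: "om.\<theta> ^ m < e / om.vol z r"
    using real_arch_pow_inv[of "e / om.vol z r" om.\<theta>] e V om.\<theta>_bounds by auto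
  have "om.vol z (r / 2 ^ m) \<le> om.\<theta> ^ m * om.vol z r"
    using om.reverse_doubling_iterate[of "r / 2 ^ m" z m] r by simp
  also have "\<dots> < e"
    using m V by (simp add: field_simps)
  finally have ex: "om.vol z (r / 2 ^ m) < e" .
  define i where "i = (LEAST i. om.vol z (r / 2 ^ i) < e)"
  have 1: "om.vol z (r / 2 ^ i) < e"
    unfolding i_def using ex by (rule LeastI)
  then obtain j where j: "i = Suc j"
    using e by (cases i) auto
  have "\<not> om.vol z (r / 2 ^ j) < e"
    using not_less_Least[of j "\<lambda>i. om.vol z (r / 2 ^ i) < e"] j unfolding i_def by simp
  moreover have "om.vol z (r / 2 ^ j) \<le> om.D * om.vol z (r / 2 ^ i)"
    using om.doubling[of "r / 2 ^ i" z] r by (simp add: j)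
  moreover have "om.D * om.vol z (r / 2 ^ i) \<le> om.D * e"
    using 1 om.D_ge_1 by (intro mult_left_mono) auto
  moreover have "r / 2 ^ j \<le> r"
    using r by (simp add: divide_le_eq mult_le_cancel_left1)
  ultimately show ?thesis
    using r by (intro exI[of _ "r / 2 ^ j"]) auto
qed

text \<open>\<open>W.D ^ 6\<close> collects four doublings from a Vitali ball to the ball of 16
  times its radius and two from \<open>ball y0 (2 * r)\<close> to a ball containing all Vitali
  balls.\<close>

definition local_const :: real where
  "local_const = kernel_const * (1 + exp cw * Kw * W.D ^ 6) / cw"

lemma local_const_nonneg: "0 \<le> local_const"
  using consts_nonneg W.c_pos W.K_pos W.D_ge_1 by (simp add: local_const_def)

text \<open>Testing the dual operator on \<open>E\<close> leads to balls whose \<open>\<omega>\<close>-measure is comparable with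
  \<open>\<omega> E\<close>: on those, the oscillation of \<open>b\<close> over \<open>E\<close> costs no logarithm.\<close>

lemma local_estimate:
  assumes r: "0 < r" and E [measurable]: "E \<in> sets lebesgue" and EB: "E \<subseteq> ball y0 r" and l: "0 < l"
    and g [measurable]: "g \<in> borel_measurable lebesgue" and g0: "\<And>x. 0 \<le> g x"
    and big: "\<And>x. x \<in> E \<Longrightarrow> ennreal l \<le> (\<integral>\<^sup>+y\<in>ball y0 (2 * r). ennreal (comm_kernel g x y) \<partial>lebesgue)"
    and \<sigma>: "0 < \<sigma>" "(\<integral>\<^sup>+y\<in>ball y0 (2 * r). ennreal (Phi (g y / \<sigma>) * w y) \<partial>lebesgue) \<le> ennreal (W.vol y0 (2 * r))"
  shows "measure \<omega> E powr \<kappa> \<le> local_const * \<sigma> * W.vol y0 (2 * r) / l"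
proof (cases "measure \<omega> E = 0")
  case True
  then show ?thesis
    using local_const_nonneg \<sigma> l by simp
next
  case False
  define e where "e = measure \<omega> E"
  have e: "0 < e" using False by (simp add: e_def less_le)
  have fin: "emeasure \<omega> E < \<infinity>" using EB by (rule om.emeasure_bounded_fin)
  have ee: "emeasure \<omega> E = ennreal e" unfolding e_def using fin by (rule emeasure_eq_measure_fin)
  let ?B = "ball y0 (2 * r)"
  \<comment> \<open>\<open>ball z (3 * r)\<close> contains \<open>ball y0 r\<close> and hence
    \<open>E\<close>, so radii up to \<open>3 * r\<close> suffice to reach the measure
    \<open>e\<close>.\<close>
  have "\<exists>\<rho>>0. \<rho> \<le> 3 * r \<and> e \<le> om.vol z \<rho> \<and> om.vol z \<rho> \<le> om.D * e" if "z \<in> ?B" for z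
  proof (rule exists_radius)
    have "e \<le> om.vol y0 r"
      unfolding e_def using EB by (rule om.measure_le_vol)
    also have "\<dots> \<le> om.vol z (3 * r)"
      using that by (intro om.vol_mono ball_subset_ballI) (simp add: dist_commute)
    finally show "e \<le> om.vol z (3 * r)" .
  qed (use r e in auto)
  then obtain \<rho> where \<rho>: "\<And>z. z \<in> ?B \<Longrightarrow> 0 < \<rho> z \<and> \<rho> z \<le> 3 * r \<and> e \<le> om.vol z (\<rho> z) \<and> om.vol z (\<rho> z) \<le> om.D * e"
    by metis
  have cB: "?B \<subseteq> (\<Union>z\<in>?B. ball z (\<rho> z))"
  proof
    fix z assume "z \<in> ?B"
    with \<rho>[OF this] show "z \<in> (\<Union>z\<in>?B. ball z (\<rho> z))"
      by (intro UN_I[of z]) auto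
  qed
  have \<rho>3: "0 < \<rho> z \<and> \<rho> z \<le> 3 * r" if "z \<in> ?B" for z
    using \<rho>[OF that] by blast
  obtain I where I: "countable I" "I \<subseteq> ?B"
    and disj: "pairwise (\<lambda>i j. disjnt (ball i (\<rho> i)) (ball j (\<rho> j))) I"
    and cov: "?B \<subseteq> (\<Union>i\<in>I. ball i (5 * \<rho> i))"
    by (rule Vitali_covering_lemma_balls[where a = "\<lambda>z. z" and K = ?B, OF cB \<rho>3], assumption) (rule that)
  \<comment> \<open>The covering needs the factor 5; 8 is the next power of 2, which suits iterated
    doubling.\<close>
  define R where "R i = 8 * \<rho> i" for i
  have R: "0 < R i" "e \<le> om.vol i (R i)" "om.vol i (R i) \<le> om.D ^ 4 * e" if "i \<in> I" for i
  proof -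
    have i: "0 < \<rho> i" "e \<le> om.vol i (\<rho> i)" "om.vol i (\<rho> i) \<le> om.D * e"
      using \<rho>[of i] that I by auto
    show "0 < R i" using i by (simp add: R_def)
    have "om.vol i (\<rho> i) \<le> om.vol i (R i)"
      using i by (intro om.vol_mono ball_subset_ballI) (simp add: R_def)
    with i show "e \<le> om.vol i (R i)" by linarith
    have "om.vol i (R i) \<le> om.D ^ 3 * om.vol i (\<rho> i)"
      using om.doubling_iterate[OF i(1), of i 3] by (simp add: R_def)
    also have "\<dots> \<le> om.D ^ 3 * (om.D * e)"
      using i om.D_ge_1 by (intro mult_left_mono) auto
    finally show "om.vol i (R i) \<le> om.D ^ 4 * e"
      by (simp add: eval_nat_numeral mult_ac)
  qed
  have covR: "\<exists>i\<in>I. y \<in> ball i (R i)" if yB: "y \<in> ?B" for y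
  proof -
    obtain i where i: "i \<in> I" "y \<in> ball i (5 * \<rho> i)" using cov yB by blast
    then have "y \<in> ball i (R i)"
      using R(1)[OF i(1)] unfolding R_def mem_ball by linarith
    with i show ?thesis by auto
  qed
  define u where "u i y = om.deviation i (2 * R i) y" for i y
  \<comment> \<open>The sum over all enlarged Vitali balls containing \<open>y\<close> dominates the
    exponential for any one of them, which replaces a measurable choice of a ball for each
    \<open>y\<close>.\<close>
  define H where "H y = (\<integral>\<^sup>+i. indicator (ball i (R i)) y * ennreal (exp (cw * u i y)) \<partial>count_space I)" for y
  have [measurable]: "u i \<in> borel_measurable lebesgue" for i
    unfolding u_def by measurable
  have u0: "0 \<le> u i y" for i y by (simp add: u_def)

  let ?F = "\<lambda>z. ennreal (w (fst z) powr q) * indicator E (fst z) * (ennreal (comm_kernel g (fst z) (snd z)) * indicator ?B (snd z))"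
  have F [measurable]: "?F \<in> borel_measurable (lebesgue \<Otimes>\<^sub>M lebesgue)"
    by measurable
  define P where "P = kernel_const * e powr (1 - \<kappa>) * (\<sigma> / cw)"
  have P: "0 \<le> P" using consts_nonneg \<sigma> W.c_pos by (simp add: P_def)
  have "ennreal (l * e) = (\<integral>\<^sup>+x\<in>E. ennreal l \<partial>\<omega>)"
    using l e by (simp add: nn_integral_cmult ee ennreal_mult)
  also have "\<dots> = (\<integral>\<^sup>+x. ennreal (w x powr q) * (ennreal l * indicator E x) \<partial>lebesgue)"
    by (intro om.nn_integral_weighted) measurable
  also have "\<dots> \<le> (\<integral>\<^sup>+x. \<integral>\<^sup>+y. ?F (x, y) \<partial>lebesgue \<partial>lebesgue)"
  proof (intro nn_integral_mono)
    fix x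
    have [measurable]: "comm_kernel g x \<in> borel_measurable lebesgue"
      unfolding comm_kernel_def riesz_kernel_def by measurable
    have "(\<integral>\<^sup>+y. ?F (x, y) \<partial>lebesgue) = ennreal (w x powr q) * indicator E x * (\<integral>\<^sup>+y\<in>?B. ennreal (comm_kernel g x y) \<partial>lebesgue)"
      by (simp add: nn_integral_cmult)
    then show "ennreal (w x powr q) * (ennreal l * indicator E x) \<le> (\<integral>\<^sup>+y. ?F (x, y) \<partial>lebesgue)"
      using big[of x] by (auto simp: indicator_def intro: mult_left_mono)
  qed
  \<comment> \<open>Exchanging the integrals brings in the dual potential of \<open>E\<close> at
    \<open>y\<close>, which \<open>kernel_deviation_integral\<close> bounds.\<close>
  also have "\<dots> = (\<integral>\<^sup>+y. \<integral>\<^sup>+x. ?F (x, y) \<partial>lebesgue \<partial>lebesgue)"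
    by (rule pair_sigma_finite.Fubini'[OF pair_sigma_finite_lebesgue, symmetric]) (use F in simp)
  also have "\<dots> \<le> (\<integral>\<^sup>+y. ennreal P * (ennreal (Phi (g y / \<sigma>) * w y) * indicator ?B y + ennreal (w y) * H y) \<partial>lebesgue)"
  proof (rule nn_integral_mono_AE)
    show "AE y in lebesgue. (\<integral>\<^sup>+x. ?F (x, y) \<partial>lebesgue)
        \<le> ennreal P * (ennreal (Phi (g y / \<sigma>) * w y) * indicator ?B y + ennreal (w y) * H y)"
      using kernel_size
    proof eventually_elim
      case (elim y)
      show ?case
      proof (cases "y \<in> ?B")
        case False
        then show ?thesis by simp
      next
        case True
        obtain i where i: "i \<in> I" "y \<in> ball i (R i)"
          using covR[OF True] by blast
        have "(\<integral>\<^sup>+x. ?F (x, y) \<partial>lebesgue) \<le> (\<integral>\<^sup>+x. ennreal (g y * u i y) *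
            (ennreal (w x powr q) * (ennreal (u i x * riesz_kernel \<gamma> x y) * indicator E x)) \<partial>lebesgue)"
        proof (intro nn_integral_mono)
          fix x
          have "comm_kernel g x y \<le> (u i x * u i y) * riesz_kernel \<gamma> x y * g y"
            unfolding comm_kernel_def u_def using g0
            by (intro mult_right_mono norm_diff_le_deviation) auto
          also have "\<dots> = (g y * u i y) * (u i x * riesz_kernel \<gamma> x y)" by (simp only: mult_ac)
          finally have ck: "comm_kernel g x y \<le> (g y * u i y) * (u i x * riesz_kernel \<gamma> x y)" .
          have "ennreal (comm_kernel g x y) \<le> ennreal (g y * u i y) * ennreal (u i x * riesz_kernel \<gamma> x y)"
            using ck g0 u0 by (subst ennreal_mult[symmetric]) (auto intro: ennreal_leI)
          then have "ennreal (w x powr q) * indicator E x * ennreal (comm_kernel g x y)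
              \<le> ennreal (w x powr q) * indicator E x * (ennreal (g y * u i y) * ennreal (u i x * riesz_kernel \<gamma> x y))"
            by (intro mult_left_mono) auto
          then show "?F (x, y) \<le> ennreal (g y * u i y) *
              (ennreal (w x powr q) * (ennreal (u i x * riesz_kernel \<gamma> x y) * indicator E x))"
            using True by (simp add: mult_ac)
        qed
        also have "\<dots> = ennreal (g y * u i y) * (\<integral>\<^sup>+x\<in>E. ennreal (u i x * riesz_kernel \<gamma> x y) \<partial>\<omega>)"
          by (subst nn_integral_cmult, measurable, subst om.nn_integral_weighted, measurable)
        also have "\<dots> \<le> ennreal (g y * u i y) * ennreal (kernel_const * w y * e powr (1 - \<kappa>))"
          unfolding u_def using R[OF i(1)] i(2) e fin elim
          by (intro mult_left_mono kernel_deviation_integral) (auto simp: e_def)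
        also have "\<dots> = ennreal ((kernel_const * w y * e powr (1 - \<kappa>)) * (g y * u i y))"
          using g0 u0 consts_nonneg by (subst ennreal_mult[symmetric]) (auto simp: mult_ac)
        also have "\<dots> \<le> ennreal ((kernel_const * w y * e powr (1 - \<kappa>)) * ((\<sigma> / cw) * (Phi (g y / \<sigma>) + exp (cw * u i y))))"
        proof (intro ennreal_leI mult_left_mono)
          \<comment> \<open>Young's inequality is applied to \<open>g y / \<sigma>\<close>, because
            the Luxemburg condition controls \<open>Phi\<close> of it, and to
            \<open>cw * u i y\<close>, whose exponential is integrable against
            \<open>w\<close>.\<close>
          have "(g y / \<sigma>) * (cw * u i y) \<le> Phi (g y / \<sigma>) + exp (cw * u i y)"
            using g0 \<sigma> by (intro Young_exp_Phi) auto
          then have "(\<sigma> / cw) * ((g y / \<sigma>) * (cw * u i y)) \<le> (\<sigma> / cw) * (Phi (g y / \<sigma>) + exp (cw * u i y))"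
            using \<sigma> W.c_pos by (intro mult_left_mono) auto
          moreover have "(\<sigma> / cw) * ((g y / \<sigma>) * (cw * u i y)) = g y * u i y"
            using \<sigma> W.c_pos by simp
          ultimately show "g y * u i y \<le> (\<sigma> / cw) * (Phi (g y / \<sigma>) + exp (cw * u i y))" by simp
        qed (use consts_nonneg in auto)
        also have "(kernel_const * w y * e powr (1 - \<kappa>)) * ((\<sigma> / cw) * (Phi (g y / \<sigma>) + exp (cw * u i y)))
            = P * (Phi (g y / \<sigma>) * w y + w y * exp (cw * u i y))"
          by (simp add: P_def algebra_simps)
        also have "ennreal \<dots> = ennreal P * (ennreal (Phi (g y / \<sigma>) * w y) + ennreal (w y) * ennreal (exp (cw * u i y)))"
          using P g0 \<sigma> by (simp add: ennreal_mult Phi_nonneg)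
        also have "\<dots> \<le> ennreal P * (ennreal (Phi (g y / \<sigma>) * w y) * indicator ?B y + ennreal (w y) * H y)"
        proof -
          have "indicator (ball i (R i)) y * ennreal (exp (cw * u i y)) \<le> H y"
            unfolding H_def using i(1) by (rule nn_integral_ge_point)
          then have "ennreal (exp (cw * u i y)) \<le> H y"
            using i(2) by simp
          then show ?thesis
            using True by (intro mult_left_mono add_mono) auto
        qed
        finally show ?thesis .
      qed
    qed
  qed
  also have "\<dots> \<le> ennreal P * ennreal ((1 + exp cw * Kw * W.D ^ 6) * W.vol y0 (2 * r))"
  proof -
    have Hm: "(\<lambda>y. indicator (ball i (R i)) y * ennreal (exp (cw * u i y))) \<in> borel_measurable lebesgue" for i
      by measurable
    have [measurable]: "H \<in> borel_measurable lebesgue"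
      unfolding H_def using I(1) Hm by (intro measurable_nn_integral_count_space) auto
    have "(\<integral>\<^sup>+y. ennreal (w y) * H y \<partial>lebesgue) = (\<integral>\<^sup>+y. H y \<partial>weighted w)"
      by (intro W.nn_integral_weighted[symmetric]) measurable
    also have "\<dots> = (\<integral>\<^sup>+i. \<integral>\<^sup>+y. indicator (ball i (R i)) y * ennreal (exp (cw * u i y)) \<partial>weighted w \<partial>count_space I)"
      unfolding H_def by (intro nn_integral_count_space_nn_integral I(1)) measurable
    also have "\<dots> \<le> (\<integral>\<^sup>+i. ennreal (exp cw * Kw * W.D ^ 4) * emeasure (weighted w) (ball i (\<rho> i)) \<partial>count_space I)"
    proof (rule nn_integral_mono)
      fix i assume "i \<in> space (count_space I)"
      then have i: "i \<in> I" by simp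
      have "(\<integral>\<^sup>+y. indicator (ball i (R i)) y * ennreal (exp (cw * u i y)) \<partial>weighted w)
          \<le> (\<integral>\<^sup>+y. ennreal (exp cw) * (ennreal (exp (cw * norm (b y - ball_mean b (ball i (2 * R i))))) * indicator (ball i (2 * R i)) y) \<partial>weighted w)"
      proof (intro nn_integral_mono)
        fix y
        have "exp (cw * u i y) = exp cw * exp (cw * norm (b y - ball_mean b (ball i (2 * R i))))"
          by (simp add: u_def om.deviation_def ring_distribs exp_add)
        moreover have "y \<in> ball i (2 * R i)" if "y \<in> ball i (R i)"
          using that R(1)[OF i] unfolding mem_ball by linarith
        ultimately show "indicator (ball i (R i)) y * ennreal (exp (cw * u i y)) \<le> ennreal (exp cw) *
            (ennreal (exp (cw * norm (b y - ball_mean b (ball i (2 * R i))))) * indicator (ball i (2 * R i)) y)"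
          by (auto simp: indicator_def ennreal_mult)
      qed
      also have "\<dots> = ennreal (exp cw) * (\<integral>\<^sup>+y\<in>ball i (2 * R i). ennreal (exp (cw * norm (b y - ball_mean b (ball i (2 * R i))))) \<partial>weighted w)"
        by (intro nn_integral_cmult) measurable
      also have "\<dots> \<le> ennreal (exp cw) * ennreal (Kw * W.vol i (2 * R i))"
        using R(1)[OF i] by (intro mult_left_mono W.John_Nirenberg) auto
      \<comment> \<open>Back from radius \<open>2 * R i = 16 * \<rho> i\<close> to
        \<open>\<rho> i\<close>: the small balls are disjoint, so that their measures add
        up.\<close>
      also have "\<dots> \<le> ennreal (exp cw) * ennreal (Kw * (W.D ^ 4 * W.vol i (\<rho> i)))"
      proof -
        have "W.vol i (2 * R i) \<le> W.D ^ 4 * W.vol i (\<rho> i)"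
          using W.doubling_iterate[of "\<rho> i" i 4] \<rho>[of i] i I by (auto simp: R_def)
        then show ?thesis
          using W.K_pos by (intro mult_left_mono ennreal_leI) auto
      qed
      also have "\<dots> = ennreal (exp cw * Kw * W.D ^ 4) * emeasure (weighted w) (ball i (\<rho> i))"
        using W.K_pos W.D_ge_1 by (simp add: W.emeasure_ball_vol mult_ac flip: ennreal_mult)
      finally show "(\<integral>\<^sup>+y. indicator (ball i (R i)) y * ennreal (exp (cw * u i y)) \<partial>weighted w)
          \<le> ennreal (exp cw * Kw * W.D ^ 4) * emeasure (weighted w) (ball i (\<rho> i))" .
    qed
    also have "\<dots> = ennreal (exp cw * Kw * W.D ^ 4) * (\<integral>\<^sup>+i. emeasure (weighted w) (ball i (\<rho> i)) \<partial>count_space I)"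
      by (intro nn_integral_cmult) simp
    also have "(\<integral>\<^sup>+i. emeasure (weighted w) (ball i (\<rho> i)) \<partial>count_space I) = emeasure (weighted w) (\<Union>i\<in>I. ball i (\<rho> i))"
      using disj I(1) by (intro emeasure_UN_countable[symmetric]) (auto simp: disjoint_family_on_def pairwise_def disjnt_def)
    also have "\<dots> \<le> emeasure (weighted w) (ball y0 (2 ^ 2 * (2 * r)))"
    proof (intro emeasure_mono UN_least)
      fix i assume "i \<in> I"
      then have "dist y0 i < 2 * r" "\<rho> i \<le> 3 * r" using I \<rho>[of i] by auto
      then show "ball i (\<rho> i) \<subseteq> ball y0 (2 ^ 2 * (2 * r))"
        using r by (intro ball_subset_ballI) simp
    qed simp
    also have "\<dots> \<le> ennreal (W.D ^ 2 * W.vol y0 (2 * r))"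
      unfolding W.emeasure_ball_vol using r by (intro ennreal_leI W.doubling_iterate) auto
    finally have Hint: "(\<integral>\<^sup>+y. ennreal (w y) * H y \<partial>lebesgue)
        \<le> ennreal (exp cw * Kw * W.D ^ 4) * ennreal (W.D ^ 2 * W.vol y0 (2 * r))"
      by (simp add: mult_left_mono)
    have "(\<integral>\<^sup>+y. ennreal P * (ennreal (Phi (g y / \<sigma>) * w y) * indicator ?B y + ennreal (w y) * H y) \<partial>lebesgue)
        = ennreal P * ((\<integral>\<^sup>+y\<in>?B. ennreal (Phi (g y / \<sigma>) * w y) \<partial>lebesgue) + (\<integral>\<^sup>+y. ennreal (w y) * H y \<partial>lebesgue))"
      by (simp add: nn_integral_cmult nn_integral_add)
    also have "\<dots> \<le> ennreal P * (ennreal (W.vol y0 (2 * r)) + ennreal (exp cw * Kw * W.D ^ 4) * ennreal (W.D ^ 2 * W.vol y0 (2 * r)))"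
      by (intro mult_left_mono add_mono \<sigma>(2) Hint) auto
    also have "\<dots> = ennreal P * ennreal ((1 + exp cw * Kw * W.D ^ 6) * W.vol y0 (2 * r))"
    proof -
      have "W.D ^ 4 * W.D ^ 2 = W.D ^ 6" by (simp flip: power_add)
      then have "(1 + exp cw * Kw * W.D ^ 6) * W.vol y0 (2 * r)
          = W.vol y0 (2 * r) + exp cw * Kw * W.D ^ 4 * (W.D ^ 2 * W.vol y0 (2 * r))"
        by (simp add: algebra_simps)
      then show ?thesis
        using W.K_pos W.D_ge_1 by (simp flip: ennreal_mult ennreal_plus)
    qed
    finally show ?thesis .
  qed
  also have "\<dots> = ennreal (P * ((1 + exp cw * Kw * W.D ^ 6) * W.vol y0 (2 * r)))"
    using P W.K_pos W.D_ge_1 by (intro ennreal_mult[symmetric]) auto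
  finally have "l * e \<le> P * ((1 + exp cw * Kw * W.D ^ 6) * W.vol y0 (2 * r))"
    using P W.K_pos W.D_ge_1 by (subst (asm) ennreal_le_iff) auto
  also have "\<dots> = e powr (1 - \<kappa>) * (local_const * \<sigma> * W.vol y0 (2 * r))"
    by (simp add: P_def local_const_def)
  \<comment> \<open>The factor \<open>e powr (1 - \<kappa>)\<close> cancels and leaves the power
    \<open>\<kappa>\<close> of the measure of the level set.\<close>
  also have "l * e = e powr (1 - \<kappa>) * (l * e powr \<kappa>)"
    using e by (simp add: mult_ac flip: powr_add)
  finally have "l * e powr \<kappa> \<le> local_const * \<sigma> * W.vol y0 (2 * r)"
    using e by simp
  then show ?thesis
    using l by (simp add: e_def[symmetric] pos_le_divide_eq mult.commute)
qed

end

section \<open>Luxemburg norms and the far part\<close>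

lemma ennreal_divide_mult_cancel:
  assumes "0 < c"
  shows "X / ennreal c * ennreal c = X"
  using assms by (simp only: ennreal_divide_times) (simp add: ennreal_mult_divide_eq)

lemma Phi_mono: "0 \<le> x \<Longrightarrow> x \<le> y \<Longrightarrow> Phi x \<le> Phi y"
  unfolding Phi_def by (cases "x = 0") (auto intro!: mult_mono add_mono max.mono)

lemma Phi_ge_self: "0 \<le> x \<Longrightarrow> x \<le> Phi x"
  unfolding Phi_def by (simp add: mult_le_cancel_left1)

context A1_weight
begin

lemma wmeas_ball: "wmeas v (ball y r) = ennreal (vol y r)"
  using emeasure_weighted[OF v_measurable, of "ball y r"] by (simp add: emeasure_ball_vol)

text \<open>The condition on \<open>\<sigma>\<close> in the Luxemburg norm with the division
  cleared, which is legitimate for \<open>r > 0\<close> because \<open>vol y r\<close> is then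
  positive and finite.\<close>

definition admissible :: "(real^'n \<Rightarrow> real) \<Rightarrow> real^'n \<Rightarrow> real \<Rightarrow> real \<Rightarrow> bool" where
  "admissible g y r \<sigma> \<longleftrightarrow> 0 < \<sigma> \<and> (\<integral>\<^sup>+x\<in>ball y r. ennreal (Phi (\<bar>g x\<bar> / \<sigma>) * v x) \<partial>lebesgue) \<le> ennreal (vol y r)"

lemma LlogL_norm_eq:
  assumes "0 < r"
  shows "LlogL_norm v (ball y r) g = Inf {ennreal \<sigma> | \<sigma>. admissible g y r \<sigma>}"
proof -
  have V: "0 < vol y r" using assms by (rule vol_pos)
  have "X / ennreal (vol y r) \<le> 1 \<longleftrightarrow> X \<le> ennreal (vol y r)" for X
  proof
    assume "X / ennreal (vol y r) \<le> 1"
    then have "X / ennreal (vol y r) * ennreal (vol y r) \<le> 1 * ennreal (vol y r)"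
      by (rule mult_right_mono) simp
    then show "X \<le> ennreal (vol y r)"
      by (simp only: ennreal_divide_mult_cancel[OF V] mult_1)
  next
    assume "X \<le> ennreal (vol y r)"
    then show "X / ennreal (vol y r) \<le> 1"
      using V by (intro divide_le_posI_ennreal) auto
  qed
  then show ?thesis
    by (simp add: LlogL_norm_def admissible_def wmeas_ball)
qed

text \<open>An estimate linear in \<open>\<sigma>\<close> passes to the infimum. If no
  \<open>\<sigma>\<close> is admissible, the infimum is infinite and the claim trivial.\<close>

lemma le_LlogL_norm:
  assumes r: "0 < r" and c: "0 < c" and le: "\<And>\<sigma>. admissible g y r \<sigma> \<Longrightarrow> X \<le> ennreal (c * \<sigma>)"
  shows "X \<le> ennreal c * LlogL_norm v (ball y r) g"
proof -
  have "X / ennreal c \<le> Inf {ennreal \<sigma> | \<sigma>. admissible g y r \<sigma>}"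
  proof (rule Inf_greatest)
    fix x assume "x \<in> {ennreal \<sigma> | \<sigma>. admissible g y r \<sigma>}"
    then obtain \<sigma> where \<sigma>: "x = ennreal \<sigma>" "admissible g y r \<sigma>" by auto
    then have "0 < \<sigma>" by (simp add: admissible_def)
    have "X \<le> ennreal \<sigma> * ennreal c"
      using le[OF \<sigma>(2)] c \<open>0 < \<sigma>\<close> by (subst ennreal_mult[symmetric]) (auto simp: mult.commute)
    then show "X / ennreal c \<le> x"
      unfolding \<sigma>(1) using c by (intro divide_le_posI_ennreal) (auto simp: mult.commute)
  qed
  then have "X / ennreal c * ennreal c \<le> LlogL_norm v (ball y r) g * ennreal c"
    unfolding LlogL_norm_eq[OF r] by (rule mult_right_mono) simp
  then show ?thesis
    unfolding ennreal_divide_mult_cancel[OF c] by (simp only: mult.commute)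
qed

end

section \<open>Exponential integrability paired with the Luxemburg norm\<close>

context A1_BMO
begin

definition Hoelder_const :: real where
  "Hoelder_const = (1 + exp c * K) / c"

lemma Hoelder_const_pos: "0 < Hoelder_const"
  using c_pos K_pos by (simp add: Hoelder_const_def add_pos_pos)

text \<open>Hoelder's inequality for the pair L log L and exp L: Young's inequality for
  \<open>g x / \<sigma>\<close> and \<open>c * deviation y r x\<close>, with the exponential
  integral supplied by John--Nirenberg.\<close>

lemma Hoelder_LlogL:
  assumes r: "0 < r" and g [measurable]: "g \<in> borel_measurable lebesgue" and g0: "\<And>x. 0 \<le> g x"
  shows "(\<integral>\<^sup>+x\<in>ball y r. ennreal (deviation y r x * g x) \<partial>weighted v)
    \<le> ennreal (Hoelder_const * vol y r) * LlogL_norm v (ball y r) g"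
proof (rule le_LlogL_norm[OF r])
  show "0 < Hoelder_const * vol y r"
    using Hoelder_const_pos vol_pos[OF r] by simp
  fix \<sigma> assume "admissible g y r \<sigma>"
  then have \<sigma>: "0 < \<sigma>" "(\<integral>\<^sup>+x\<in>ball y r. ennreal (Phi (g x / \<sigma>) * v x) \<partial>lebesgue) \<le> ennreal (vol y r)"
    using g0 by (simp_all add: admissible_def)
  let ?e = "\<lambda>x. exp (c * norm (b x - ball_mean b (ball y r)))"
  have "(\<integral>\<^sup>+x\<in>ball y r. ennreal (deviation y r x * g x) \<partial>weighted v)
      \<le> (\<integral>\<^sup>+x. ennreal (\<sigma> / c) * (ennreal (Phi (g x / \<sigma>)) * indicator (ball y r) x
          + ennreal (exp c) * (ennreal (?e x) * indicator (ball y r) x)) \<partial>weighted v)"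
  proof (intro nn_integral_mono)
    fix x
    have "(g x / \<sigma>) * (c * deviation y r x) \<le> Phi (g x / \<sigma>) + exp (c * deviation y r x)"
      using g0 \<sigma> by (intro Young_exp_Phi) auto
    also have "exp (c * deviation y r x) = exp c * ?e x"
      by (simp add: deviation_def ring_distribs exp_add)
    finally have "(\<sigma> / c) * ((g x / \<sigma>) * (c * deviation y r x)) \<le> (\<sigma> / c) * (Phi (g x / \<sigma>) + exp c * ?e x)"
      using \<sigma> c_pos by (intro mult_left_mono) auto
    moreover have "(\<sigma> / c) * ((g x / \<sigma>) * (c * deviation y r x)) = deviation y r x * g x"
      using \<sigma> c_pos by simp
    ultimately have "ennreal (deviation y r x * g x) \<le> ennreal ((\<sigma> / c) * (Phi (g x / \<sigma>) + exp c * ?e x))"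
      by (intro ennreal_leI) simp
    also have "\<dots> = ennreal (\<sigma> / c) * (ennreal (Phi (g x / \<sigma>)) + ennreal (exp c) * ennreal (?e x))"
    proof -
      have "0 \<le> Phi (g x / \<sigma>)" using \<sigma> g0 by (simp add: Phi_nonneg)
      then show ?thesis using \<sigma> c_pos by (simp flip: ennreal_mult ennreal_plus)
    qed
    finally show "ennreal (deviation y r x * g x) * indicator (ball y r) x \<le>
        ennreal (\<sigma> / c) * (ennreal (Phi (g x / \<sigma>)) * indicator (ball y r) x
          + ennreal (exp c) * (ennreal (?e x) * indicator (ball y r) x))"
      by (auto simp: indicator_def)
  qed
  also have "\<dots> = ennreal (\<sigma> / c) * ((\<integral>\<^sup>+x\<in>ball y r. ennreal (Phi (g x / \<sigma>)) \<partial>weighted v)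
      + ennreal (exp c) * (\<integral>\<^sup>+x\<in>ball y r. ennreal (?e x) \<partial>weighted v))"
    by (simp add: nn_integral_cmult nn_integral_add)
  also have "(\<integral>\<^sup>+x\<in>ball y r. ennreal (Phi (g x / \<sigma>)) \<partial>weighted v)
      = (\<integral>\<^sup>+x\<in>ball y r. ennreal (Phi (g x / \<sigma>) * v x) \<partial>lebesgue)"
    by (subst nn_integral_weighted, measurable) (use \<sigma> g0 in \<open>simp add: ennreal_mult Phi_nonneg mult_ac\<close>)
  also have "ennreal (\<sigma> / c) * ((\<integral>\<^sup>+x\<in>ball y r. ennreal (Phi (g x / \<sigma>) * v x) \<partial>lebesgue)
      + ennreal (exp c) * (\<integral>\<^sup>+x\<in>ball y r. ennreal (?e x) \<partial>weighted v))
      \<le> ennreal (\<sigma> / c) * (ennreal (vol y r) + ennreal (exp c) * ennreal (K * vol y r))"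
    by (intro mult_left_mono add_mono \<sigma> John_Nirenberg r) auto
  also have "\<dots> = ennreal (\<sigma> / c * (vol y r + exp c * (K * vol y r)))"
    using \<sigma> c_pos K_pos by (simp flip: ennreal_mult ennreal_plus)
  also have "\<sigma> / c * (vol y r + exp c * (K * vol y r)) = Hoelder_const * vol y r * \<sigma>"
    by (simp add: Hoelder_const_def algebra_simps add_divide_distrib)
  finally show "(\<integral>\<^sup>+x\<in>ball y r. ennreal (deviation y r x * g x) \<partial>weighted v) \<le> ennreal (Hoelder_const * vol y r * \<sigma>)" .
qed

text \<open>The sum of a deviation and a difference of means becomes a product because deviations
  and the ratio of measures are at least 1.\<close>

lemma deviation_change_radius:
  assumes "0 < r" "r \<le> R" "0 < p" "p < 1"
  shows "deviation y r x \<le> 3 * dev_const p * (vol y R / vol y r) powr p * deviation y R x"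
proof -
  let ?d = "norm (ball_mean b (ball y r) - ball_mean b (ball y R))" and ?q = "(vol y R / vol y r) powr p"
  have sub: "ball y r \<subseteq> ball y R" using assms by (intro ball_subset_ballI) simp
  have "1 \<le> ?q"
    using vol_pos[of r y] vol_mono[OF sub] assms by (intro ge_one_powr_ge_zero) auto
  then have q: "1 \<le> dev_const p * ?q"
    using dev_const_ge_1[OF assms(3)] mult_mono[of 1 "dev_const p" 1 ?q] by simp
  have "deviation y r x \<le> deviation y R x + ?d"
    using norm_triangle_ineq4[of "b x - ball_mean b (ball y R)" "ball_mean b (ball y r) - ball_mean b (ball y R)"]
    by (simp add: deviation_def)
  also have "\<dots> \<le> 1 * deviation y R x + (2 * dev_const p * ?q) * 1"
    using mean_difference[OF assms(1) _ sub assms(3,4)] assms by simp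
  also have "\<dots> \<le> (dev_const p * ?q) * deviation y R x + (2 * dev_const p * ?q) * deviation y R x"
    using q deviation_ge_1[of y R x] dev_const_ge_1[OF assms(3)] by (intro add_mono mult_mono) auto
  finally show ?thesis by (simp add: algebra_simps)
qed

text \<open>\<open>x \<le> exp x\<close> at \<open>x = c * deviation y r x / s\<close>, raised to
  the power \<open>s\<close>, bounds any power of the deviation by its exponential.\<close>

lemma deviation_power_integral:
  assumes r: "0 < r" and s: "0 < s"
  shows "(\<integral>\<^sup>+x\<in>ball y r. ennreal (deviation y r x powr s) \<partial>weighted v) \<le> ennreal ((s / c) powr s * exp c * K * vol y r)"
proof -
  let ?e = "\<lambda>x. exp (c * norm (b x - ball_mean b (ball y r)))"
  have "(\<integral>\<^sup>+x\<in>ball y r. ennreal (deviation y r x powr s) \<partial>weighted v)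
      \<le> (\<integral>\<^sup>+x. ennreal ((s / c) powr s * exp c) * (ennreal (?e x) * indicator (ball y r) x) \<partial>weighted v)"
  proof (intro nn_integral_mono)
    fix x
    have "c * deviation y r x / s \<le> exp (c * deviation y r x / s)"
      using exp_ge_add_one_self[of "c * deviation y r x / s"] by linarith
    then have "deviation y r x \<le> (s / c) * exp (c * deviation y r x / s)"
      using c_pos s by (simp add: field_simps)
    then have "deviation y r x powr s \<le> ((s / c) * exp (c * deviation y r x / s)) powr s"
      using s by (intro powr_mono2) auto
    also have "\<dots> = (s / c) powr s * exp (c * deviation y r x)"
      using c_pos s by (subst powr_mult) (auto simp: powr_def[of "exp _"])
    also have "exp (c * deviation y r x) = exp c * ?e x"
      by (simp add: deviation_def ring_distribs exp_add)
    finally show "ennreal (deviation y r x powr s) * indicator (ball y r) x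
        \<le> ennreal ((s / c) powr s * exp c) * (ennreal (?e x) * indicator (ball y r) x)"
      by (auto simp: indicator_def mult.assoc simp flip: ennreal_mult intro!: ennreal_leI)
  qed
  also have "\<dots> = ennreal ((s / c) powr s * exp c) * (\<integral>\<^sup>+x\<in>ball y r. ennreal (?e x) \<partial>weighted v)"
    by (intro nn_integral_cmult) measurable
  also have "\<dots> \<le> ennreal ((s / c) powr s * exp c) * ennreal (K * vol y r)"
    by (intro mult_left_mono John_Nirenberg r) auto
  also have "\<dots> = ennreal ((s / c) powr s * exp c * K * vol y r)"
    using K_pos by (simp add: mult.assoc flip: ennreal_mult)
  finally show ?thesis .
qed

end

section \<open>The far part: shells and Chebyshev's inequality\<close>

context commutator_setting
begin

lemma q_pos: "0 < q"
  using gamma by (subst q_def) auto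

definition far_const :: "real \<Rightarrow> real" where
  "far_const p = Co powr \<kappa> * (om.D ^ 3) powr \<kappa> * (3 * om.dev_const p) * W.Hoelder_const"

lemma far_const_pos: "0 < p \<Longrightarrow> 0 < far_const p"
  using om.C_pos om.D_ge_1 om.dev_const_ge_1[of p] W.Hoelder_const_pos by (simp add: far_const_def)

text \<open>All dependence on \<open>x\<close> is pushed into the single factor
  \<open>om.deviation y0 r x\<close>, which prepares Chebyshev's inequality. In the shell of
  \<open>y\<close> the kernel is compared with the measure of a ball about \<open>y0\<close>, the
  deviation at \<open>y\<close> is recentered at that larger ball, and Hoelder's inequality is
  applied there.\<close>

lemma far_pointwise:
  assumes r: "0 < r" and p: "0 < p" "p < 1" and x: "x \<in> ball y0 r"
    and g [measurable]: "g \<in> borel_measurable lebesgue" and g0: "\<And>x. 0 \<le> g x"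
  shows "(\<integral>\<^sup>+y\<in>- ball y0 (2 * r). ennreal (comm_kernel g x y) \<partial>lebesgue) \<le> ennreal (om.deviation y0 r x) *
    (\<Sum>j. ennreal (far_const p * om.vol y0 (2 ^ (j + 2) * r) powr - \<kappa> * (om.vol y0 (2 ^ (j + 2) * r) / om.vol y0 r) powr p
      * W.vol y0 (2 ^ (j + 2) * r)) * LlogL_norm w (ball y0 (2 ^ (j + 2) * r)) g)"
proof -
  \<comment> \<open>A point of the \<open>j\<close>-th shell has distance less than
    \<open>2 ^ Suc j * (2 * r)\<close>, that is \<open>2 ^ (j + 2) * r\<close>, from
    \<open>y0\<close>.\<close>
  define \<rho> where "\<rho> j = 2 ^ (j + 2) * r" for j :: nat
  have \<rho>: "0 < \<rho> j" "r \<le> \<rho> j" for j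
  proof -
    show "0 < \<rho> j" using r by (simp add: \<rho>_def)
    have "1 * r \<le> 2 ^ (j + 2) * r" using r by (intro mult_right_mono one_le_power) auto
    then show "r \<le> \<rho> j" by (simp add: \<rho>_def)
  qed
  define c1 where "c1 j = Co powr \<kappa> * (om.D ^ 3) powr \<kappa> * om.vol y0 (\<rho> j) powr - \<kappa>" for j
  define c2 where "c2 j = 3 * om.dev_const p * (om.vol y0 (\<rho> j) / om.vol y0 r) powr p" for j
  have c1: "0 \<le> c1 j" for j by (simp add: c1_def)
  have c2: "0 \<le> c2 j" for j using om.dev_const_ge_1[OF p(1)] by (simp add: c2_def)
  let ?u = "om.deviation y0 r x"
  let ?G = "\<lambda>j y. ennreal (c1 j * c2 j) * (ennreal (w y) * (ennreal (om.deviation y0 (\<rho> j) y * g y) * indicator (ball y0 (\<rho> j)) y))"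
  have "(\<integral>\<^sup>+y\<in>- ball y0 (2 * r). ennreal (comm_kernel g x y) \<partial>lebesgue) \<le> (\<integral>\<^sup>+y. ennreal ?u * (\<Sum>j. ?G j y) \<partial>lebesgue)"
  proof (rule nn_integral_mono_AE)
    show "AE y in lebesgue. ennreal (comm_kernel g x y) * indicator (- ball y0 (2 * r)) y \<le> ennreal ?u * (\<Sum>j. ?G j y)"
      using kernel_size
    proof eventually_elim
      case (elim y)
      show ?case
      proof (cases "y \<in> ball y0 (2 * r)")
        case False
        then have "2 * r \<le> dist y0 y" by simp
        then obtain j where j: "2 ^ j * (2 * r) \<le> dist y0 y" "dist y0 y < 2 ^ Suc j * (2 * r)"
          using exists_dyadic_scale_above[of "2 * r"] r by auto
        have yj: "y \<in> ball y0 (\<rho> j)" using j(2) by (simp add: \<rho>_def)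
        let ?t = "2 ^ j * r"
        have tr: "r \<le> ?t" using r by (simp add: mult_le_cancel_right1)
        have t0: "0 < ?t" using r by simp
        have dx: "dist y0 x < r" using x by simp
        have "?t \<le> norm (x - y)"
        proof -
          have "dist y0 y \<le> dist y0 x + dist x y" by (rule dist_triangle)
          moreover have "2 ^ j * (2 * r) = 2 * ?t" by simp
          ultimately have "?t \<le> dist x y" using j(1) dx tr by linarith
          then show ?thesis by (simp add: dist_norm)
        qed
        then have "riesz_kernel \<gamma> x y \<le> ?t powr - (real CARD('n) - \<gamma>)"
          using r gamma by (intro riesz_kernel_le) auto
        also have "\<dots> \<le> Co powr \<kappa> * w y * om.vol y ?t powr - \<kappa>"
          using elim r by simp
        also have "\<dots> \<le> Co powr \<kappa> * w y * ((om.D ^ 3) powr \<kappa> * om.vol y0 (\<rho> j) powr - \<kappa>)"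
        proof (intro mult_left_mono)
          have V: "0 < om.vol y0 (\<rho> j)" using \<rho> by (intro om.vol_pos)
          have "om.vol y0 (\<rho> j) \<le> om.D ^ 3 * om.vol y ?t"
          proof (rule om.vol_le_doubling[OF t0])
            have "dist y y0 < 4 * ?t" "\<rho> j = 4 * ?t"
              using j(2) by (simp_all add: \<rho>_def dist_commute)
            then have "dist y y0 + \<rho> j \<le> 8 * ?t"
              by linarith
            also have "8 * ?t = 2 ^ 3 * ?t" by simp
            finally show "ball y0 (\<rho> j) \<subseteq> ball y (2 ^ 3 * ?t)"
              by (rule ball_subset_ballI)
          qed
          then have "om.vol y0 (\<rho> j) / om.D ^ 3 \<le> om.vol y ?t"
            using om.D_ge_1 by (simp add: divide_le_eq mult.commute)
          then have "om.vol y ?t powr - \<kappa> \<le> (om.vol y0 (\<rho> j) / om.D ^ 3) powr - \<kappa>"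
            using V om.D_ge_1 kappa by (intro powr_mono2') auto
          also have "\<dots> = (om.D ^ 3) powr \<kappa> * om.vol y0 (\<rho> j) powr - \<kappa>"
            using V om.D_ge_1 by (simp add: powr_divide powr_minus field_simps)
          finally show "om.vol y ?t powr - \<kappa> \<le> (om.D ^ 3) powr \<kappa> * om.vol y0 (\<rho> j) powr - \<kappa>" .
        qed auto
        also have "\<dots> = c1 j * w y" by (simp add: c1_def)
        finally have kb: "riesz_kernel \<gamma> x y \<le> c1 j * w y" .
        have "norm (b x - b y) \<le> ?u * om.deviation y0 r y"
          by (rule norm_diff_le_deviation)
        also have "\<dots> \<le> ?u * (c2 j * om.deviation y0 (\<rho> j) y)"
          unfolding c2_def using r \<rho> p by (intro mult_left_mono om.deviation_change_radius) auto
        finally have "comm_kernel g x y \<le> (?u * (c2 j * om.deviation y0 (\<rho> j) y)) * (c1 j * w y) * g y"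
          unfolding comm_kernel_def using kb g0 c1 c2 by (intro mult_mono mult_right_mono) auto
        also have "\<dots> = ?u * ((c1 j * c2 j) * (w y * (om.deviation y0 (\<rho> j) y * g y)))"
          by (simp only: mult_ac)
        finally have "ennreal (comm_kernel g x y) \<le> ennreal (?u * ((c1 j * c2 j) * (w y * (om.deviation y0 (\<rho> j) y * g y))))"
          by (rule ennreal_leI)
        also have "\<dots> = ennreal ?u * ?G j y"
          using yj g0 c1 c2 by (simp add: ennreal_mult)
        also have "\<dots> \<le> ennreal ?u * (\<Sum>j. ?G j y)"
          by (intro mult_left_mono ennreal_le_suminf) auto
        finally show ?thesis
          using False by simp
      qed simp
    qed
  qed
  also have "\<dots> = ennreal ?u * (\<integral>\<^sup>+y. (\<Sum>j. ?G j y) \<partial>lebesgue)"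
    by (intro nn_integral_cmult) measurable
  also have "(\<integral>\<^sup>+y. (\<Sum>j. ?G j y) \<partial>lebesgue) = (\<Sum>j. \<integral>\<^sup>+y. ?G j y \<partial>lebesgue)"
    by (intro nn_integral_suminf) measurable
  also have "\<dots> \<le> (\<Sum>j. ennreal (far_const p * om.vol y0 (\<rho> j) powr - \<kappa> * (om.vol y0 (\<rho> j) / om.vol y0 r) powr p
      * W.vol y0 (\<rho> j)) * LlogL_norm w (ball y0 (\<rho> j)) g)"
  proof (intro suminf_le)
    fix j
    have "(\<integral>\<^sup>+y. ?G j y \<partial>lebesgue) = ennreal (c1 j * c2 j) * (\<integral>\<^sup>+y\<in>ball y0 (\<rho> j). ennreal (om.deviation y0 (\<rho> j) y * g y) \<partial>weighted w)"
      by (subst nn_integral_cmult, measurable, subst W.nn_integral_weighted, measurable)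
    also have "\<dots> \<le> ennreal (c1 j * c2 j) * (ennreal (W.Hoelder_const * W.vol y0 (\<rho> j)) * LlogL_norm w (ball y0 (\<rho> j)) g)"
      using W.Hoelder_LlogL[OF \<rho>(1) g g0] by (intro mult_left_mono) auto
    also have "\<dots> = ennreal (c1 j * c2 j * (W.Hoelder_const * W.vol y0 (\<rho> j))) * LlogL_norm w (ball y0 (\<rho> j)) g"
    proof -
      have "ennreal (c1 j * c2 j * (W.Hoelder_const * W.vol y0 (\<rho> j)))
          = ennreal (c1 j * c2 j) * ennreal (W.Hoelder_const * W.vol y0 (\<rho> j))"
        using c1 c2 W.Hoelder_const_pos by (intro ennreal_mult) auto
      then show ?thesis by (simp only: mult.assoc)
    qed
    also have "c1 j * c2 j * (W.Hoelder_const * W.vol y0 (\<rho> j)) =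
        far_const p * om.vol y0 (\<rho> j) powr - \<kappa> * (om.vol y0 (\<rho> j) / om.vol y0 r) powr p * W.vol y0 (\<rho> j)"
      unfolding c1_def c2_def far_const_def by (simp only: mult_ac)
    finally show "(\<integral>\<^sup>+y. ?G j y \<partial>lebesgue) \<le> ennreal (far_const p * om.vol y0 (\<rho> j) powr - \<kappa> * (om.vol y0 (\<rho> j) / om.vol y0 r) powr p
      * W.vol y0 (\<rho> j)) * LlogL_norm w (ball y0 (\<rho> j)) g" .
  qed auto
  finally show ?thesis
    by (simp add: \<rho>_def mult_left_mono)
qed

definition cheb_const :: real where
  "cheb_const = ((q / co) powr q * exp co * Ko) powr \<kappa>"

lemma cheb_const_pos: "0 < cheb_const"
  using q_pos om.c_pos om.K_pos by (simp add: cheb_const_def)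

text \<open>Chebyshev's inequality with exponent \<open>q\<close>; the corresponding moment of the
  deviation is finite by exponential integrability. An infinite \<open>S\<close> makes the right
  side infinite.\<close>

lemma far_level_set:
  assumes r: "0 < r" and E [measurable]: "E \<in> sets lebesgue" and EB: "E \<subseteq> ball y0 r" and l: "0 < l"
    and big: "\<And>x. x \<in> E \<Longrightarrow> ennreal l \<le> ennreal (om.deviation y0 r x) * S"
  shows "ennreal (measure \<omega> E powr \<kappa>) \<le> ennreal (cheb_const * om.vol y0 r powr \<kappa> / l) * S"
proof (cases S)
  case top
  then show ?thesis
    using cheb_const_pos om.vol_pos[OF r, of y0] l by (simp add: ennreal_mult_top)
next
  case (real s)
  then have s: "S = ennreal s" "0 \<le> s" by auto
  let ?M = "(q / co) powr q * exp co * Ko"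
  have M: "0 < ?M" using q_pos om.c_pos om.K_pos by simp
  have eE: "emeasure \<omega> E = ennreal (measure \<omega> E)"
    by (rule emeasure_eq_measure_fin) (rule om.emeasure_bounded_fin[OF EB])
  have "ennreal (l powr q) * ennreal (measure \<omega> E) = (\<integral>\<^sup>+x\<in>E. ennreal (l powr q) \<partial>\<omega>)"
    by (simp add: nn_integral_cmult eE)
  also have "\<dots> \<le> (\<integral>\<^sup>+x. ennreal (s powr q) * (ennreal (om.deviation y0 r x powr q) * indicator (ball y0 r) x) \<partial>\<omega>)"
  proof (intro nn_integral_mono)
    fix x
    have "l powr q \<le> s powr q * om.deviation y0 r x powr q" if "x \<in> E"
    proof -
      have "ennreal l \<le> ennreal (om.deviation y0 r x * s)"
        using big[OF that] s by (simp add: ennreal_mult)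
      then have "l \<le> om.deviation y0 r x * s"
        using s by (subst (asm) ennreal_le_iff) auto
      then have "l powr q \<le> (om.deviation y0 r x * s) powr q"
        using l q_pos by (intro powr_mono2) auto
      then show ?thesis
        using s by (simp add: powr_mult mult.commute)
    qed
    then show "ennreal (l powr q) * indicator E x \<le> ennreal (s powr q) * (ennreal (om.deviation y0 r x powr q) * indicator (ball y0 r) x)"
      using EB by (auto simp: indicator_def simp flip: ennreal_mult intro!: ennreal_leI)
  qed
  also have "\<dots> = ennreal (s powr q) * (\<integral>\<^sup>+x\<in>ball y0 r. ennreal (om.deviation y0 r x powr q) \<partial>\<omega>)"
    by (intro nn_integral_cmult) measurable
  also have "\<dots> \<le> ennreal (s powr q) * ennreal (?M * om.vol y0 r)"
    using om.deviation_power_integral[OF r q_pos] by (intro mult_left_mono) auto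
  finally have "l powr q * measure \<omega> E \<le> s powr q * (?M * om.vol y0 r)"
    using M by (intro ennreal_mult_le_multD) auto
  then have "(l powr q * measure \<omega> E) powr \<kappa> \<le> (s powr q * (?M * om.vol y0 r)) powr \<kappa>"
    using kappa by (intro powr_mono2) auto
  then have "l * measure \<omega> E powr \<kappa> \<le> s * (cheb_const * om.vol y0 r powr \<kappa>)"
    using l s M by (simp add: powr_mult powr_powr kappa cheb_const_def del: mult_pos_pos)
  then have "measure \<omega> E powr \<kappa> \<le> cheb_const * om.vol y0 r powr \<kappa> / l * s"
    using l by (simp add: field_simps)
  then show ?thesis
    unfolding s(1) using s(2) l cheb_const_pos by (simp add: ennreal_leI flip: ennreal_mult)
qed

end

section \<open>Powers and norms with values in the extended reals\<close>

lemma epowr_ennreal: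
  assumes "0 < x"
  shows "epowr (ennreal x) p = ennreal (x powr p)"
  using assms by (simp add: epowr_def ennreal_eq_0_iff)

lemma epowr_ennreal_nonneg:
  assumes "0 \<le> x" "0 < p"
  shows "epowr (ennreal x) p = ennreal (x powr p)"
  using assms by (cases "x = 0") (simp_all add: epowr_ennreal epowr_def)

lemma epowr_0 [simp]: "0 < p \<Longrightarrow> epowr 0 p = 0"
  and epowr_top [simp]: "0 < p \<Longrightarrow> epowr top p = top"
  by (simp_all add: epowr_def)

lemma epowr_mono:
  assumes p: "0 < p" and le: "x \<le> y"
  shows "epowr x p \<le> epowr y p"
proof (cases y)
  case (real b)
  with le obtain a where "x = ennreal a" "0 \<le> a" "a \<le> b"
    by (cases x) (auto simp: top_unique)
  with real p show ?thesis
    by (simp add: epowr_ennreal_nonneg powr_mono2 ennreal_leI)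
qed (use p in simp)

lemma epowr_mult:
  assumes p: "0 < p"
  shows "epowr (x * y) p = epowr x p * epowr y p"
proof -
  have top: "epowr (top * z) p = top * epowr z p" for z
  proof (cases "z = 0")
    case False
    have "epowr z p \<noteq> 0"
      using False p by (cases z) (auto simp: epowr_ennreal_nonneg)
    with False p show ?thesis
      by (simp add: ennreal_top_mult)
  qed (use p in simp)
  show ?thesis
  proof (cases x)
    case (real a)
    show ?thesis
    proof (cases y)
      case (real b)
      with \<open>x = ennreal a\<close> \<open>0 \<le> a\<close> p show ?thesis
        by (simp add: epowr_ennreal_nonneg powr_mult flip: ennreal_mult)
    next
      case top
      then show ?thesis
        using \<open>epowr (top * x) p = top * epowr x p\<close> p by (simp add: mult.commute)
    qed
  next
    case top
    then show ?thesis
      using \<open>epowr (top * y) p = top * epowr y p\<close> p by simp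
  qed
qed

lemma epowr_epowr_inverse:
  assumes p: "0 < p"
  shows "epowr (epowr x p) (1 / p) = x" "epowr (epowr x (1 / p)) p = x"
proof -
  show "epowr (epowr x p) (1 / p) = x"
    using p by (cases x) (simp_all add: epowr_ennreal_nonneg powr_powr)
  show "epowr (epowr x (1 / p)) p = x"
    using p by (cases x) (simp_all add: epowr_ennreal_nonneg powr_powr)
qed

lemma measurable_epowr [measurable]: "(\<lambda>x. epowr x p) \<in> borel_measurable borel"
  unfolding epowr_def by measurable

lemma suminf_ennreal_geometric_mult:
  assumes "0 \<le> x" "0 \<le> t" "t < 1"
  shows "(\<Sum>i. ennreal (x * t ^ i) * X) = ennreal (x / (1 - t)) * X"
  unfolding mult.commute[of _ X] ennreal_suminf_cmult suminf_ennreal_geometric[OF assms] ..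

text \<open>Minkowski's inequality is avoided: half of the geometric decay makes the series a
  supremum, which is dominated by an \<open>l^p\<close> sum.\<close>

lemma nn_integral_epowr_geometric:
  assumes p: "0 < p" and M: "0 < M" and t: "0 < t" "t < 1"
    and G [measurable]: "\<And>j. G j \<in> borel_measurable L" and [measurable]: "\<mu> \<in> borel_measurable L"
    and F: "\<And>y. F y \<le> (\<Sum>j. ennreal (M * t ^ j) * G j y)"
    and N: "\<And>j. epowr (\<integral>\<^sup>+y. epowr (G j y) p * \<mu> y \<partial>L) (1 / p) \<le> N"
  shows "epowr (\<integral>\<^sup>+y. epowr (F y) p * \<mu> y \<partial>L) (1 / p)
    \<le> ennreal (M / (1 - sqrt t) * (1 / (1 - sqrt t powr p)) powr (1 / p)) * N"
proof -
  define s where "s = sqrt t"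
  have s: "0 < s" "s < 1" "t = s * s" using t by (auto simp: s_def)
  have sp: "0 \<le> s powr p" "s powr p < 1"
    using s p powr_less_mono2[of p s 1] by auto
  define Z where "Z y = (\<Sum>j. epowr (ennreal (s ^ j) * G j y) p)" for y
  have [measurable]: "Z \<in> borel_measurable L" unfolding Z_def by measurable
  define c where "c = M / (1 - s)"
  have c: "0 < c" using M s by (simp add: c_def)
  have Fp: "epowr (F y) p \<le> ennreal (c powr p) * Z y" for y
  proof -
    have term_le: "ennreal (s ^ j) * G j y \<le> epowr (Z y) (1 / p)" for j
    proof -
      have "epowr (ennreal (s ^ j) * G j y) p \<le> Z y"
        unfolding Z_def by (rule ennreal_le_suminf)
      then have "epowr (epowr (ennreal (s ^ j) * G j y) p) (1 / p) \<le> epowr (Z y) (1 / p)"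
        using p by (intro epowr_mono) auto
      then show ?thesis using p by (simp only: epowr_epowr_inverse)
    qed
    have "F y \<le> (\<Sum>j. ennreal (M * t ^ j) * G j y)" by (rule F)
    also have "\<dots> = (\<Sum>j. ennreal (M * s ^ j) * (ennreal (s ^ j) * G j y))"
      using M s by (simp add: power_mult_distrib mult.assoc[symmetric] flip: ennreal_mult)
    also have "\<dots> \<le> (\<Sum>j. ennreal (M * s ^ j) * epowr (Z y) (1 / p))"
      using term_le by (intro suminf_le mult_left_mono) auto
    also have "\<dots> = ennreal c * epowr (Z y) (1 / p)"
      unfolding c_def using M s by (intro suminf_ennreal_geometric_mult) auto
    finally have "epowr (F y) p \<le> epowr (ennreal c * epowr (Z y) (1 / p)) p"
      using p by (intro epowr_mono)
    also have "\<dots> = ennreal (c powr p) * Z y"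
      using p c by (simp only: epowr_mult epowr_epowr_inverse epowr_ennreal)
    finally show ?thesis .
  qed
  have term_int: "(\<integral>\<^sup>+y. epowr (ennreal (s ^ j) * G j y) p * \<mu> y \<partial>L) \<le> ennreal (1 * (s powr p) ^ j) * epowr N p" for j
  proof -
    have sj: "(s ^ j) powr p = (s powr p) ^ j"
      using s by (simp add: powr_realpow[symmetric] powr_powr powr_power mult.commute)
    have "(\<integral>\<^sup>+y. epowr (ennreal (s ^ j) * G j y) p * \<mu> y \<partial>L) = ennreal ((s powr p) ^ j) * (\<integral>\<^sup>+y. epowr (G j y) p * \<mu> y \<partial>L)"
      using p s by (simp add: epowr_mult epowr_ennreal sj mult.assoc nn_integral_cmult)
    also have "(\<integral>\<^sup>+y. epowr (G j y) p * \<mu> y \<partial>L) \<le> epowr N p"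
    proof -
      have "epowr (epowr (\<integral>\<^sup>+y. epowr (G j y) p * \<mu> y \<partial>L) (1 / p)) p \<le> epowr N p"
        using p N by (intro epowr_mono)
      then show ?thesis using p by (simp only: epowr_epowr_inverse)
    qed
    finally show ?thesis by (simp add: mult_left_mono)
  qed
  have "(\<integral>\<^sup>+y. epowr (F y) p * \<mu> y \<partial>L) \<le> (\<integral>\<^sup>+y. ennreal (c powr p) * (\<Sum>j. epowr (ennreal (s ^ j) * G j y) p * \<mu> y) \<partial>L)"
  proof (intro nn_integral_mono)
    fix y
    have "epowr (F y) p * \<mu> y \<le> ennreal (c powr p) * Z y * \<mu> y"
      using Fp by (intro mult_right_mono) auto
    then show "epowr (F y) p * \<mu> y \<le> ennreal (c powr p) * (\<Sum>j. epowr (ennreal (s ^ j) * G j y) p * \<mu> y)"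
      by (simp add: Z_def mult.assoc)
  qed
  also have "\<dots> = ennreal (c powr p) * (\<Sum>j. \<integral>\<^sup>+y. epowr (ennreal (s ^ j) * G j y) p * \<mu> y \<partial>L)"
    by (subst nn_integral_cmult, measurable, subst nn_integral_suminf, measurable)
  also have "\<dots> \<le> ennreal (c powr p) * (\<Sum>j. ennreal (1 * (s powr p) ^ j) * epowr N p)"
    using term_int by (intro mult_left_mono suminf_le) auto
  also have "\<dots> = ennreal (c powr p) * (ennreal (1 / (1 - s powr p)) * epowr N p)"
    using sp by (subst suminf_ennreal_geometric_mult) auto
  finally have "epowr (\<integral>\<^sup>+y. epowr (F y) p * \<mu> y \<partial>L) (1 / p)
      \<le> epowr (ennreal (c powr p) * (ennreal (1 / (1 - s powr p)) * epowr N p)) (1 / p)"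
    using p by (intro epowr_mono) auto
  also have "\<dots> = ennreal c * (ennreal ((1 / (1 - s powr p)) powr (1 / p)) * N)"
  proof -
    have "epowr (ennreal (1 / (1 - s powr p))) (1 / p) = ennreal ((1 / (1 - s powr p)) powr (1 / p))"
      using sp by (intro epowr_ennreal) auto
    moreover have "epowr (ennreal (c powr p)) (1 / p) = ennreal c"
      using c p by (simp add: epowr_ennreal powr_powr)
    ultimately show ?thesis
      using p by (simp only: epowr_mult[of "1 / p"] epowr_epowr_inverse zero_less_divide_1_iff)
  qed
  also have "\<dots> = ennreal (c * (1 / (1 - s powr p)) powr (1 / p)) * N"
    using c by (simp add: mult.assoc[symmetric] flip: ennreal_mult)
  finally show ?thesis by (simp only: c_def s_def)
qed

lemma recip_ennreal: "0 < p \<Longrightarrow> recip (ennreal p) = 1 / p"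
proof -
  assume p: "0 < p"
  then have "1 / ennreal p = ennreal (1 / p)"
    using divide_ennreal[of 1 p] by simp
  then show ?thesis using p by (simp add: recip_def)
qed

text \<open>\<open>C\<close> is fixed before \<open>F\<close>, \<open>G\<close> and
  \<open>N\<close>, as level, radius and function will vary. For finite \<open>s\<close>
  measurability of \<open>G\<close> allows integrating the series term by term; for infinite
  \<open>s\<close> that of \<open>F\<close> matters, because \<open>esssup\<close> of a
  nonmeasurable function is infinite.\<close>

lemma Ls_norm_geometric:
  fixes G :: "nat \<Rightarrow> real^'n \<Rightarrow> ennreal"
  assumes s: "0 < s" and M: "0 < M" and t: "0 < t" "t < 1" and \<mu>: "\<mu> \<in> borel_measurable lebesgue"
  shows "\<exists>C>0. \<forall>F G N. F \<in> borel_measurable lebesgue \<longrightarrow> (\<forall>j. G j \<in> borel_measurable lebesgue) \<longrightarrow>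
    (\<forall>y. F y \<le> (\<Sum>j. ennreal (M * t ^ j) * G j y)) \<longrightarrow> (\<forall>j. Ls_norm s \<mu> (G j) \<le> N) \<longrightarrow>
    Ls_norm s \<mu> (F :: real^'n \<Rightarrow> ennreal) \<le> ennreal C * N"
proof (cases s)
  case (real p)
  with s have p: "0 < p" by (simp add: less_le)
  let ?C = "M / (1 - sqrt t) * (1 / (1 - sqrt t powr p)) powr (1 / p)"
  have st: "sqrt t < 1" "sqrt t powr p < 1"
    using t p powr_less_mono2[of p "sqrt t" 1] by auto
  then have "0 < ?C" using M by simp
  moreover have "Ls_norm s \<mu> F \<le> ennreal ?C * N"
    if F: "\<forall>y. F y \<le> (\<Sum>j. ennreal (M * t ^ j) * G j y)"
      and G: "\<forall>j. G j \<in> borel_measurable lebesgue" and N: "\<forall>j. Ls_norm s \<mu> (G j) \<le> N" for F G N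
  proof -
    have eq: "Ls_norm s \<mu> H = epowr (\<integral>\<^sup>+y. epowr (H y) p * ennreal (\<mu> y) \<partial>lebesgue) (1 / p)" for H
      using real p by (simp add: Ls_norm_def recip_ennreal)
    show ?thesis
      unfolding eq
      by (rule nn_integral_epowr_geometric[OF p M t, where G = G]) (use G F N \<mu> in \<open>auto simp: eq\<close>)
  qed
  ultimately show ?thesis by blast
next
  case top
  have "Ls_norm s \<mu> F \<le> ennreal (M / (1 - t)) * N"
    if Fm: "F \<in> borel_measurable lebesgue" and F: "\<forall>y. F y \<le> (\<Sum>j. ennreal (M * t ^ j) * G j y)"
      and N: "\<forall>j. Ls_norm s \<mu> (G j) \<le> N" for F G N
  proof -
    let ?D = "density lebesgue (\<lambda>y. ennreal (\<mu> y))"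
    have "AE y in ?D. G j y \<le> N" for j
      using esssup_AE[of "G j" ?D] N top by (auto simp: Ls_norm_def elim!: eventually_mono intro: order_trans)
    then have "AE y in ?D. \<forall>j. G j y \<le> N"
      by (simp add: AE_all_countable)
    then have "AE y in ?D. F y \<le> ennreal (M / (1 - t)) * N"
    proof eventually_elim
      case (elim y)
      have "F y \<le> (\<Sum>j. ennreal (M * t ^ j) * G j y)" using F by blast
      also have "\<dots> \<le> (\<Sum>j. ennreal (M * t ^ j) * N)"
        using elim by (intro suminf_le mult_left_mono) auto
      also have "\<dots> = ennreal (M / (1 - t)) * N"
        using M t by (intro suminf_ennreal_geometric_mult) auto
      finally show ?case .
    qed
    then show ?thesis
      using top Fm by (simp add: Ls_norm_def esssup_I)
  qed
  moreover have "0 < M / (1 - t)" using M t by simp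
  ultimately show ?thesis by blast
qed

section \<open>Measurability in the center of the ball\<close>

text \<open>The indicator of \<open>dist y x < r\<close> is jointly measurable, so the integral is
  measurable in the center by Tonelli's theorem.\<close>

lemma measurable_ball_integral:
  fixes h :: "real^'n \<Rightarrow> ennreal"
  assumes [measurable]: "h \<in> borel_measurable lebesgue"
  shows "(\<lambda>y. \<integral>\<^sup>+x\<in>ball y r. h x \<partial>lebesgue) \<in> borel_measurable lebesgue"
proof -
  have [measurable]: "(\<lambda>z::(real^'n) \<times> (real^'n). h (snd z) * (if dist (fst z) (snd z) < r then 1 else 0))
      \<in> borel_measurable (lebesgue \<Otimes>\<^sub>M lebesgue)"
    by measurable
  have "(\<lambda>y. \<integral>\<^sup>+x. h x * (if dist y x < r then 1 else 0) \<partial>(lebesgue :: (real^'n) measure)) \<in> borel_measurable lebesgue"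
    by (rule sigma_finite_measure.borel_measurable_nn_integral[OF sigma_finite_lebesgue]) (simp add: case_prod_beta)
  moreover have "(\<integral>\<^sup>+x\<in>ball y r. h x \<partial>lebesgue) = (\<integral>\<^sup>+x. h x * (if dist y x < r then 1 else 0) \<partial>lebesgue)" for y
    by (intro nn_integral_cong) (auto simp: indicator_def)
  ultimately show ?thesis by simp
qed

lemma measurable_wmeas_ball:
  fixes v :: "real^'n \<Rightarrow> real"
  assumes [measurable]: "v \<in> borel_measurable lebesgue" "E \<in> sets lebesgue"
  shows "(\<lambda>y. wmeas v {x \<in> ball y r. x \<in> E}) \<in> borel_measurable lebesgue"
proof -
  have "wmeas v {x \<in> ball y r. x \<in> E} = (\<integral>\<^sup>+x\<in>ball y r. (ennreal (v x) * indicator E x) \<partial>lebesgue)" for y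
    unfolding wmeas_def by (intro nn_integral_cong) (auto simp: indicator_def)
  then show ?thesis
    by (simp add: measurable_ball_integral)
qed

lemma measurable_wmeas_ball_UNIV:
  fixes v :: "real^'n \<Rightarrow> real"
  assumes [measurable]: "v \<in> borel_measurable lebesgue"
  shows "(\<lambda>y. wmeas v (ball y r)) \<in> borel_measurable lebesgue"
  unfolding wmeas_def by (intro measurable_ball_integral) measurable

text \<open>Admissibility is monotone in \<open>\<sigma>\<close>, so the norm is below
  \<open>c\<close> exactly when some rational \<open>\<sigma>\<close> below \<open>c\<close> is
  admissible; the set in question is then a countable union of measurable sets.\<close>

lemma (in A1_weight) measurable_LlogL_norm:
  assumes r: "0 < r" and [measurable]: "g \<in> borel_measurable lebesgue"
  shows "(\<lambda>y. LlogL_norm v (ball y r) g) \<in> borel_measurable lebesgue"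
proof (rule borel_measurableI_less)
  fix c :: ennreal
  have "{y \<in> space lebesgue. LlogL_norm v (ball y r) g < c}
      = (\<Union>\<sigma>\<in>{\<sigma> \<in> \<rat>. 0 < \<sigma> \<and> ennreal \<sigma> < c}. {y \<in> space lebesgue. admissible g y r \<sigma>})" (is "?L = ?R")
  proof (intro set_eqI iffI)
    fix y assume "y \<in> ?L"
    then obtain \<sigma>0 where a: "admissible g y r \<sigma>0" and c: "ennreal \<sigma>0 < c"
      by (auto simp: LlogL_norm_eq[OF r] Inf_less_iff)
    have s0: "0 < \<sigma>0" using a by (simp add: admissible_def)
    obtain z where z: "ennreal \<sigma>0 < z" "z < c" using dense[OF c] by blast
    then obtain z' where z': "z = ennreal z'" "0 \<le> z'" by (cases z) auto
    then have "\<sigma>0 < z'" using z(1) s0 by (simp add: ennreal_less_iff)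
    then obtain \<sigma> where \<sigma>: "\<sigma> \<in> \<rat>" "\<sigma>0 < \<sigma>" "\<sigma> < z'" using Rats_dense_in_real by blast
    have "(\<integral>\<^sup>+x\<in>ball y r. ennreal (Phi (\<bar>g x\<bar> / \<sigma>) * v x) \<partial>lebesgue)
        \<le> (\<integral>\<^sup>+x\<in>ball y r. ennreal (Phi (\<bar>g x\<bar> / \<sigma>0) * v x) \<partial>lebesgue)"
      using \<sigma> s0 by (intro nn_integral_mono mult_right_mono ennreal_leI Phi_mono divide_left_mono) auto
    then have "admissible g y r \<sigma>"
      using a \<sigma> s0 by (auto simp: admissible_def)
    moreover have "ennreal \<sigma> < c"
      using \<sigma> s0 z z' by (metis ennreal_leI less_imp_le le_less_trans)
    ultimately show "y \<in> ?R" using \<sigma> s0 by auto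
  next
    fix y assume "y \<in> ?R"
    then show "y \<in> ?L"
      by (auto simp: LlogL_norm_eq[OF r] Inf_less_iff)
  qed
  also have "?R \<in> sets lebesgue"
  proof (intro sets.countable_UN'')
    show "countable {\<sigma> \<in> \<rat>. 0 < \<sigma> \<and> ennreal \<sigma> < c}"
      by (rule countable_subset[OF _ countable_rat]) auto
    fix \<sigma>
    have [measurable]: "(\<lambda>y. \<integral>\<^sup>+x\<in>ball y r. ennreal (Phi (\<bar>g x\<bar> / \<sigma>) * v x) \<partial>lebesgue) \<in> borel_measurable lebesgue"
      by (intro measurable_ball_integral) measurable
    have [measurable]: "(\<lambda>y. ennreal (vol y r)) \<in> borel_measurable lebesgue"
      unfolding wmeas_ball[symmetric] by (intro measurable_wmeas_ball_UNIV) measurable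
    show "{y \<in> space lebesgue. admissible g y r \<sigma>} \<in> sets lebesgue"
      unfolding admissible_def by measurable
  qed
  finally show "{y \<in> space lebesgue. LlogL_norm v (ball y r) g < c} \<in> sets lebesgue" .
qed

section \<open>Muckenhoupt weights\<close>

lemma weight_measurable: "weight w \<Longrightarrow> w \<in> borel_measurable lebesgue"
  by (simp add: weight_def locally_integrable_measurable)

lemma wmeas_eq_0_iff:
  assumes [measurable]: "v \<in> borel_measurable lebesgue" "E \<in> sets lebesgue" and "\<And>x. 0 \<le> v x"
  shows "wmeas v E = 0 \<longleftrightarrow> (AE x in lebesgue. x \<in> E \<longrightarrow> v x = 0)"
proof -
  have "wmeas v E = 0 \<longleftrightarrow> (AE x in lebesgue. ennreal (v x) * indicator E x = 0)"
    unfolding wmeas_def by (intro nn_integral_0_iff_AE) measurable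
  also have "\<dots> \<longleftrightarrow> (AE x in lebesgue. x \<in> E \<longrightarrow> v x = 0)"
    using assms(3) by (intro AE_cong) (auto simp: indicator_def ennreal_eq_0_iff intro: antisym)
  finally show ?thesis .
qed

lemma not_AE_outside_ball:
  fixes y :: "real^'n"
  assumes "0 < r"
  shows "\<not> (AE x in lebesgue. x \<notin> ball y r)"
proof
  assume "AE x in lebesgue. x \<notin> ball y r"
  then have "emeasure lebesgue (ball y r) = 0"
    by (subst (asm) AE_iff_null_sets[symmetric]) auto
  then show False
    using measure_ball_pos[OF assms, of y] by (simp add: measure_def)
qed

text \<open>A bound on each ball, off a null set depending on the ball, becomes a bound for all balls
  centered at almost every point by passing to rational radii and a countable dense set of centers.\<close>

lemma AE_all_balls:
  fixes X :: "real^'n \<Rightarrow> real \<Rightarrow> ennreal" and h :: "real^'n \<Rightarrow> real"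
  assumes mono: "\<And>y r z R. ball y r \<subseteq> ball z R \<Longrightarrow> X y r \<le> X z R"
    and le: "\<And>y r. 0 < r \<Longrightarrow> AE x in lebesgue. x \<in> ball y r \<longrightarrow> X y r \<le> ennreal (C * r ^ CARD('n) * h x)"
    and C: "0 \<le> C" and h: "\<And>x. 0 \<le> h x"
  shows "AE x in lebesgue. \<forall>r>0. X x r \<le> ennreal (C * 2 ^ CARD('n) * r ^ CARD('n) * h x)"
proof -
  obtain Q :: "(real^'n) set" where Q: "countable Q" "\<And>U. open U \<Longrightarrow> U \<noteq> {} \<Longrightarrow> \<exists>d\<in>Q. d \<in> U"
    using countable_dense_exists by blast
  have "AE x in lebesgue. \<forall>(z, R) \<in> Q \<times> {R \<in> \<rat>. 0 < R}. x \<in> ball z R \<longrightarrow> X z R \<le> ennreal (C * R ^ CARD('n) * h x)"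
  proof (subst AE_ball_countable)
    show "countable (Q \<times> {R::real. R \<in> \<rat> \<and> 0 < R})"
      using Q(1) by (intro countable_SIGMA countable_subset[OF _ countable_rat]) auto
  qed (use le in auto)
  then show ?thesis
  proof eventually_elim
    case (elim x)
    show ?case
    proof (intro allI impI)
      fix r :: real assume r: "0 < r"
      obtain z where z: "z \<in> Q" "z \<in> ball x (r / 2)"
        using Q(2)[of "ball x (r / 2)"] r by auto
      \<comment> \<open>\<open>R > 3 * r / 2\<close> puts \<open>ball x r\<close> inside
        \<open>ball z R\<close>, and \<open>R < 2 * r\<close> limits the loss to
        \<open>2 ^ CARD('n)\<close>.\<close>
      obtain R where R: "R \<in> \<rat>" "3 * r / 2 < R" "R < 2 * r"
        using Rats_dense_in_real[of "3 * r / 2" "2 * r"] r by auto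
      have d: "dist z x < r / 2" using z(2) by (simp add: dist_commute)
      have "X x r \<le> X z R"
        using d R by (intro mono ball_subset_ballI) linarith
      also have "\<dots> \<le> ennreal (C * R ^ CARD('n) * h x)"
      proof -
        have "x \<in> ball z R" using d R r unfolding mem_ball by linarith
        then show ?thesis using elim z(1) R r by force
      qed
      also have "\<dots> \<le> ennreal (C * (2 * r) ^ CARD('n) * h x)"
        using R r C h by (intro ennreal_leI mult_right_mono mult_left_mono power_mono) auto
      finally show "X x r \<le> ennreal (C * 2 ^ CARD('n) * r ^ CARD('n) * h x)"
        by (simp add: power_mult_distrib mult.assoc)
    qed
  qed
qed

text \<open>\<open>weight w\<close> gives local integrability of \<open>w\<close> only. Finiteness
  for \<open>w powr q\<close> follows from the class condition, because
  \<open>1 / ennreal (w x)\<close> never vanishes and an infinite first factor would make the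
  product infinite. Removing the power \<open>1 / q\<close> gives the pointwise bound.\<close>

lemma A1_class_ball_bound:
  fixes w :: "real^'n \<Rightarrow> real"
  assumes A1: "A1_class q w" and q: "1 < q"
  obtains C where "0 < C"
    "\<And>y r. 0 < r \<Longrightarrow> wmeas (\<lambda>x. w x powr q) (ball y r) < \<infinity>"
    "\<And>y r. 0 < r \<Longrightarrow> AE x in lebesgue. x \<in> ball y r \<longrightarrow>
      wmeas (\<lambda>x. w x powr q) (ball y r) \<le> ennreal (C * r ^ CARD('n) * w x powr q)"
proof -
  let ?\<kappa> = "unit_ball_vol (real CARD('n))"
  have w0: "0 \<le> w x" for x using A1 by (simp add: A1_class_def weight_def)
  obtain C where C: "0 < C" and CA: "\<And>y r. 0 < r \<Longrightarrow>
      epowr (wmeas (\<lambda>x. w x powr q) (ball y r) / emeasure lebesgue (ball y r)) (1 / q)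
        * esssup (restrict_space lebesgue (ball y r)) (\<lambda>x. 1 / ennreal (w x)) \<le> ennreal C"
    using A1 unfolding A1_class_def by blast
  have main: "wmeas (\<lambda>x. w x powr q) (ball y r) < \<infinity> \<and> (AE x in lebesgue. x \<in> ball y r \<longrightarrow>
      wmeas (\<lambda>x. w x powr q) (ball y r) \<le> ennreal (C powr q * ?\<kappa> * r ^ CARD('n) * w x powr q))"
    if r: "0 < r" for y :: "real^'n" and r
  proof -
    let ?X = "wmeas (\<lambda>x. w x powr q) (ball y r)"
    define B where "B = measure lebesgue (ball y r)"
    have B: "0 < B" "B = r ^ CARD('n) * ?\<kappa>"
      using measure_ball_pos[OF r, of y] measure_ball_scale[of r y] r by (auto simp: B_def)
    have "AE x in restrict_space lebesgue (ball y r).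
        1 / ennreal (w x) \<le> esssup (restrict_space lebesgue (ball y r)) (\<lambda>x. 1 / ennreal (w x))"
      by (rule esssup_AE)
    then have "AE x in lebesgue. x \<in> ball y r \<longrightarrow>
        1 / ennreal (w x) \<le> esssup (restrict_space lebesgue (ball y r)) (\<lambda>x. 1 / ennreal (w x))"
      by (subst (asm) AE_restrict_space_iff) auto
    then have ae: "AE x in lebesgue. x \<in> ball y r \<longrightarrow> epowr (?X / ennreal B) (1 / q) * (1 / ennreal (w x)) \<le> ennreal C"
    proof eventually_elim
      case (elim x)
      then show ?case
        using CA[OF r, of y] unfolding B_def emeasure_ball_real by (meson mult_left_mono order_trans zero_le)
    qed
    have fin: "?X < \<infinity>"
    proof (rule ccontr)
      assume "\<not> ?X < \<infinity>"
      then have "?X = top" by (simp add: not_less top_unique)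
      then have "epowr (?X / ennreal B) (1 / q) = top"
        using q B by (simp add: ennreal_top_divide)
      with ae have "AE x in lebesgue. x \<notin> ball y r"
        by (auto simp: ennreal_top_mult top_unique elim!: eventually_mono)
      with not_AE_outside_ball[OF r] show False by blast
    qed
    then obtain a where a: "?X = ennreal a" "0 \<le> a" by (cases ?X) auto
    have "AE x in lebesgue. x \<in> ball y r \<longrightarrow> ?X \<le> ennreal (C powr q * ?\<kappa> * r ^ CARD('n) * w x powr q)"
      using ae
    proof eventually_elim
      case (elim x)
      show ?case
      proof
        assume x: "x \<in> ball y r"
        show "?X \<le> ennreal (C powr q * ?\<kappa> * r ^ CARD('n) * w x powr q)"
        proof (cases "a = 0")
          case False
          then have a0: "0 < a" using a by simp
          have "?X / ennreal B = ennreal (a / B)"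
            using a B by (simp add: divide_ennreal)
          then have ep: "epowr (?X / ennreal B) (1 / q) = ennreal ((a / B) powr (1 / q))"
            using a0 B by (simp add: epowr_ennreal)
          \<comment> \<open>At a zero of \<open>w\<close> the reciprocal is infinite, which a
            positive first factor does not allow.\<close>
          have wx: "w x \<noteq> 0"
          proof
            assume "w x = 0"
            then have "ennreal ((a / B) powr (1 / q)) * top \<le> ennreal C"
              using elim x ep by simp
            then show False
              using a0 B(1) by (simp add: ennreal_mult_top top_unique)
          qed
          then have wp: "0 < w x" using w0[of x] by simp
          then have "1 / ennreal (w x) = ennreal (1 / w x)"
            using divide_ennreal[of 1 "w x"] by simp
          then have "ennreal ((a / B) powr (1 / q) * (1 / w x)) \<le> ennreal C"
            using elim x ep wp by (subst ennreal_mult) simp_all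
          then have "(a / B) powr (1 / q) * (1 / w x) \<le> C"
            using C by (subst (asm) ennreal_le_iff) auto
          then have "(a / B) powr (1 / q) \<le> C * w x"
            using wp by (simp add: field_simps)
          then have "((a / B) powr (1 / q)) powr q \<le> (C * w x) powr q"
            using q by (intro powr_mono2) auto
          then have "a / B \<le> C powr q * w x powr q"
            using q a0 B C wp by (simp add: powr_powr powr_mult)
          then have "a \<le> C powr q * w x powr q * B"
            using B by (simp add: divide_le_eq)
          then show ?thesis
            unfolding a(1) B(2) by (intro ennreal_leI) (simp add: mult_ac)
        qed (simp add: a)
      qed
    qed
    with fin show ?thesis by blast
  qed
  show ?thesis
  proof (rule that)
    show "0 < C powr q * ?\<kappa>" using C by simp
  qed (use main in blast)+
qed

lemma wmeas_ball_mono: "ball y r \<subseteq> ball z R \<Longrightarrow> wmeas v (ball y r) \<le> wmeas v (ball z R)"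
  unfolding wmeas_def by (intro nn_integral_mono) (auto simp: indicator_def)

text \<open>The convention \<open>0 * \<infinity> = 0\<close> admits the weight that vanishes almost
  everywhere, for which balls have measure 0. For any other weight one null ball would make every
  ball containing it null, by the bound at points where \<open>w\<close> vanishes. That
  \<open>w\<close> inherits the condition from \<open>w powr q\<close> is Jensen's inequality, here
  with an extra factor 2.\<close>

lemma A1_class_cases:
  fixes w :: "real^'n \<Rightarrow> real"
  assumes A1: "A1_class q w" and q: "1 < q"
  shows "(AE x in lebesgue. w x = 0) \<or> (\<exists>C C'. A1_weight C (\<lambda>x. w x powr q) \<and> A1_weight C' w)"
proof (rule disjCI)
  assume nz: "\<not> (\<exists>C C'. A1_weight C (\<lambda>x. w x powr q) \<and> A1_weight C' w)"
  show "AE x in lebesgue. w x = 0"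
  proof (rule ccontr)
    assume not0: "\<not> (AE x in lebesgue. w x = 0)"
    let ?v = "\<lambda>x. w x powr q"
    have w0: "0 \<le> w x" for x using A1 by (simp add: A1_class_def weight_def)
    have wi: "locally_integrable w" using A1 by (simp add: A1_class_def weight_def)
    have [measurable]: "w \<in> borel_measurable lebesgue" using wi by (rule locally_integrable_measurable)
    have [measurable]: "?v \<in> borel_measurable lebesgue" by measurable
    obtain C where C: "0 < C" and fin: "\<And>y r. 0 < r \<Longrightarrow> wmeas ?v (ball y r) < \<infinity>"
      and le: "\<And>y r. 0 < r \<Longrightarrow> AE x in lebesgue. x \<in> ball y r \<longrightarrow> wmeas ?v (ball y r) \<le> ennreal (C * r ^ CARD('n) * ?v x)"
      by (rule A1_class_ball_bound[OF A1 q]) blast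
    have v0: "wmeas ?v (ball y r) = 0 \<longleftrightarrow> (AE x in lebesgue. x \<in> ball y r \<longrightarrow> w x = 0)" for y r
      by (subst wmeas_eq_0_iff) auto
    have "\<exists>k::nat. wmeas ?v (ball 0 (real k)) \<noteq> 0"
    proof (rule ccontr)
      assume "\<not> (\<exists>k::nat. wmeas ?v (ball 0 (real k)) \<noteq> 0)"
      then have "AE x in lebesgue. \<forall>k::nat. x \<in> ball 0 (real k) \<longrightarrow> w x = 0"
        unfolding v0 AE_all_countable by blast
      then have "AE x in lebesgue. w x = 0"
      proof eventually_elim
        case (elim x)
        obtain k :: nat where "norm x < real k" using reals_Archimedean2 by blast
        then show ?case using elim by auto
      qed
      with not0 show False by blast
    qed
    then obtain k :: nat where k: "wmeas ?v (ball 0 (real k)) \<noteq> 0" by blast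
    have pos: "wmeas ?v (ball y r) \<noteq> 0" if r: "0 < r" for y r
    proof
      assume z: "wmeas ?v (ball y r) = 0"
      \<comment> \<open>A ball about 0 that contains both the ball of positive measure and the
        supposed null ball.\<close>
      define R where "R = real k + norm y + r"
      have R: "0 < R" using r by (simp add: R_def add_nonneg_pos)
      have "wmeas ?v (ball 0 (real k)) \<le> wmeas ?v (ball 0 R)"
        using r by (intro wmeas_ball_mono ball_subset_ballI) (simp add: R_def)
      then have BR: "wmeas ?v (ball 0 R) \<noteq> 0" using k by auto
      have sub: "ball y r \<subseteq> ball 0 R"
        by (intro ball_subset_ballI) (simp add: R_def)
      have "AE x in lebesgue. x \<notin> ball y r"
        using le[OF R, of 0] z[unfolded v0]
      proof eventually_elim
        case (elim x)
        show ?case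
        proof
          assume x: "x \<in> ball y r"
          then have "w x = 0" "x \<in> ball 0 R" using elim sub by auto
          then have "wmeas ?v (ball 0 R) \<le> 0" using elim(1) q by simp
          with BR show False by simp
        qed
      qed
      with not_AE_outside_ball[OF r] show False by blast
    qed
    let ?\<kappa> = "unit_ball_vol (real CARD('n))"
    have all: "AE x in lebesgue. \<forall>r>0. wmeas ?v (ball x r) \<le> ennreal (C * 2 ^ CARD('n) * r ^ CARD('n) * ?v x)"
      using C le by (intro AE_all_balls wmeas_ball_mono) auto
    have em: "emeasure (weighted ?v) (ball y r) = wmeas ?v (ball y r)" "emeasure (weighted w) (ball y r) = wmeas w (ball y r)" for y r
      by (auto intro!: emeasure_weighted)
    have A: "A1_weight (C * 2 ^ CARD('n)) ?v"
    proof
      show "0 < r \<Longrightarrow> 0 < emeasure (weighted ?v) (ball y r)" for y r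
        using pos[of r y] by (simp add: em zero_less_iff_neq_zero)
      show "emeasure (weighted ?v) (ball y r) < \<infinity>" for y r
        using fin[of r y] unfolding em by (cases "0 < r") (auto simp: wmeas_def ball_empty)
      show "AE y in lebesgue. \<forall>r>0. emeasure (weighted ?v) (ball y r) \<le> ennreal (C * 2 ^ CARD('n) * r ^ CARD('n) * ?v y)"
        using all by (simp add: em)
    qed (use C in auto)
    interpret A: A1_weight "C * 2 ^ CARD('n)" ?v by (rule A)
    define C' where "C' = 2 * ?\<kappa> * (C * 2 ^ CARD('n) / ?\<kappa>) powr (1 / q)"
    have "?\<kappa> \<noteq> 0" using unit_ball_vol_pos[of "real CARD('n)"] by linarith
    then have C': "0 < C'"
      unfolding C'_def using C by (intro mult_pos_pos) auto
    have B: "A1_weight C' w"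
    proof
      show "0 < r \<Longrightarrow> 0 < emeasure (weighted w) (ball y r)" for y r
        using pos[of r y] unfolding em v0 zero_less_iff_neq_zero by (subst wmeas_eq_0_iff) (auto simp: w0)
      show "emeasure (weighted w) (ball y r) < \<infinity>" for y r
      proof -
        have "set_integrable lebesgue (ball y r) w"
          using wi by (intro set_integrable_locally_integrable) auto
        then have "(\<integral>\<^sup>+x. ennreal (norm (indicat_real (ball y r) x *\<^sub>R w x)) \<partial>lebesgue) < \<infinity>"
          by (simp add: set_integrable_def integrable_iff_bounded)
        also have "(\<integral>\<^sup>+x. ennreal (norm (indicat_real (ball y r) x *\<^sub>R w x)) \<partial>lebesgue) = wmeas w (ball y r)"
          unfolding wmeas_def using w0 by (intro nn_integral_cong) (auto simp: indicator_def)
        finally show ?thesis by (simp add: em)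
      qed
      show "AE y in lebesgue. \<forall>r>0. emeasure (weighted w) (ball y r) \<le> ennreal (C' * r ^ CARD('n) * w y)"
        using A.maximal_vol
      proof eventually_elim
        case (elim y)
        show ?case
        proof (intro allI impI)
          fix r :: real assume r: "0 < r"
          define S where "S = measure lebesgue (ball y r)"
          have S: "0 < S" "S = r ^ CARD('n) * ?\<kappa>"
            using measure_ball_pos[OF r, of y] measure_ball_scale[of r y] r by (auto simp: S_def)
          define V where "V = A.vol y r"
          have V: "0 < V" using A.vol_pos[OF r] by (simp add: V_def)
          \<comment> \<open>The mean of \<open>w powr q\<close> to the power \<open>1 / q\<close>.
            Splitting at height \<open>a\<close> gives
            \<open>w x \<le> a + a powr (1 - q) * w x powr q\<close>, and both terms have the
            integral \<open>S * a\<close> over the ball.\<close>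
          define a where "a = (V / S) powr (1 / q)"
          have a: "0 < a" using V S(1) by (simp add: a_def)
          have aq: "a powr q = V / S" using q V S(1) by (simp add: a_def powr_powr)
          have young: "w x \<le> a + a powr (1 - q) * ?v x" for x
          proof (cases "w x \<le> a")
            case False
            then have wx: "0 < w x" "a < w x" using a by auto
            then have "w x powr (1 - q) \<le> a powr (1 - q)"
              using a q by (intro powr_mono2') auto
            then have "w x powr (1 - q) * ?v x \<le> a powr (1 - q) * ?v x"
              by (intro mult_right_mono) auto
            moreover have "w x powr (1 - q) * ?v x = w x"
              using wx by (simp flip: powr_add)
            ultimately show ?thesis using a by simp
          qed (use a in \<open>simp add: add_increasing2\<close>)
          have "emeasure (weighted w) (ball y r) = (\<integral>\<^sup>+x\<in>ball y r. ennreal (w x) \<partial>lebesgue)"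
            by (simp add: em wmeas_def)
          also have "\<dots> \<le> (\<integral>\<^sup>+x. ennreal a * indicator (ball y r) x + ennreal (a powr (1 - q)) * (ennreal (?v x) * indicator (ball y r) x) \<partial>lebesgue)"
            using young a by (intro nn_integral_mono)
              (auto simp: indicator_def simp flip: ennreal_mult ennreal_plus intro!: ennreal_leI)
          also have "\<dots> = ennreal a * ennreal S + ennreal (a powr (1 - q)) * ennreal V"
          proof -
            have "(\<integral>\<^sup>+x\<in>ball y r. ennreal (?v x) \<partial>lebesgue) = ennreal V"
              using A.wmeas_ball[of y r] by (simp add: wmeas_def V_def)
            moreover have "emeasure lebesgue (ball y r) = ennreal S"
              unfolding S_def by (rule emeasure_ball_real)
            ultimately show ?thesis
              by (simp add: nn_integral_add nn_integral_cmult)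
          qed
          also have "\<dots> = ennreal (a * S + a powr (1 - q) * V)"
            using a S(1) V by (simp flip: ennreal_mult ennreal_plus)
          also have "a * S + a powr (1 - q) * V = 2 * S * a"
            using a S(1) V by (simp add: powr_diff aq field_simps)
          also have "ennreal (2 * S * a) \<le> ennreal (C' * r ^ CARD('n) * w y)"
          proof (rule ennreal_leI)
            have "V / S \<le> (C * 2 ^ CARD('n) * r ^ CARD('n) * ?v y) / S"
              unfolding V_def using elim r S by (intro divide_right_mono) auto
            also have "\<dots> = (C * 2 ^ CARD('n) / ?\<kappa>) * ?v y"
              unfolding S(2) using r by simp
            finally have "a \<le> ((C * 2 ^ CARD('n) / ?\<kappa>) * ?v y) powr (1 / q)"
              unfolding a_def using q V S(1) by (intro powr_mono2) auto
            also have "\<dots> = (C * 2 ^ CARD('n) / ?\<kappa>) powr (1 / q) * w y"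
              using q C w0 by (subst powr_mult) (auto simp: powr_powr)
            finally have "2 * S * a \<le> 2 * S * ((C * 2 ^ CARD('n) / ?\<kappa>) powr (1 / q) * w y)"
              using S by (intro mult_left_mono) auto
            also have "\<dots> = C' * r ^ CARD('n) * w y"
              unfolding S(2) C'_def by (simp only: mult_ac)
            finally show "2 * S * a \<le> C' * r ^ CARD('n) * w y" .
          qed
          finally show "emeasure (weighted w) (ball y r) \<le> ennreal (C' * r ^ CARD('n) * w y)" .
        qed
      qed
    qed (use C' w0 in auto)
    show False using nz A B by blast
  qed
qed

section \<open>The weak-type estimate\<close>

context commutator_setting
begin

definition amalgam_term :: "real \<Rightarrow> (real^'n \<Rightarrow> real) \<Rightarrow> real^'n \<Rightarrow> real \<Rightarrow> ennreal" where
  "amalgam_term t g y r = epowr (wmeas (\<lambda>x. w x powr q) (ball y r)) t * wmeas w (ball y r) * LlogL_norm w (ball y r) g"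

lemma amalgam_term_eq:
  assumes "0 < r"
  shows "amalgam_term t g y r = ennreal (om.vol y r powr t * W.vol y r) * LlogL_norm w (ball y r) g"
  using om.vol_pos[OF assms, of y]
  by (simp add: amalgam_term_def om.wmeas_ball W.wmeas_ball epowr_ennreal ennreal_mult)

lemma measurable_amalgam_term:
  assumes "0 < r" and [measurable]: "g \<in> borel_measurable lebesgue"
  shows "(\<lambda>y. amalgam_term t g y r) \<in> borel_measurable lebesgue"
proof -
  have [measurable]: "(\<lambda>y. wmeas (\<lambda>x. w x powr q) (ball y r)) \<in> borel_measurable lebesgue"
    "(\<lambda>y. wmeas w (ball y r)) \<in> borel_measurable lebesgue"
    "(\<lambda>y. LlogL_norm w (ball y r) g) \<in> borel_measurable lebesgue"
    using assms by (auto intro!: measurable_wmeas_ball_UNIV W.measurable_LlogL_norm)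
  show ?thesis
    unfolding amalgam_term_def by measurable
qed

text \<open>The factors 2 come from \<open>(e1 + e2) powr \<kappa> \<le> 2 * (e1 powr \<kappa> + e2
  powr \<kappa>)\<close>. The division by a power of \<open>om.\<theta>\<close> pays for an index
  shift: the far series starts at radius \<open>4 * r\<close>, which is the term with index 1 of the
  joint series.\<close>

definition sum_const :: "real \<Rightarrow> real \<Rightarrow> real" where
  "sum_const t l = 2 * (om.D powr - t * (local_const + 1) / l) + 2 * (cheb_const * far_const ((t + \<kappa>) / 2) / l) / om.\<theta> powr ((t + \<kappa>) / 2)"

lemma sum_const_pos:
  assumes "0 < l" "0 < t + \<kappa>"
  shows "0 < sum_const t l"
proof -
  have "0 < local_const + 1" using local_const_nonneg by linarith
  moreover have "0 < far_const ((t + \<kappa>) / 2)" using assms by (intro far_const_pos) auto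
  ultimately show ?thesis
    unfolding sum_const_def using assms cheb_const_pos om.D_ge_1 om.\<theta>_bounds by (intro add_pos_pos) auto
qed

text \<open>As \<open>t \<le> 0\<close>, doubling lets the power \<open>t\<close> of the measure of
  \<open>ball y0 r\<close> be replaced by that of \<open>ball y0 (2 * r)\<close>. The summand 1 next
  to \<open>local_const\<close> gives the positive constant that \<open>W.le_LlogL_norm\<close> asks
  for.\<close>

lemma near_bound:
  assumes r: "0 < r" and E: "E \<in> sets lebesgue" "E \<subseteq> ball y0 r" and l: "0 < l"
    and g: "g \<in> borel_measurable lebesgue" "\<And>x. 0 \<le> g x" and t: "t \<le> 0"
    and big: "\<And>x. x \<in> E \<Longrightarrow> ennreal l \<le> (\<integral>\<^sup>+y\<in>ball y0 (2 * r). ennreal (comm_kernel g x y) \<partial>lebesgue)"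
  shows "ennreal (om.vol y0 r powr t) * ennreal (measure \<omega> E powr \<kappa>)
    \<le> ennreal (om.D powr - t * (local_const + 1) / l) * amalgam_term t g y0 (2 * r)"
proof -
  have lc: "0 < local_const + 1" using local_const_nonneg by linarith
  have V: "0 < om.vol y0 (2 * r)" "0 < W.vol y0 (2 * r)"
    using r by (auto intro!: om.vol_pos W.vol_pos)
  let ?c = "(local_const + 1) * W.vol y0 (2 * r) / l"
  have "ennreal (measure \<omega> E powr \<kappa>) \<le> ennreal ?c * LlogL_norm w (ball y0 (2 * r)) g"
  proof (rule W.le_LlogL_norm)
    fix \<sigma> assume "W.admissible g y0 (2 * r) \<sigma>"
    then have \<sigma>: "0 < \<sigma>" "(\<integral>\<^sup>+x\<in>ball y0 (2 * r). ennreal (Phi (g x / \<sigma>) * w x) \<partial>lebesgue) \<le> ennreal (W.vol y0 (2 * r))"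
      using g(2) by (simp_all add: W.admissible_def)
    have "measure \<omega> E powr \<kappa> \<le> local_const * \<sigma> * W.vol y0 (2 * r) / l"
      by (rule local_estimate[OF r E l g big \<sigma>])
    also have "\<dots> \<le> (local_const + 1) * \<sigma> * W.vol y0 (2 * r) / l"
      using l V \<sigma> by (intro divide_right_mono mult_right_mono) auto
    finally show "ennreal (measure \<omega> E powr \<kappa>) \<le> ennreal (?c * \<sigma>)"
      by (intro ennreal_leI) (simp add: mult_ac)
  qed (use r lc V l in auto)
  then have "ennreal (om.vol y0 r powr t) * ennreal (measure \<omega> E powr \<kappa>)
      \<le> ennreal (om.D powr - t * om.vol y0 (2 * r) powr t) * (ennreal ?c * LlogL_norm w (ball y0 (2 * r)) g)"
  proof (intro mult_mono ennreal_leI)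
    have "om.vol y0 (2 * r) / om.D \<le> om.vol y0 r"
      using om.doubling[OF r, of y0] om.D_ge_1 by (simp add: divide_le_eq mult.commute)
    then have "om.vol y0 r powr t \<le> (om.vol y0 (2 * r) / om.D) powr t"
      using V om.D_ge_1 t by (intro powr_mono2') auto
    also have "\<dots> = om.D powr - t * om.vol y0 (2 * r) powr t"
      using V om.D_ge_1 by (simp add: powr_divide powr_minus field_simps)
    finally show "om.vol y0 r powr t \<le> om.D powr - t * om.vol y0 (2 * r) powr t" .
  qed auto
  also have "\<dots> = ennreal (om.D powr - t * om.vol y0 (2 * r) powr t * ?c) * LlogL_norm w (ball y0 (2 * r)) g"
  proof -
    have "ennreal (om.D powr - t * om.vol y0 (2 * r) powr t * ?c) = ennreal (om.D powr - t * om.vol y0 (2 * r) powr t) * ennreal ?c"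
      using lc V l by (intro ennreal_mult) auto
    then show ?thesis by (simp only: mult.assoc)
  qed
  also have "om.D powr - t * om.vol y0 (2 * r) powr t * ?c = (om.D powr - t * (local_const + 1) / l) * (om.vol y0 (2 * r) powr t * W.vol y0 (2 * r))"
    by simp
  also have "ennreal \<dots> * LlogL_norm w (ball y0 (2 * r)) g = ennreal (om.D powr - t * (local_const + 1) / l) * amalgam_term t g y0 (2 * r)"
  proof -
    have "ennreal ((om.D powr - t * (local_const + 1) / l) * (om.vol y0 (2 * r) powr t * W.vol y0 (2 * r)))
        = ennreal (om.D powr - t * (local_const + 1) / l) * ennreal (om.vol y0 (2 * r) powr t * W.vol y0 (2 * r))"
      using lc l by (intro ennreal_mult) auto
    then show ?thesis
      using r by (simp only: amalgam_term_eq[of "2 * r"] mult.assoc mult_pos_pos zero_less_numeral)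
  qed
  finally show ?thesis .
qed

text \<open>With \<open>V\<close> and \<open>U\<close> the measures of the small and of the
  \<open>j\<close>-th ball and \<open>p = (t + \<kappa>) / 2\<close>, the powers combine to
  \<open>V powr p * U powr (p - \<kappa>)\<close>. Reverse doubling bounds \<open>V powr p\<close>
  by a decaying multiple of \<open>U powr p\<close>, and \<open>2 * p - \<kappa> = t\<close> is the
  exponent of the amalgam norm.\<close>

lemma far_bound:
  assumes r: "0 < r" and E: "E \<in> sets lebesgue" "E \<subseteq> ball y0 r" and l: "0 < l"
    and g: "g \<in> borel_measurable lebesgue" "\<And>x. 0 \<le> g x" and t: "t \<le> 0" "0 < t + \<kappa>"
    and big: "\<And>x. x \<in> E \<Longrightarrow> ennreal l \<le> (\<integral>\<^sup>+y\<in>- ball y0 (2 * r). ennreal (comm_kernel g x y) \<partial>lebesgue)"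
  shows "ennreal (om.vol y0 r powr t) * ennreal (measure \<omega> E powr \<kappa>)
    \<le> (\<Sum>j. ennreal (cheb_const * far_const ((t + \<kappa>) / 2) / l * (om.\<theta> powr ((t + \<kappa>) / 2)) ^ j) * amalgam_term t g y0 (2 ^ (j + 2) * r))"
proof -
  define p where "p = (t + \<kappa>) / 2"
  have p: "0 < p" "p < 1" using t kappa by (auto simp: p_def)
  have fc: "0 < far_const p" using p by (intro far_const_pos)
  define \<rho> where "\<rho> j = 2 ^ (j + 2) * r" for j :: nat
  have \<rho>: "0 < \<rho> j" for j using r by (simp add: \<rho>_def)
  define V where "V = om.vol y0 r"
  have V: "0 < V" using r by (auto simp: V_def intro: om.vol_pos)
  have Vj: "0 < om.vol y0 (\<rho> j)" for j using \<rho> by (intro om.vol_pos)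
  define a where "a j = far_const p * om.vol y0 (\<rho> j) powr - \<kappa> * (om.vol y0 (\<rho> j) / V) powr p * W.vol y0 (\<rho> j)" for j
  have a0: "0 \<le> a j" for j using fc by (simp add: a_def)
  define S where "S = (\<Sum>j. ennreal (a j) * LlogL_norm w (ball y0 (\<rho> j)) g)"
  have "ennreal (measure \<omega> E powr \<kappa>) \<le> ennreal (cheb_const * V powr \<kappa> / l) * S"
    unfolding V_def
  proof (rule far_level_set[OF r E l])
    fix x assume x: "x \<in> E"
    have "ennreal l \<le> (\<integral>\<^sup>+y\<in>- ball y0 (2 * r). ennreal (comm_kernel g x y) \<partial>lebesgue)"
      using x by (rule big)
    also have "\<dots> \<le> ennreal (om.deviation y0 r x) * S"
      unfolding S_def a_def \<rho>_def V_def using x E(2) by (intro far_pointwise r p g) auto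
    finally show "ennreal l \<le> ennreal (om.deviation y0 r x) * S" .
  qed
  then have "ennreal (V powr t) * ennreal (measure \<omega> E powr \<kappa>) \<le> ennreal (V powr t) * (ennreal (cheb_const * V powr \<kappa> / l) * S)"
    by (intro mult_left_mono) auto
  also have "\<dots> = (\<Sum>j. ennreal (V powr t * (cheb_const * V powr \<kappa> / l)) * (ennreal (a j) * LlogL_norm w (ball y0 (\<rho> j)) g))"
  proof -
    have "ennreal (V powr t * (cheb_const * V powr \<kappa> / l)) = ennreal (V powr t) * ennreal (cheb_const * V powr \<kappa> / l)"
      using cheb_const_pos l by (intro ennreal_mult) auto
    then show ?thesis
      unfolding S_def ennreal_suminf_cmult by (simp only: mult.assoc)
  qed
  also have "\<dots> \<le> (\<Sum>j. ennreal (cheb_const * far_const p / l * (om.\<theta> powr p) ^ j) * amalgam_term t g y0 (\<rho> j))"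
  proof (intro suminf_le)
    fix j
    let ?U = "om.vol y0 (\<rho> j)" and ?L = "LlogL_norm w (ball y0 (\<rho> j)) g"
    have key: "V powr t * V powr \<kappa> * (?U powr - \<kappa> * (?U / V) powr p) \<le> (om.\<theta> powr p) ^ j * ?U powr t"
    proof -
      have "V \<le> om.\<theta> ^ (j + 2) * ?U"
        unfolding V_def \<rho>_def using r by (rule om.reverse_doubling_iterate)
      also have "\<dots> \<le> om.\<theta> ^ j * ?U"
        using om.\<theta>_bounds Vj by (intro mult_right_mono power_decreasing) auto
      finally have "V powr p \<le> (om.\<theta> ^ j * ?U) powr p"
        using V p by (intro powr_mono2) auto
      also have "\<dots> = (om.\<theta> powr p) ^ j * ?U powr p"
        using om.\<theta>_bounds by (simp add: powr_mult powr_realpow[symmetric] powr_powr powr_power mult.commute)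
      finally have Vp: "V powr p \<le> (om.\<theta> powr p) ^ j * ?U powr p" .
      have e1: "V powr t * V powr \<kappa> = V powr p * V powr p"
      proof -
        have "t + \<kappa> = p + p" by (simp add: p_def)
        then show ?thesis by (metis powr_add)
      qed
      have e2: "?U powr p * (?U powr - \<kappa> * ?U powr p) = ?U powr t"
      proof -
        have "p + (- \<kappa> + p) = t" by (simp add: p_def field_simps)
        then show ?thesis by (metis powr_add)
      qed
      have "V powr t * V powr \<kappa> * (?U powr - \<kappa> * (?U / V) powr p) = V powr p * (?U powr - \<kappa> * ?U powr p)"
        unfolding e1 using V Vj[of j] by (simp add: powr_divide)
      also have "\<dots> \<le> (om.\<theta> powr p) ^ j * ?U powr p * (?U powr - \<kappa> * ?U powr p)"
        using Vp by (intro mult_right_mono) auto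
      also have "\<dots> = (om.\<theta> powr p) ^ j * ?U powr t"
        using e2 by (simp only: mult.assoc)
      finally show ?thesis .
    qed
    have "V powr t * (cheb_const * V powr \<kappa> / l) * a j
        = (cheb_const * far_const p / l * W.vol y0 (\<rho> j)) * (V powr t * V powr \<kappa> * (?U powr - \<kappa> * (?U / V) powr p))"
      unfolding a_def divide_inverse[of _ l] by (simp only: mult_ac)
    also have "\<dots> \<le> (cheb_const * far_const p / l * W.vol y0 (\<rho> j)) * ((om.\<theta> powr p) ^ j * ?U powr t)"
      using key fc cheb_const_pos l by (intro mult_left_mono) auto
    also have "\<dots> = (cheb_const * far_const p / l * (om.\<theta> powr p) ^ j) * (?U powr t * W.vol y0 (\<rho> j))"
      by (simp only: mult_ac)
    finally have le: "V powr t * (cheb_const * V powr \<kappa> / l) * a j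
        \<le> (cheb_const * far_const p / l * (om.\<theta> powr p) ^ j) * (?U powr t * W.vol y0 (\<rho> j))" .
    have "ennreal (V powr t * (cheb_const * V powr \<kappa> / l)) * (ennreal (a j) * ?L)
        = ennreal (V powr t * (cheb_const * V powr \<kappa> / l) * a j) * ?L"
      using a0[of j] cheb_const_pos l by (subst ennreal_mult) (auto simp: mult.assoc)
    also have "\<dots> \<le> ennreal ((cheb_const * far_const p / l * (om.\<theta> powr p) ^ j) * (?U powr t * W.vol y0 (\<rho> j))) * ?L"
      using le by (intro mult_right_mono ennreal_leI) auto
    also have "\<dots> = ennreal (cheb_const * far_const p / l * (om.\<theta> powr p) ^ j) * amalgam_term t g y0 (\<rho> j)"
      unfolding amalgam_term_eq[OF \<rho>]
      using cheb_const_pos fc l by (subst ennreal_mult) (auto simp: mult.assoc)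
    finally show "ennreal (V powr t * (cheb_const * V powr \<kappa> / l)) * (ennreal (a j) * ?L)
        \<le> ennreal (cheb_const * far_const p / l * (om.\<theta> powr p) ^ j) * amalgam_term t g y0 (\<rho> j)" .
  qed auto
  finally show ?thesis
    by (simp only: V_def p_def \<rho>_def)
qed

text \<open>The near and far potentials sum to at least \<open>2 * l\<close> on \<open>E\<close>, so
  at each point one of them is at least \<open>l\<close>. Their level sets \<open>E1\<close> and
  \<open>E2\<close> are measurable and take the place of \<open>E\<close>.\<close>

lemma pointwise_bound:
  assumes r: "0 < r" and l: "0 < l"
    and g [measurable]: "g \<in> borel_measurable lebesgue" and g0: "\<And>x. 0 \<le> g x" and t: "t \<le> 0" "0 < t + \<kappa>"
    and E: "\<And>x. x \<in> E \<Longrightarrow> x \<in> ball y0 r \<and> ennreal (2 * l) \<le> (\<integral>\<^sup>+y. ennreal (comm_kernel g x y) \<partial>lebesgue)"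
  shows "epowr (wmeas (\<lambda>x. w x powr q) (ball y0 r)) t * epowr (wmeas (\<lambda>x. w x powr q) E) \<kappa>
    \<le> (\<Sum>j. ennreal (sum_const t l * (om.\<theta> powr ((t + \<kappa>) / 2)) ^ j) * amalgam_term t g y0 (2 ^ (j + 1) * r))"
proof -
  define T where "T A x = (\<integral>\<^sup>+y\<in>A. ennreal (comm_kernel g x y) \<partial>lebesgue)" for A x
  have [measurable]: "T A \<in> borel_measurable lebesgue" if [measurable]: "A \<in> sets lebesgue" for A
  proof -
    have "(\<lambda>z. ennreal (comm_kernel g (fst z) (snd z)) * indicator A (snd z)) \<in> borel_measurable (lebesgue \<Otimes>\<^sub>M lebesgue)"
      by measurable
    then show ?thesis
      unfolding T_def
      by (intro sigma_finite_measure.borel_measurable_nn_integral[OF sigma_finite_lebesgue]) (simp add: case_prod_beta)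
  qed
  let ?N = "ball y0 (2 * r)"
  define E1 where "E1 = ball y0 r \<inter> {x \<in> space lebesgue. ennreal l \<le> T ?N x}"
  define E2 where "E2 = ball y0 r \<inter> {x \<in> space lebesgue. ennreal l \<le> T (- ?N) x}"
  have [measurable]: "- ?N \<in> sets lebesgue" using sets.compl_sets[OF sets_lebesgue_ball, of y0 "2 * r"] by (simp add: Compl_eq_Diff_UNIV)
  have sE [measurable]: "E1 \<in> sets lebesgue" "E2 \<in> sets lebesgue"
    unfolding E1_def E2_def by measurable
  have sub: "E1 \<subseteq> ball y0 r" "E2 \<subseteq> ball y0 r" by (auto simp: E1_def E2_def)
  have EE: "E \<subseteq> E1 \<union> E2"
  proof
    fix x assume x: "x \<in> E"
    have [measurable]: "comm_kernel g x \<in> borel_measurable lebesgue"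
      unfolding comm_kernel_def riesz_kernel_def by measurable
    have "ennreal l + ennreal l = ennreal (2 * l)"
      using l by (simp flip: ennreal_plus)
    also have "\<dots> \<le> (\<integral>\<^sup>+y. ennreal (comm_kernel g x y) \<partial>lebesgue)"
      using E[OF x] by blast
    also have "\<dots> = (\<integral>\<^sup>+y. ennreal (comm_kernel g x y) * indicator ?N y + ennreal (comm_kernel g x y) * indicator (- ?N) y \<partial>lebesgue)"
      by (intro nn_integral_cong) (auto simp: indicator_def)
    also have "\<dots> = T ?N x + T (- ?N) x"
      unfolding T_def by (intro nn_integral_add) measurable
    finally have "ennreal l + ennreal l \<le> T ?N x + T (- ?N) x" .
    then have "ennreal l \<le> T ?N x \<or> ennreal l \<le> T (- ?N) x"
      by (metis add_strict_mono linorder_not_le)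
    with E[OF x] show "x \<in> E1 \<union> E2" by (auto simp: E1_def E2_def)
  qed
  define e1 where "e1 = measure \<omega> E1"
  define e2 where "e2 = measure \<omega> E2"
  have em: "emeasure \<omega> E1 = ennreal e1" "emeasure \<omega> E2 = ennreal e2"
    unfolding e1_def e2_def by (auto intro!: emeasure_eq_measure_fin om.emeasure_bounded_fin[OF sub(1)] om.emeasure_bounded_fin[OF sub(2)])
  have e0: "0 \<le> e1" "0 \<le> e2" by (simp_all add: e1_def e2_def)
  have "wmeas (\<lambda>x. w x powr q) E \<le> wmeas (\<lambda>x. w x powr q) (E1 \<union> E2)"
    unfolding wmeas_def using EE by (intro nn_integral_mono) (auto simp: indicator_def)
  also have "\<dots> = emeasure \<omega> (E1 \<union> E2)"
    by (intro emeasure_weighted[symmetric]) measurable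
  also have "\<dots> \<le> ennreal e1 + ennreal e2"
    unfolding em[symmetric] by (intro emeasure_subadditive) auto
  also have "\<dots> = ennreal (e1 + e2)" using e0 by simp
  finally have "epowr (wmeas (\<lambda>x. w x powr q) E) \<kappa> \<le> epowr (ennreal (e1 + e2)) \<kappa>"
    using kappa by (intro epowr_mono)
  also have "\<dots> = ennreal ((e1 + e2) powr \<kappa>)"
    using e0 kappa by (intro epowr_ennreal_nonneg) auto
  also have "\<dots> \<le> ennreal (2 * (e1 powr \<kappa> + e2 powr \<kappa>))"
  proof (rule ennreal_leI)
    have m: "max e1 e2 powr \<kappa> \<le> e1 powr \<kappa> + e2 powr \<kappa>" by (simp add: max_def)
    have "(e1 + e2) powr \<kappa> \<le> (2 * max e1 e2) powr \<kappa>"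
      using e0 kappa by (intro powr_mono2) auto
    also have "\<dots> = 2 powr \<kappa> * max e1 e2 powr \<kappa>"
      by (rule powr_mult)
    also have "\<dots> \<le> 2 powr 1 * (e1 powr \<kappa> + e2 powr \<kappa>)"
      using m kappa by (intro mult_mono powr_mono) auto
    finally show "(e1 + e2) powr \<kappa> \<le> 2 * (e1 powr \<kappa> + e2 powr \<kappa>)" by simp
  qed
  finally have Ek: "epowr (wmeas (\<lambda>x. w x powr q) E) \<kappa> \<le> ennreal (2 * (e1 powr \<kappa> + e2 powr \<kappa>))" .
  let ?V = "om.vol y0 r"
  have V: "0 < ?V" using r by (rule om.vol_pos)
  define N1 where "N1 = om.D powr - t * (local_const + 1) / l"
  define N2 where "N2 = cheb_const * far_const ((t + \<kappa>) / 2) / l"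
  define h where "h = om.\<theta> powr ((t + \<kappa>) / 2)"
  have h: "0 < h" using om.\<theta>_bounds by (simp add: h_def)
  have N1: "0 \<le> N1" using local_const_nonneg l by (simp add: N1_def)
  have "0 < far_const ((t + \<kappa>) / 2)" using t by (intro far_const_pos) auto
  then have N2: "0 \<le> N2" using cheb_const_pos l by (simp add: N2_def)
  have sc: "sum_const t l = 2 * N1 + 2 * N2 / h"
    by (simp add: sum_const_def N1_def N2_def h_def)
  let ?A = "\<lambda>j. amalgam_term t g y0 (2 ^ (j + 1) * r)"
  let ?f = "\<lambda>j. ennreal (sum_const t l * h ^ j) * ?A j"
  have B1: "ennreal (?V powr t) * ennreal (e1 powr \<kappa>) \<le> ennreal N1 * amalgam_term t g y0 (2 * r)"
    unfolding e1_def N1_def by (rule near_bound[OF r sE(1) sub(1) l g g0 t(1)]) (simp add: E1_def T_def)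
  have B2: "ennreal (?V powr t) * ennreal (e2 powr \<kappa>) \<le> (\<Sum>j. ennreal (N2 * h ^ j) * amalgam_term t g y0 (2 ^ (j + 2) * r))"
    unfolding e2_def N2_def h_def by (rule far_bound[OF r sE(2) sub(2) l g g0 t]) (simp add: E2_def T_def)
  have "epowr (wmeas (\<lambda>x. w x powr q) (ball y0 r)) t * epowr (wmeas (\<lambda>x. w x powr q) E) \<kappa>
      \<le> ennreal (?V powr t) * ennreal (2 * (e1 powr \<kappa> + e2 powr \<kappa>))"
    unfolding om.wmeas_ball epowr_ennreal[OF V] by (intro mult_left_mono Ek) auto
  also have "\<dots> = 2 * (ennreal (?V powr t) * ennreal (e1 powr \<kappa>)) + 2 * (ennreal (?V powr t) * ennreal (e2 powr \<kappa>))"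
    by (simp add: ennreal_mult ennreal_plus distrib_left mult_ac)
  also have "\<dots> \<le> 2 * (ennreal N1 * amalgam_term t g y0 (2 * r)) + 2 * (\<Sum>j. ennreal (N2 * h ^ j) * amalgam_term t g y0 (2 ^ (j + 2) * r))"
    by (intro add_mono mult_left_mono B1 B2) auto
  also have "\<dots> \<le> ?f 0 + (\<Sum>j. ?f (Suc j))"
  proof (intro add_mono)
    have "2 * (ennreal N1 * amalgam_term t g y0 (2 * r)) = ennreal (2 * N1) * amalgam_term t g y0 (2 * r)"
      using N1 by (simp add: ennreal_mult mult.assoc)
    also have "\<dots> \<le> ?f 0"
      using N2 h by (auto simp: sc intro!: mult_right_mono ennreal_leI)
    finally show "2 * (ennreal N1 * amalgam_term t g y0 (2 * r)) \<le> ?f 0" .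
    have "2 * (\<Sum>j. ennreal (N2 * h ^ j) * amalgam_term t g y0 (2 ^ (j + 2) * r))
        = (\<Sum>j. ennreal (2 * (N2 * h ^ j)) * amalgam_term t g y0 (2 ^ (j + 2) * r))"
    proof -
      have "ennreal (2 * (N2 * h ^ j)) = 2 * ennreal (N2 * h ^ j)" for j
        using N2 h by (subst ennreal_mult) auto
      then show ?thesis
        by (simp only: mult.assoc ennreal_suminf_cmult)
    qed
    also have "\<dots> \<le> (\<Sum>j. ?f (Suc j))"
    proof (intro suminf_le)
      fix j
      have "2 * (N2 * h ^ j) = (2 * N2 / h) * h ^ Suc j" using h by simp
      also have "\<dots> \<le> sum_const t l * h ^ Suc j"
        unfolding sc using N1 h by (intro mult_right_mono) auto
      finally show "ennreal (2 * (N2 * h ^ j)) * amalgam_term t g y0 (2 ^ (j + 2) * r) \<le> ?f (Suc j)"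
        by (auto intro!: mult_mono ennreal_leI)
    qed auto
    finally show "2 * (\<Sum>j. ennreal (N2 * h ^ j) * amalgam_term t g y0 (2 ^ (j + 2) * r)) \<le> (\<Sum>j. ?f (Suc j))" .
  qed
  also have "\<dots> = (\<Sum>j. ?f j)"
    using suminf_offset[of ?f 1] by (simp add: add.commute)
  finally show ?thesis by (simp only: h_def)
qed

end

section \<open>From the commutator to a positive kernel\<close>

lemma measurable_commutator:
  fixes b f :: "real^'n \<Rightarrow> complex"
  assumes [measurable]: "b \<in> borel_measurable lebesgue" "f \<in> borel_measurable lebesgue"
  shows "commutator b \<gamma> f \<in> borel_measurable lebesgue"
proof -
  have "(\<lambda>z. (b (fst z) - b (snd z)) * f (snd z) / complex_of_real (norm (fst z - snd z) powr (real CARD('n) - \<gamma>)))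
      \<in> borel_measurable (lebesgue \<Otimes>\<^sub>M (lebesgue :: (real^'n) measure))"
    by measurable
  then have "(\<lambda>x. LINT y|lebesgue. (b x - b y) * f y / complex_of_real (norm (x - y) powr (real CARD('n) - \<gamma>))) \<in> borel_measurable lebesgue"
    by (intro sigma_finite_measure.borel_measurable_lebesgue_integral[OF sigma_finite_lebesgue]) (simp add: case_prod_beta)
  then have [measurable]: "(\<lambda>x. LINT y|lebesgue. (b x - b y) * f y / complex_of_real (norm (x - y) powr (real CARD('n) - \<gamma>))) \<in> borel_measurable lebesgue" .
  show ?thesis
    unfolding commutator_def[abs_def] by measurable
qed

text \<open>Linearity in \<open>f\<close> and \<open>s \<le> Phi s\<close> at
  \<open>s = norm (f y) / t\<close> remove \<open>t\<close>: the threshold for the positive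
  potential depends only on the normalizing constant. Adding 1 keeps the denominator positive. Where
  the integral does not converge absolutely, the Bochner integral is 0 and its bound by the
  potential is trivial.\<close>

lemma (in commutator_setting) norm_commutator_le:
  fixes f :: "real^'n \<Rightarrow> complex"
  assumes [measurable]: "f \<in> borel_measurable lebesgue"
    and t: "0 < t" and x: "t < norm (commutator b \<gamma> f x)"
  shows "ennreal (2 * (1 / (2 * (\<bar>1 / riesz_const (real CARD('n)) \<gamma>\<bar> + 1))))
    \<le> (\<integral>\<^sup>+y. ennreal (comm_kernel (\<lambda>x. Phi (norm (f x) / t)) x y) \<partial>lebesgue)"
proof -
  let ?z = "\<bar>1 / riesz_const (real CARD('n)) \<gamma>\<bar>"
  let ?h = "\<lambda>y. (b x - b y) * f y / complex_of_real (norm (x - y) powr (real CARD('n) - \<gamma>))"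
  let ?I = "\<integral>\<^sup>+y. ennreal (comm_kernel (\<lambda>x. Phi (norm (f x) / t)) x y) \<partial>lebesgue"
  have ptw: "norm (?h y) \<le> t * comm_kernel (\<lambda>x. Phi (norm (f x) / t)) x y" for y
  proof -
    have "norm (f y) \<le> t * Phi (norm (f y) / t)"
      using Phi_ge_self[of "norm (f y) / t"] t by (simp add: field_simps)
    then have "(norm (b x - b y) * riesz_kernel \<gamma> x y) * norm (f y) \<le> (norm (b x - b y) * riesz_kernel \<gamma> x y) * (t * Phi (norm (f y) / t))"
      by (intro mult_left_mono) auto
    then show ?thesis
      by (simp add: comm_kernel_def riesz_kernel_def norm_mult norm_divide mult_ac)
  qed
  have "ennreal (norm (LINT y|lebesgue. ?h y)) \<le> ennreal t * ?I"
  proof (cases "integrable lebesgue ?h")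
    case True
    have "ennreal (norm (LINT y|lebesgue. ?h y)) \<le> (\<integral>\<^sup>+y. ennreal (norm (?h y)) \<partial>lebesgue)"
      using True by (rule integral_norm_bound_ennreal)
    also have "\<dots> \<le> (\<integral>\<^sup>+y. ennreal t * ennreal (comm_kernel (\<lambda>x. Phi (norm (f x) / t)) x y) \<partial>lebesgue)"
      using ptw t by (intro nn_integral_mono) (auto simp: ennreal_mult'[symmetric] intro!: ennreal_leI)
    also have "\<dots> = ennreal t * ?I"
      unfolding comm_kernel_def riesz_kernel_def by (intro nn_integral_cmult) measurable
    finally show ?thesis .
  qed (simp add: not_integrable_integral_eq)
  then have "ennreal ?z * ennreal (norm (LINT y|lebesgue. ?h y)) \<le> ennreal ?z * (ennreal t * ?I)"
    by (rule mult_left_mono) simp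
  also have "ennreal ?z * ennreal (norm (LINT y|lebesgue. ?h y)) = ennreal (norm (commutator b \<gamma> f x))"
    unfolding commutator_def norm_mult norm_of_real by (rule ennreal_mult[symmetric]) auto
  finally have "ennreal (norm (commutator b \<gamma> f x)) \<le> ennreal ?z * (ennreal t * ?I)" .
  moreover have "ennreal t < ennreal (norm (commutator b \<gamma> f x))"
    using x t by (simp add: ennreal_less_iff)
  ultimately have "ennreal t < ennreal ?z * (ennreal t * ?I)"
    by (rule less_le_trans[rotated])
  also have "\<dots> \<le> ennreal (?z + 1) * (ennreal t * ?I)"
    by (intro mult_right_mono ennreal_leI) auto
  finally have "ennreal t * 1 \<le> ennreal t * (ennreal (?z + 1) * ?I)"
    by (simp add: mult_ac)
  then have "1 \<le> ennreal (?z + 1) * ?I"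
    using t by (subst (asm) ennreal_mult_le_mult_iff) auto
  then have "ennreal (1 / (?z + 1)) * 1 \<le> ennreal (1 / (?z + 1)) * (ennreal (?z + 1) * ?I)"
    by (intro mult_left_mono) auto
  also have "\<dots> = ennreal (1 / (?z + 1) * (?z + 1)) * ?I"
    by (subst ennreal_mult) (auto simp: mult.assoc)
  also have "1 / (?z + 1) * (?z + 1) = 1"
    by (simp add: add_nonneg_eq_0_iff)
  finally have "ennreal (1 / (?z + 1)) \<le> ?I" by simp
  moreover have "2 * (1 / (2 * (x + 1))) = 1 / (x + 1)" for x :: real
    by (metis mult_divide_mult_cancel_left mult.right_neutral times_divide_eq_right zero_neq_numeral)
  ultimately show ?thesis by (simp only:)
qed

theorem theorem2p4:
  fixes w \<mu> :: "real^'n \<Rightarrow> real"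
    and b :: "real^'n \<Rightarrow> complex"
    and \<gamma> q \<alpha> \<beta> :: real
    and s :: ennreal
  assumes "0 < \<gamma>" and "\<gamma> < real CARD('n)"
    and "q = real CARD('n) / (real CARD('n) - \<gamma>)"
    and "A1_class q w"
    and "1 \<le> \<alpha>" and "\<alpha> < \<beta>" and "ennreal \<beta> < s"
    and "1 / \<beta> = 1 / \<alpha> - \<gamma> / real CARD('n)"
    and "doubling \<mu>"
    and "b \<in> BMO"
  shows "\<exists>C>0. \<forall>t>0. \<forall>r>0. \<forall>f :: real^'n \<Rightarrow> complex. locally_integrable f \<longrightarrow>
    Ls_norm s \<mu> (\<lambda>y.
        epowr (wmeas (\<lambda>x. w x powr q) (ball y r)) (1 / \<beta> - 1 / q - recip s)
          * epowr (wmeas (\<lambda>x. w x powr q) {x \<in> ball y r. norm (commutator b \<gamma> f x) > t}) (1 / q))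
      \<le> ennreal C *
        amalgam_LlogL_norm \<alpha> s w (\<lambda>x. w x powr q) \<mu> (\<lambda>x. Phi (norm (f x) / t))"
proof -
  have q1: "1 < q" using assms(1-3) by simp
  have \<beta>: "1 < \<beta>" using assms(5,6) by linarith
  have s0: "0 < s" using assms(7) by (rule le_less_trans[rotated]) simp
  have \<mu>: "\<mu> \<in> borel_measurable lebesgue"
    using assms(9) by (simp add: doubling_def weight_measurable)
  have w: "weight w" using assms(4) by (simp add: A1_class_def)
  have w0: "0 \<le> w x" for x using w by (simp add: weight_def)
  have [measurable]: "w \<in> borel_measurable lebesgue" using w by (rule weight_measurable)
  have bl: "locally_integrable b" using assms(10) by (rule BMO_locally_integrable)
  have [measurable]: "b \<in> borel_measurable lebesgue" using bl by (rule locally_integrable_measurable)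
  define F where "F t r f y = epowr (wmeas (\<lambda>x. w x powr q) (ball y r)) (1 / \<beta> - 1 / q - recip s)
          * epowr (wmeas (\<lambda>x. w x powr q) {x \<in> ball y r. norm (commutator b \<gamma> f x) > t}) (1 / q)"
    for t r and f :: "real^'n \<Rightarrow> complex" and y
  from A1_class_cases[OF assms(4) q1] show ?thesis
  proof
    \<comment> \<open>The degenerate weight: level sets have measure 0 and \<open>1 / q > 0\<close>,
      so the left side vanishes even where its other factor is infinite.\<close>
    assume ae: "AE x in lebesgue. w x = 0"
    have "F t r f = (\<lambda>y. 0)" for t r f
    proof
      fix y
      have "wmeas (\<lambda>x. w x powr q) {x \<in> ball y r. norm (commutator b \<gamma> f x) > t} = (\<integral>\<^sup>+x. 0 \<partial>(lebesgue :: (real^'n) measure))"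
        unfolding wmeas_def using ae q1 by (intro nn_integral_cong_AE) (auto elim!: eventually_mono)
      then show "F t r f y = 0" using q1 by (simp add: F_def)
    qed
    moreover have "Ls_norm s \<mu> (\<lambda>y. 0) = 0"
    proof (cases s)
      case (real p)
      then have "0 < p" using s0 by (simp add: less_le)
      with real show ?thesis by (simp add: Ls_norm_def recip_ennreal)
    next
      case top
      have "esssup (density lebesgue (\<lambda>y. ennreal (\<mu> y))) (\<lambda>y. 0 :: ennreal) \<le> 0"
        by (rule esssup_I) auto
      with top show ?thesis by (simp add: Ls_norm_def)
    qed
    ultimately have "Ls_norm s \<mu> (F t r f) \<le> ennreal 1 * X" for t r f X by simp
    then show ?thesis unfolding F_def using zero_less_one by blast
  next
    assume "\<exists>C C'. A1_weight C (\<lambda>x. w x powr q) \<and> A1_weight C' w"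
    then obtain Co Cw where A: "A1_weight Co (\<lambda>x. w x powr q)" and B: "A1_weight Cw w" by blast
    obtain co Ko where o: "0 < co" "0 < Ko" "\<forall>y r. 0 < r \<longrightarrow>
      (\<integral>\<^sup>+x\<in>ball y r. ennreal (exp (co * norm (b x - ball_mean b (ball y r)))) \<partial>weighted (\<lambda>x. w x powr q))
        \<le> ennreal (Ko * A1_weight.vol (\<lambda>x. w x powr q) y r)"
      using A1_weight.John_Nirenberg_ball[OF A assms(10)] by blast
    obtain cw Kw where ow: "0 < cw" "0 < Kw" "\<forall>y r. 0 < r \<longrightarrow>
      (\<integral>\<^sup>+x\<in>ball y r. ennreal (exp (cw * norm (b x - ball_mean b (ball y r)))) \<partial>weighted w)
        \<le> ennreal (Kw * A1_weight.vol w y r)"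
      using A1_weight.John_Nirenberg_ball[OF B assms(10)] by blast
    have LA: "A1_BMO Co (\<lambda>x. w x powr q) b co Ko"
      using A o by (auto intro!: A1_BMO.intro A1_BMO_axioms.intro)
    have LB: "A1_BMO Cw w b cw Kw"
      using B ow by (auto intro!: A1_BMO.intro A1_BMO_axioms.intro)
    interpret commutator_setting w b q Co co Ko Cw cw Kw \<gamma>
      using LA LB assms(1-3) by (intro commutator_setting.intro commutator_setting_axioms.intro)
    define t' where "t' = 1 / \<beta> - 1 / q - recip s"
    have rs: "0 \<le> recip s" "recip s < 1 / \<beta>"
    proof -
      show "0 \<le> recip s" by (simp add: recip_def)
      show "recip s < 1 / \<beta>"
      proof (cases s)
        case (real p)
        then have "\<beta> < p" using assms(7) \<beta> by (simp add: ennreal_less_iff)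
        with real \<beta> show ?thesis by (simp add: recip_ennreal frac_less2)
      next
        case top
        with \<beta> show ?thesis by (simp add: recip_def)
      qed
    qed
    have qk: "1 / q = 1 - \<gamma> / real CARD('n)"
      using assms(1,2) by (subst assms(3)) (simp add: field_simps)
    \<comment> \<open>The relation between \<alpha> and \<beta> together with
      \<open>1 / q = 1 - \<gamma> / real CARD('n)\<close> gives both sides the same power of the
      measure of a ball.\<close>
    have t'_eq: "t' = 1 / \<alpha> - 1 - recip s"
      unfolding t'_def qk assms(8) by simp
    have "1 / \<alpha> \<le> 1" using assms(5) by simp
    \<comment> \<open>\<open>t' + \<kappa>\<close> equals \<open>1 / \<beta> - recip s\<close>,
      which is positive because \<beta> lies strictly below \<open>s\<close>; this is the room for
      geometric decay.\<close>
    then have t': "t' \<le> 0" "0 < t' + \<kappa>"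
      using rs unfolding t'_eq by (simp, simp add: \<kappa>_def t'_eq[symmetric] t'_def)
    \<comment> \<open>\<open>norm_commutator_le\<close> gives the threshold \<open>2 * l\<close>:
      one \<open>l\<close> for the near and one for the far potential.\<close>
    define l where "l = 1 / (2 * (\<bar>1 / riesz_const (real CARD('n)) \<gamma>\<bar> + 1))"
    have l: "0 < l" by (simp add: l_def add_nonneg_pos)
    define h where "h = om.\<theta> powr ((t' + \<kappa>) / 2)"
    have h: "0 < h" "h < 1"
      using om.\<theta>_bounds theta_powr[of "(t' + \<kappa>) / 2"] t' by (auto simp: h_def)
    have "0 < sum_const t' l" using l t' by (intro sum_const_pos)
    \<comment> \<open>\<open>C\<close> is obtained before level, radius and function are introduced,
      so it is independent of them.\<close>
    from Ls_norm_geometric[OF s0 this h \<mu>] obtain C where C: "0 < C"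
      and LC: "\<And>F G N. F \<in> borel_measurable lebesgue \<Longrightarrow> (\<And>j. G j \<in> borel_measurable lebesgue) \<Longrightarrow>
        (\<And>y. F y \<le> (\<Sum>j. ennreal (sum_const t' l * h ^ j) * G j y)) \<Longrightarrow> (\<And>j. Ls_norm s \<mu> (G j) \<le> N) \<Longrightarrow>
        Ls_norm s \<mu> F \<le> ennreal C * N"
      by blast
    have "Ls_norm s \<mu> (F t r f) \<le> ennreal C * amalgam_LlogL_norm \<alpha> s w (\<lambda>x. w x powr q) \<mu> (\<lambda>x. Phi (norm (f x) / t))"
      if t: "0 < t" and r: "0 < r" and f: "locally_integrable f" for t r f
    proof (rule LC)
      let ?g = "\<lambda>x. Phi (norm (f x) / t)"
      have [measurable]: "f \<in> borel_measurable lebesgue" using f by (rule locally_integrable_measurable)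
      have [measurable]: "commutator b \<gamma> f \<in> borel_measurable lebesgue" by (intro measurable_commutator) measurable
      have g: "?g \<in> borel_measurable lebesgue" by measurable
      have g0: "0 \<le> ?g x" for x using t by (intro Phi_nonneg) auto
      show "F t r f \<in> borel_measurable lebesgue"
      proof -
        have "{x. t < norm (commutator b \<gamma> f x)} = {x \<in> space lebesgue. t < norm (commutator b \<gamma> f x)}" by simp
        also have "\<dots> \<in> sets lebesgue" by measurable
        finally have "{x. t < norm (commutator b \<gamma> f x)} \<in> sets lebesgue" .
        then have [measurable]: "(\<lambda>y. wmeas (\<lambda>x. w x powr q) {x \<in> ball y r. norm (commutator b \<gamma> f x) > t}) \<in> borel_measurable lebesgue"
          using measurable_wmeas_ball[of "\<lambda>x. w x powr q" "{x. t < norm (commutator b \<gamma> f x)}" r] by simp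
        have [measurable]: "(\<lambda>y. wmeas (\<lambda>x. w x powr q) (ball y r)) \<in> borel_measurable lebesgue"
          by (intro measurable_wmeas_ball_UNIV) measurable
        show ?thesis
          unfolding F_def[abs_def] by measurable
      qed
      have rj: "0 < 2 ^ (j + 1) * r" for j :: nat using r by simp
      show "(\<lambda>y. amalgam_term t' ?g y (2 ^ (j + 1) * r)) \<in> borel_measurable lebesgue" for j
        by (intro measurable_amalgam_term rj g)
      show "F t r f y \<le> (\<Sum>j. ennreal (sum_const t' l * h ^ j) * amalgam_term t' ?g y (2 ^ (j + 1) * r))" for y
      proof -
        have "F t r f y = epowr (wmeas (\<lambda>x. w x powr q) (ball y r)) t'
            * epowr (wmeas (\<lambda>x. w x powr q) {x \<in> ball y r. norm (commutator b \<gamma> f x) > t}) \<kappa>"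
          by (simp only: F_def t'_def \<kappa>_def)
        also have "\<dots> \<le> (\<Sum>j. ennreal (sum_const t' l * h ^ j) * amalgam_term t' ?g y (2 ^ (j + 1) * r))"
          unfolding h_def
        proof (rule pointwise_bound[OF r l g g0 t'])
          fix x assume "x \<in> {x \<in> ball y r. norm (commutator b \<gamma> f x) > t}"
          then show "x \<in> ball y r \<and> ennreal (2 * l) \<le> (\<integral>\<^sup>+y. ennreal (comm_kernel ?g x y) \<partial>lebesgue)"
            unfolding l_def using norm_commutator_le[of f t x] t by auto
        qed
        finally show ?thesis .
      qed
      show "Ls_norm s \<mu> (\<lambda>y. amalgam_term t' ?g y (2 ^ (j + 1) * r)) \<le>
          amalgam_LlogL_norm \<alpha> s w (\<lambda>x. w x powr q) \<mu> ?g" for j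
        unfolding amalgam_LlogL_norm_def amalgam_term_def t'_eq
        by (rule SUP_upper2[of "2 ^ (j + 1) * r"]) (use rj in auto)
    qed
    then show ?thesis unfolding F_def using C by blast
  qed
qed

end
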